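(* Let $k$ be a field of characteristic zero and $H$ a subgroup of a finite group $G$. If the group algebra extension $kG \supseteq kH$ is uniquely separable, then it has depth $1$.
   Context: Let $A \supseteq B$ be a ring extension ($B$ a subring of $A$ with the same unit). A separability element of $A \supseteq B$ is an element $e = e^1 \otimes_B e^2 \in A \otimes_B A$ (summation suppressed) with $ae = ea$ for all $a \in A$ and $e^1 e^2 = 1$. The extension is uniquely separable if it has exactly one separability element. $A \supseteq B$ has depth $1$ if for some positive integer $n$ the natural $B$-$B$-bimodule $A$ is isomorphic to a direct summand of the direct sum of $n$ copies of ${}_BB_B$ (equivalently, ${}_BA_B$ and ${}_BB_B$ are each isomorphic to a direct summand of a finite direct sum of copies of the other). *)

theory Defs
  imports "HOL-Algebra.Module" "HOL-Algebra.Subrings" "HOL-Algebra.Free_Abelian_Groups"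
begin

section \<open>Bimodules over (non-commutative) rings\<close>

text \<open>As for \<open>module\<close> in \<open>HOL-Algebra\<close>, the fields \<open>mult\<close> and \<open>one\<close> that the record inherits
  from \<open>ring\<close> play no role: a bimodule consists of the additive group and the two actions.\<close>

record ('a, 'm, 'b) bimodule = "('a, 'm) module" +
  rsmult :: "['m, 'b] \<Rightarrow> 'm" (infixl \<open>\<odot>\<^sub>r\<index>\<close> 70)

locale bimodule = R: ring R + S: ring S + M: abelian_group M
  for R :: "('a, 'x) ring_scheme" and S :: "('b, 'y) ring_scheme"
    and M :: "('a, 'm, 'b) bimodule" +
  assumes lact_closed:
      "\<lbrakk>a \<in> carrier R; x \<in> carrier M\<rbrakk> \<Longrightarrow> a \<odot>\<^bsub>M\<^esub> x \<in> carrier M"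
    and lact_add_scalar:
      "\<lbrakk>a \<in> carrier R; b \<in> carrier R; x \<in> carrier M\<rbrakk>
        \<Longrightarrow> (a \<oplus>\<^bsub>R\<^esub> b) \<odot>\<^bsub>M\<^esub> x = a \<odot>\<^bsub>M\<^esub> x \<oplus>\<^bsub>M\<^esub> b \<odot>\<^bsub>M\<^esub> x"
    and lact_add:
      "\<lbrakk>a \<in> carrier R; x \<in> carrier M; y \<in> carrier M\<rbrakk>
        \<Longrightarrow> a \<odot>\<^bsub>M\<^esub> (x \<oplus>\<^bsub>M\<^esub> y) = a \<odot>\<^bsub>M\<^esub> x \<oplus>\<^bsub>M\<^esub> a \<odot>\<^bsub>M\<^esub> y"
    and lact_assoc:
      "\<lbrakk>a \<in> carrier R; b \<in> carrier R; x \<in> carrier M\<rbrakk>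
        \<Longrightarrow> (a \<otimes>\<^bsub>R\<^esub> b) \<odot>\<^bsub>M\<^esub> x = a \<odot>\<^bsub>M\<^esub> (b \<odot>\<^bsub>M\<^esub> x)"
    and lact_one: "x \<in> carrier M \<Longrightarrow> \<one>\<^bsub>R\<^esub> \<odot>\<^bsub>M\<^esub> x = x"
    and ract_closed:
      "\<lbrakk>x \<in> carrier M; c \<in> carrier S\<rbrakk> \<Longrightarrow> x \<odot>\<^sub>r\<^bsub>M\<^esub> c \<in> carrier M"
    and ract_add_scalar:
      "\<lbrakk>x \<in> carrier M; c \<in> carrier S; d \<in> carrier S\<rbrakk>
        \<Longrightarrow> x \<odot>\<^sub>r\<^bsub>M\<^esub> (c \<oplus>\<^bsub>S\<^esub> d) = x \<odot>\<^sub>r\<^bsub>M\<^esub> c \<oplus>\<^bsub>M\<^esub> x \<odot>\<^sub>r\<^bsub>M\<^esub> d"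
    and ract_add:
      "\<lbrakk>x \<in> carrier M; y \<in> carrier M; c \<in> carrier S\<rbrakk>
        \<Longrightarrow> (x \<oplus>\<^bsub>M\<^esub> y) \<odot>\<^sub>r\<^bsub>M\<^esub> c = x \<odot>\<^sub>r\<^bsub>M\<^esub> c \<oplus>\<^bsub>M\<^esub> y \<odot>\<^sub>r\<^bsub>M\<^esub> c"
    and ract_assoc:
      "\<lbrakk>x \<in> carrier M; c \<in> carrier S; d \<in> carrier S\<rbrakk>
        \<Longrightarrow> x \<odot>\<^sub>r\<^bsub>M\<^esub> (c \<otimes>\<^bsub>S\<^esub> d) = (x \<odot>\<^sub>r\<^bsub>M\<^esub> c) \<odot>\<^sub>r\<^bsub>M\<^esub> d"
    and ract_one: "x \<in> carrier M \<Longrightarrow> x \<odot>\<^sub>r\<^bsub>M\<^esub> \<one>\<^bsub>S\<^esub> = x"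
    and lact_ract:
      "\<lbrakk>a \<in> carrier R; x \<in> carrier M; c \<in> carrier S\<rbrakk>
        \<Longrightarrow> (a \<odot>\<^bsub>M\<^esub> x) \<odot>\<^sub>r\<^bsub>M\<^esub> c = a \<odot>\<^bsub>M\<^esub> (x \<odot>\<^sub>r\<^bsub>M\<^esub> c)"

definition sub_bimodule ::
  "('a, 'x) ring_scheme \<Rightarrow> ('b, 'y) ring_scheme \<Rightarrow> 'm set \<Rightarrow> ('a, 'm, 'b) bimodule \<Rightarrow> bool"
  where "sub_bimodule R S D M \<longleftrightarrow>
    subgroup D (add_monoid M) \<and>
    (\<forall>a\<in>carrier R. \<forall>x\<in>D. a \<odot>\<^bsub>M\<^esub> x \<in> D) \<and>
    (\<forall>x\<in>D. \<forall>c\<in>carrier S. x \<odot>\<^sub>r\<^bsub>M\<^esub> c \<in> D)"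

definition bimodule_hom ::
  "('a, 'x) ring_scheme \<Rightarrow> ('b, 'y) ring_scheme \<Rightarrow> ('a, 'm, 'b) bimodule
    \<Rightarrow> ('a, 'n, 'b) bimodule \<Rightarrow> ('m \<Rightarrow> 'n) set"
  where "bimodule_hom R S M N =
    {f \<in> hom (add_monoid M) (add_monoid N).
      (\<forall>a\<in>carrier R. \<forall>x\<in>carrier M. f (a \<odot>\<^bsub>M\<^esub> x) = a \<odot>\<^bsub>N\<^esub> f x) \<and>
      (\<forall>x\<in>carrier M. \<forall>c\<in>carrier S. f (x \<odot>\<^sub>r\<^bsub>M\<^esub> c) = f x \<odot>\<^sub>r\<^bsub>N\<^esub> c)}"

definition bimodule_isomorphic ::
  "('a, 'x) ring_scheme \<Rightarrow> ('b, 'y) ring_scheme \<Rightarrow> ('a, 'm, 'b) bimodule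
    \<Rightarrow> ('a, 'n, 'b) bimodule \<Rightarrow> bool"
  where "bimodule_isomorphic R S M N \<longleftrightarrow>
    (\<exists>f \<in> bimodule_hom R S M N. bij_betw f (carrier M) (carrier N))"

definition direct_summand ::
  "('a, 'x) ring_scheme \<Rightarrow> ('b, 'y) ring_scheme \<Rightarrow> 'm set \<Rightarrow> ('a, 'm, 'b) bimodule \<Rightarrow> bool"
  where "direct_summand R S D M \<longleftrightarrow>
    sub_bimodule R S D M \<and>
    (\<exists>E. sub_bimodule R S E M \<and> D <+>\<^bsub>M\<^esub> E = carrier M \<and> D \<inter> E = {\<zero>\<^bsub>M\<^esub>})"

text \<open>The direct sum of \<open>n\<close> copies of \<open>M\<close>.\<close>

definition bimodule_power :: "('a, 'm, 'b) bimodule \<Rightarrow> nat \<Rightarrow> ('a, nat \<Rightarrow> 'm, 'b) bimodule"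
  where "bimodule_power M n =
    \<lparr>carrier = {..<n} \<rightarrow>\<^sub>E carrier M,
     monoid.mult = undefined, one = undefined,
     ring.zero = (\<lambda>i\<in>{..<n}. \<zero>\<^bsub>M\<^esub>),
     add = (\<lambda>u v. \<lambda>i\<in>{..<n}. u i \<oplus>\<^bsub>M\<^esub> v i),
     smult = (\<lambda>a u. \<lambda>i\<in>{..<n}. a \<odot>\<^bsub>M\<^esub> u i),
     rsmult = (\<lambda>u c. \<lambda>i\<in>{..<n}. u i \<odot>\<^sub>r\<^bsub>M\<^esub> c)\<rparr>"

lemma bimodule_bimodule_power:
  assumes "bimodule R S M"
  shows "bimodule R S (bimodule_power M n)"
proof -
  interpret bimodule R S M by fact
  have ag: "abelian_group (bimodule_power M n)"
  proof (rule abelian_groupI)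
    fix x assume x: "x \<in> carrier (bimodule_power M n)"
    show "\<exists>y\<in>carrier (bimodule_power M n). y \<oplus>\<^bsub>bimodule_power M n\<^esub> x = \<zero>\<^bsub>bimodule_power M n\<^esub>"
      by (rule bexI[of _ "\<lambda>i\<in>{..<n}. \<ominus>\<^bsub>M\<^esub> x i"])
       (use x in \<open>auto simp: bimodule_power_def PiE_iff M.l_neg intro!: restrict_ext\<close>)
  qed (auto simp: bimodule_power_def PiE_iff M.a_ac extensional_def fun_eq_iff)
  show ?thesis
    by (intro bimodule.intro bimodule_axioms.intro R.ring_axioms S.ring_axioms ag)
      (auto simp: bimodule_power_def PiE_iff lact_closed ract_closed lact_add_scalar lact_add 
        lact_assoc lact_one ract_add_scalar ract_add ract_assoc ract_one lact_ract
        extensional_def fun_eq_iff)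
qed


section \<open>Tensor products\<close>

text \<open>\<open>M \<otimes>\<^sub>S N\<close> is the free abelian group on \<open>M \<times> N\<close> modulo the biadditivity and
  \<open>S\<close>-balancedness relations.  Its elements are the cosets of \<open>tensor_relations S M N\<close>.\<close>

definition tensor_relations ::
  "('s, 'x) ring_scheme \<Rightarrow> ('r, 'm, 's) bimodule \<Rightarrow> ('s, 'n, 't) bimodule
    \<Rightarrow> ('m \<times> 'n \<Rightarrow>\<^sub>0 int) set"
  where "tensor_relations S M N =
    generate (free_Abelian_group (carrier M \<times> carrier N))
      ({frag_of (x \<oplus>\<^bsub>M\<^esub> x', y) - frag_of (x, y) - frag_of (x', y) | x x' y.
          x \<in> carrier M \<and> x' \<in> carrier M \<and> y \<in> carrier N} \<union>
       {frag_of (x, y \<oplus>\<^bsub>N\<^esub> y') - frag_of (x, y) - frag_of (x, y') | x y y'.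
          x \<in> carrier M \<and> y \<in> carrier N \<and> y' \<in> carrier N} \<union>
       {frag_of (x \<odot>\<^sub>r\<^bsub>M\<^esub> s, y) - frag_of (x, s \<odot>\<^bsub>N\<^esub> y) | x s y.
          x \<in> carrier M \<and> s \<in> carrier S \<and> y \<in> carrier N})"

text \<open>The outer actions are \<open>a (x \<otimes> y) = (a x) \<otimes> y\<close> and \<open>(x \<otimes> y) c = x \<otimes> (y c)\<close>.  The image
  of a coset under the corresponding endomorphism of the free abelian group need not be a full
  coset, so the subgroup of relations is added to it again.\<close>

definition tensor_product ::
  "('s, 'x) ring_scheme \<Rightarrow> ('r, 'm, 's) bimodule \<Rightarrow> ('s, 'n, 't) bimodule
    \<Rightarrow> ('r, ('m \<times> 'n \<Rightarrow>\<^sub>0 int) set, 't) bimodule"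
  where "tensor_product S M N =
    (let F = free_Abelian_group (carrier M \<times> carrier N); Q = tensor_relations S M N in
    \<lparr>carrier = carrier (F Mod Q),
     monoid.mult = undefined, one = undefined,
     ring.zero = \<one>\<^bsub>F Mod Q\<^esub>,
     add = monoid.mult (F Mod Q),
     smult = (\<lambda>a U. Q <#>\<^bsub>F\<^esub> frag_extend (\<lambda>(x, y). frag_of (a \<odot>\<^bsub>M\<^esub> x, y)) ` U),
     rsmult = (\<lambda>U c. Q <#>\<^bsub>F\<^esub> frag_extend (\<lambda>(x, y). frag_of (x, y \<odot>\<^sub>r\<^bsub>N\<^esub> c)) ` U)\<rparr>)"


section \<open>Ring extensions\<close>

text \<open>A ring extension is given by a ring \<open>A\<close> and a set \<open>B\<close> with \<open>subring B A\<close>; the ring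
  structure on \<open>B\<close> is \<open>A\<lparr>carrier := B\<rparr>\<close>.

  \<open>regular_bimodule A C\<close> is \<open>C \<subseteq> A\<close> with left and right multiplication in \<open>A\<close> as actions.  The
  scalars are not part of the record, so \<open>regular_bimodule A (carrier A)\<close> serves as \<open>A\<close>-\<open>A\<close>-,
  \<open>A\<close>-\<open>B\<close>-, \<open>B\<close>-\<open>A\<close>- and \<open>B\<close>-\<open>B\<close>-bimodule.\<close>

definition regular_bimodule :: "('a, 'x) ring_scheme \<Rightarrow> 'a set \<Rightarrow> ('a, 'a, 'a) bimodule"
  where "regular_bimodule A C =
    \<lparr>carrier = C, monoid.mult = monoid.mult A, one = \<one>\<^bsub>A\<^esub>, ring.zero = \<zero>\<^bsub>A\<^esub>, add = add A,
     smult = monoid.mult A, rsmult = monoid.mult A\<rparr>"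

lemma bimodule_regular:
  assumes "ring A" "subring B A" "subring B' A" "subring C A" "B \<subseteq> C" "B' \<subseteq> C"
  shows "bimodule (A\<lparr>carrier := B\<rparr>) (A\<lparr>carrier := B'\<rparr>) (regular_bimodule A C)"
proof -
  interpret ring A by fact
  interpret C: ring "A\<lparr>carrier := C\<rparr>" using subring_is_ring assms by blast
  have CA: "C \<subseteq> carrier A" using assms subringE(1) by blast
  have ag: "abelian_group (regular_bimodule A C)"
  proof (rule abelian_groupI)
    fix x assume "x \<in> carrier (regular_bimodule A C)"
    then show "\<exists>y\<in>carrier (regular_bimodule A C).
        y \<oplus>\<^bsub>regular_bimodule A C\<^esub> x = \<zero>\<^bsub>regular_bimodule A C\<^esub>"
      using CA subringE(5)[OF assms(4)]
      by (intro bexI[of _ "\<ominus>\<^bsub>A\<^esub> x"]) (auto simp: regular_bimodule_def l_neg)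
  qed (use CA subringE(2,7)[OF assms(4)] in \<open>auto simp: regular_bimodule_def a_ac subset_eq\<close>)
  show ?thesis
    by (intro bimodule.intro bimodule_axioms.intro subring_is_ring assms(2,3) ag)
      (use CA assms(5,6) in \<open>auto simp: regular_bimodule_def l_distr r_distr m_assoc subset_eq
         intro: subringE(6)[OF assms(4)]\<close>)
qed

definition tensor_square ::
  "('a, 'x) ring_scheme \<Rightarrow> 'a set \<Rightarrow> ('a, ('a \<times> 'a \<Rightarrow>\<^sub>0 int) set, 'a) bimodule"
  where "tensor_square A B =
    tensor_product (A\<lparr>carrier := B\<rparr>)
      (regular_bimodule A (carrier A)) (regular_bimodule A (carrier A))"

text \<open>The multiplication map \<open>A \<otimes>\<^sub>B A \<rightarrow> A\<close>, \<open>x \<otimes> y \<mapsto> x y\<close>: its extension to the free abelian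
  group is constant on cosets of the relations.\<close>

definition frag_mult :: "('a, 'x) ring_scheme \<Rightarrow> ('a \<times> 'a \<Rightarrow>\<^sub>0 int) \<Rightarrow> 'a"
  where "frag_mult A u =
    (\<Oplus>\<^bsub>A\<^esub>p\<in>Poly_Mapping.keys u. [Poly_Mapping.lookup u p] \<cdot>\<^bsub>A\<^esub> (fst p \<otimes>\<^bsub>A\<^esub> snd p))"

definition tensor_mult :: "('a, 'x) ring_scheme \<Rightarrow> ('a \<times> 'a \<Rightarrow>\<^sub>0 int) set \<Rightarrow> 'a"
  where "tensor_mult A U = the_elem (frag_mult A ` U)"

definition separability_element ::
  "('a, 'x) ring_scheme \<Rightarrow> 'a set \<Rightarrow> ('a \<times> 'a \<Rightarrow>\<^sub>0 int) set \<Rightarrow> bool"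
  where "separability_element A B e \<longleftrightarrow>
    e \<in> carrier (tensor_square A B) \<and>
    (\<forall>a\<in>carrier A. a \<odot>\<^bsub>tensor_square A B\<^esub> e = e \<odot>\<^sub>r\<^bsub>tensor_square A B\<^esub> a) \<and>
    tensor_mult A e = \<one>\<^bsub>A\<^esub>"

definition uniquely_separable :: "('a, 'x) ring_scheme \<Rightarrow> 'a set \<Rightarrow> bool"
  where "uniquely_separable A B \<longleftrightarrow> (\<exists>!e. separability_element A B e)"

definition depth_one :: "('a, 'x) ring_scheme \<Rightarrow> 'a set \<Rightarrow> bool"
  where "depth_one A B \<longleftrightarrow>
    (let R = A\<lparr>carrier := B\<rparr> in
     \<exists>n>0. \<exists>D. direct_summand R R D (bimodule_power (regular_bimodule A B) n) \<and>
       bimodule_isomorphic R R (regular_bimodule A (carrier A))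
         ((bimodule_power (regular_bimodule A B) n)\<lparr>carrier := D\<rparr>))"


section \<open>Group algebras\<close>

text \<open>\<open>K[G]\<close> consists of the finitely supported functions \<open>G \<rightarrow> K\<close> with convolution.  Functions
  are extended by zero outside \<open>carrier G\<close>, so that for a subgroup \<open>H\<close> the carrier of the group
  algebra of \<open>G\<lparr>carrier := H\<rparr>\<close> is a subset, and in fact a subring, of the group algebra of \<open>G\<close>.\<close>

definition group_algebra ::
  "('k, 'x) ring_scheme \<Rightarrow> ('g, 'y) monoid_scheme \<Rightarrow> ('g \<Rightarrow> 'k) ring"
  where "group_algebra K G =
    \<lparr>carrier = {f. (\<forall>g\<in>carrier G. f g \<in> carrier K) \<and> (\<forall>g. g \<notin> carrier G \<longrightarrow> f g = \<zero>\<^bsub>K\<^esub>) \<and>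
                   finite {g. f g \<noteq> \<zero>\<^bsub>K\<^esub>}},
     monoid.mult = (\<lambda>f h x. if x \<in> carrier G
       then (\<Oplus>\<^bsub>K\<^esub>y\<in>{y \<in> carrier G. f y \<noteq> \<zero>\<^bsub>K\<^esub>}. f y \<otimes>\<^bsub>K\<^esub> h (inv\<^bsub>G\<^esub> y \<otimes>\<^bsub>G\<^esub> x)) else \<zero>\<^bsub>K\<^esub>),
     one = (\<lambda>x. if x = \<one>\<^bsub>G\<^esub> then \<one>\<^bsub>K\<^esub> else \<zero>\<^bsub>K\<^esub>),
     ring.zero = (\<lambda>x. \<zero>\<^bsub>K\<^esub>),
     add = (\<lambda>f h x. f x \<oplus>\<^bsub>K\<^esub> h x)\<rparr>"

abbreviation subgroup_algebra ::
  "('k, 'x) ring_scheme \<Rightarrow> ('g, 'y) monoid_scheme \<Rightarrow> 'g set \<Rightarrow> ('g \<Rightarrow> 'k) set"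
  where "subgroup_algebra K G H \<equiv> carrier (group_algebra K (G\<lparr>carrier := H\<rparr>))"

end

theory Submission
  imports Defs "Jordan_Normal_Form.Determinant"
begin

text \<open>Write \<open>A = kG\<close> and \<open>B = kH\<close>, and for a subgroup \<open>S\<close> of \<open>G\<close> let \<open>tr\<^sub>S r\<close> be the sum of all
  \<open>g r g\<inverse>\<close> with \<open>g \<in> S\<close> (\<open>conj_sum\<close>).

  Uniqueness makes every \<open>tr\<^sub>H r\<close> central in \<open>A\<close>.  For each \<open>r \<in> A\<close> the tensor
  \<open>t\<^sub>r = \<Sum>\<^sub>g g r \<otimes> g\<inverse>\<close>, with \<open>g\<close> running over \<open>G\<close>, satisfies \<open>a t\<^sub>r = t\<^sub>r a\<close>, and multiplication sends
  it to \<open>tr\<^sub>G r\<close>.  So \<open>t\<^sub>r\<close> is a separability element whenever \<open>tr\<^sub>G r = 1\<close>.  Both \<open>r\<^sub>1 = 1/|G|\<close> and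
  \<open>r\<^sub>2 = r\<^sub>1 + |G| r - tr\<^sub>G r\<close> have trace \<open>1\<close>, hence \<open>t\<close> takes the same value at them.  If \<open>E : A \<rightarrow> B\<close>
  restricts the support to \<open>H\<close>, the map \<open>x \<otimes> y \<mapsto> x E(y)\<close> sends \<open>t\<^sub>r\<close> to \<open>tr\<^sub>H r\<close>.  Therefore
  \<open>tr\<^sub>H r\<^sub>1 = tr\<^sub>H r\<^sub>2\<close>, that is \<open>|G| tr\<^sub>H r = |H| tr\<^sub>G r\<close>, and the right-hand side is central.  This is
  \<open>conj_sum_central_if_uniquely_separable\<close>.

  In particular the elements \<open>c\<^sub>g = tr\<^sub>H g\<close> are central, so the maps \<open>a \<mapsto> E(a c\<^sub>g)\<close> are bimodule maps
  \<open>A \<rightarrow> B\<close>.  Let \<open>w\<close> be the sum of all commutators \<open>x h x\<inverse> h\<inverse>\<close> with \<open>x, h \<in> H\<close>.  A direct computation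
  (\<open>averaged_projection_expansion\<close>) gives, for every \<open>a \<in> A\<close>,
  \<open>\<Sum>\<^sub>g E(a c\<^bsub>g\<inverse>\<^esub>) c\<^sub>g = |H| a w\<close>, where \<open>g\<close> runs over \<open>G\<close>.  If \<open>w\<close> has an inverse \<open>u\<close> in the centre of
  \<open>B\<close>, this says that \<open>a = \<Sum>\<^sub>g E(a c\<^bsub>g\<inverse>\<^esub>) r\<^sub>g\<close> with \<open>r\<^sub>g = c\<^sub>g u / |H|\<close> commuting with \<open>B\<close>; so \<open>A\<close> is a retract of the direct
  sum of \<open>|G|\<close> copies of \<open>B\<close>, which is depth one (\<open>depth_one_if_dual_bases\<close>).

  It remains to invert \<open>w\<close>.  Over the complex numbers \<open>w\<close> acts on the irreducible representation
  with character \<open>\<chi>\<close> as the nonzero scalar \<open>(|H| / \<chi>(1))\<^sup>2\<close>.  Over an arbitrary field of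
  characteristic zero one argues with integers: multiplication by \<open>w\<close> on the integral group ring of
  \<open>H\<close> is given by an integer matrix whose quadratic form, multiplied by \<open>|H|\<close>, is a sum of squares
  (\<open>commutator_form\<close>), and it is positive definite.  So the determinant is a nonzero integer, and the
  adjugate matrix yields \<open>v\<close> in the integral group ring and an integer \<open>N \<noteq> 0\<close> with \<open>w v = N\<close>.  This
  equation can be read in \<open>kH\<close>, where \<open>N\<close> is invertible.\<close>

section \<open>Finite sums and translations in groups\<close>

lemma (in abelian_monoid) finsum_swap:
  assumes "finite I" "finite J" "\<And>i j. i \<in> I \<Longrightarrow> j \<in> J \<Longrightarrow> f i j \<in> carrier G"
  shows "(\<Oplus>i\<in>I. \<Oplus>j\<in>J. f i j) = (\<Oplus>j\<in>J. \<Oplus>i\<in>I. f i j)"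
  using assms(1,3)
proof (induction I rule: finite_induct)
  case (insert i I)
  have "(\<Oplus>i\<in>insert i I. \<Oplus>j\<in>J. f i j) = (\<Oplus>j\<in>J. f i j) \<oplus> (\<Oplus>i\<in>I. \<Oplus>j\<in>J. f i j)"
    using insert by (intro finsum_insert) (auto intro!: finsum_closed)
  also have "\<dots> = (\<Oplus>j\<in>J. f i j) \<oplus> (\<Oplus>j\<in>J. \<Oplus>i\<in>I. f i j)"
    using insert by simp
  also have "\<dots> = (\<Oplus>j\<in>J. f i j \<oplus> (\<Oplus>i\<in>I. f i j))"
    using insert by (intro finsum_addf [symmetric]) (auto intro!: finsum_closed)
  also have "\<dots> = (\<Oplus>j\<in>J. \<Oplus>i\<in>insert i I. f i j)"
    using insert by (intro finsum_cong') (auto intro!: finsum_closed finsum_insert[symmetric])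
  finally show ?case .
qed simp

lemma (in abelian_monoid) finsum_bij:
  assumes "bij_betw h I J" "\<And>j. j \<in> J \<Longrightarrow> f j \<in> carrier G"
  shows "(\<Oplus>j\<in>J. f j) = (\<Oplus>i\<in>I. f (h i))"
  using finsum_reindex[of f h I] assms by (auto simp: bij_betw_def)

lemma hom_finsum:
  assumes R: "abelian_monoid R" and S: "abelian_monoid S"
    and h: "\<And>x. x \<in> carrier R \<Longrightarrow> h x \<in> carrier S" "h \<zero>\<^bsub>R\<^esub> = \<zero>\<^bsub>S\<^esub>"
      "\<And>x y. x \<in> carrier R \<Longrightarrow> y \<in> carrier R \<Longrightarrow> h (x \<oplus>\<^bsub>R\<^esub> y) = h x \<oplus>\<^bsub>S\<^esub> h y"
    and f: "\<And>i. i \<in> I \<Longrightarrow> f i \<in> carrier R"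
  shows "h (\<Oplus>\<^bsub>R\<^esub>i\<in>I. f i) = (\<Oplus>\<^bsub>S\<^esub>i\<in>I. h (f i))"
proof -
  interpret R: abelian_monoid R by fact
  interpret S: abelian_monoid S by fact
  show ?thesis
    using f
  proof (induction I rule: infinite_finite_induct)
    case (insert i I)
    have "h (\<Oplus>\<^bsub>R\<^esub>i\<in>insert i I. f i) = h (f i \<oplus>\<^bsub>R\<^esub> (\<Oplus>\<^bsub>R\<^esub>i\<in>I. f i))"
      using insert by (subst R.finsum_insert) auto
    also have "\<dots> = h (f i) \<oplus>\<^bsub>S\<^esub> (\<Oplus>\<^bsub>S\<^esub>i\<in>I. h (f i))"
      using insert by (subst h) auto
    also have "\<dots> = (\<Oplus>\<^bsub>S\<^esub>i\<in>insert i I. h (f i))"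
      using insert h by (subst S.finsum_insert) auto
    finally show ?case .
  qed (auto simp: h)
qed

lemma (in ring) finsum_int_multiple:
  assumes "finite I" "a \<in> carrier R"
  shows "(\<Oplus>i\<in>I. [(v i :: int)] \<cdot> a) = [(\<Sum>i\<in>I. v i)] \<cdot> a"
  using assms(1)
proof (induction I rule: finite_induct)
  case empty
  show ?case by (simp add: add_pow_def)
next
  case (insert i I)
  then show ?case
    using assms(2) by (subst finsum_insert) (auto simp: add.int_pow_mult intro!: add.int_pow_closed)
qed

lemma (in group) inv_mult_cancel:
  assumes "x \<in> carrier G" "y \<in> carrier G"
  shows "x \<otimes> (inv x \<otimes> y) = y" "inv x \<otimes> (x \<otimes> y) = y"
  using assms by (simp_all add: m_assoc[symmetric])

lemma (in group) subgroup_translation_bij: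
  assumes "subgroup H G" "x \<in> H"
  shows "bij_betw (\<lambda>a. x \<otimes> a) H H" "bij_betw (\<lambda>a. a \<otimes> x) H H"
    "bij_betw (\<lambda>a. x \<otimes> a \<otimes> inv x) H H"
proof -
  have [simp]: "a \<in> carrier G" if "a \<in> H" for a using assms(1) that by (rule subgroup.mem_carrier)
  have [simp]: "inv a \<in> H" if "a \<in> H" for a using assms(1) that by (rule subgroup.m_inv_closed)
  have [simp]: "a \<otimes> b \<in> H" if "a \<in> H" "b \<in> H" for a b
    using assms(1) that by (rule subgroup.m_closed)
  show "bij_betw (\<lambda>a. x \<otimes> a) H H"
    using assms(2) by (intro bij_betwI[of _ _ _ "\<lambda>a. inv x \<otimes> a"]) (auto simp: m_assoc[symmetric])
  show "bij_betw (\<lambda>a. a \<otimes> x) H H"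
    using assms(2) by (intro bij_betwI[of _ _ _ "\<lambda>a. a \<otimes> inv x"]) (auto simp: m_assoc inv_mult_cancel)
  show "bij_betw (\<lambda>a. x \<otimes> a \<otimes> inv x) H H"
    using assms(2) by (intro bij_betwI[of _ _ _ "\<lambda>a. inv x \<otimes> a \<otimes> x"])
      (auto simp: m_assoc inv_mult_cancel)
qed

section \<open>Retracts of bimodules and depth one\<close>

lemma group_hom_bimodule_hom:
  assumes "bimodule R S M" "bimodule R S N" "f \<in> bimodule_hom R S M N"
  shows "group_hom (add_monoid M) (add_monoid N) f"
proof -
  interpret M: bimodule R S M by fact
  interpret N: bimodule R S N by fact
  show ?thesis
    using assms(3) by unfold_locales (simp add: bimodule_hom_def)
qed

text \<open>The complement of the image of \<open>f\<close> is the kernel of \<open>g\<close>, because \<open>f \<circ> g\<close> is idempotent.\<close>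

lemma retract_is_direct_summand:
  assumes M: "bimodule R S M" and N: "bimodule R S N"
    and f: "f \<in> bimodule_hom R S M N" and g: "g \<in> bimodule_hom R S N M"
    and gf: "\<And>x. x \<in> carrier M \<Longrightarrow> g (f x) = x"
  shows "direct_summand R S (f ` carrier M) N"
    and "bimodule_isomorphic R S M (N\<lparr>carrier := f ` carrier M\<rparr>)"
proof -
  interpret M: bimodule R S M by fact
  interpret N: bimodule R S N by fact
  interpret f: group_hom "add_monoid M" "add_monoid N" f
    by (rule group_hom_bimodule_hom[OF M N f])
  interpret g: group_hom "add_monoid N" "add_monoid M" g
    by (rule group_hom_bimodule_hom[OF N M g])
  have f_closed: "f x \<in> carrier N" if "x \<in> carrier M" for x using f.hom_closed[of x] that by simp
  have g_closed: "g y \<in> carrier M" if "y \<in> carrier N" for y using g.hom_closed[of y] that by simp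
  have f_act: "f (a \<odot>\<^bsub>M\<^esub> x) = a \<odot>\<^bsub>N\<^esub> f x" "f (x \<odot>\<^sub>r\<^bsub>M\<^esub> c) = f x \<odot>\<^sub>r\<^bsub>N\<^esub> c"
    if "a \<in> carrier R" "x \<in> carrier M" "c \<in> carrier S" for a x c
    using f that by (auto simp: bimodule_hom_def)
  have g_act: "g (a \<odot>\<^bsub>N\<^esub> y) = a \<odot>\<^bsub>M\<^esub> g y" "g (y \<odot>\<^sub>r\<^bsub>N\<^esub> c) = g y \<odot>\<^sub>r\<^bsub>M\<^esub> c"
    if "a \<in> carrier R" "y \<in> carrier N" "c \<in> carrier S" for a y c
    using g that by (auto simp: bimodule_hom_def)
  let ?D = "f ` carrier M"
  let ?E = "{y \<in> carrier N. g y = \<zero>\<^bsub>M\<^esub>}"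
  have D: "sub_bimodule R S ?D N"
    unfolding sub_bimodule_def
  proof (intro conjI ballI)
    show "subgroup ?D (add_monoid N)" using f.img_is_subgroup by simp
    fix a y assume "a \<in> carrier R" "y \<in> ?D"
    then show "a \<odot>\<^bsub>N\<^esub> y \<in> ?D"
      using f_act(1)[OF _ _ M.S.zero_closed] M.lact_closed by (force simp: image_iff)
  next
    fix y c assume "y \<in> ?D" "c \<in> carrier S"
    then show "y \<odot>\<^sub>r\<^bsub>N\<^esub> c \<in> ?D"
      using f_act(2)[OF M.R.zero_closed] M.ract_closed by (force simp: image_iff)
  qed
  have lact_zero: "a \<odot>\<^bsub>M\<^esub> \<zero>\<^bsub>M\<^esub> = \<zero>\<^bsub>M\<^esub>" if a: "a \<in> carrier R" for a
    using M.lact_add[OF a M.M.zero_closed M.M.zero_closed] M.lact_closed[OF a M.M.zero_closed]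
    by (simp add: M.M.add.r_cancel_one')
  have ract_zero: "\<zero>\<^bsub>M\<^esub> \<odot>\<^sub>r\<^bsub>M\<^esub> c = \<zero>\<^bsub>M\<^esub>" if c: "c \<in> carrier S" for c
    using M.ract_add[OF M.M.zero_closed M.M.zero_closed c] M.ract_closed[OF M.M.zero_closed c]
    by (simp add: M.M.add.r_cancel_one')
  have E: "sub_bimodule R S ?E N"
    unfolding sub_bimodule_def
  proof (intro conjI ballI)
    show "subgroup ?E (add_monoid N)" using g.subgroup_kernel by (simp add: kernel_def)
    fix a y assume "a \<in> carrier R" "y \<in> ?E"
    then show "a \<odot>\<^bsub>N\<^esub> y \<in> ?E"
      using g_act(1)[OF _ _ M.S.zero_closed] N.lact_closed lact_zero by force
  next
    fix y c assume "y \<in> ?E" "c \<in> carrier S"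
    then show "y \<odot>\<^sub>r\<^bsub>N\<^esub> c \<in> ?E"
      using g_act(2)[OF M.R.zero_closed] N.ract_closed ract_zero by force
  qed
  have "?D \<inter> ?E = {\<zero>\<^bsub>N\<^esub>}"
  proof -
    have "f \<zero>\<^bsub>M\<^esub> = \<zero>\<^bsub>N\<^esub>" "g \<zero>\<^bsub>N\<^esub> = \<zero>\<^bsub>M\<^esub>" using f.hom_one g.hom_one by simp_all
    then show ?thesis using gf by (force simp: image_iff)
  qed
  moreover have "?D <+>\<^bsub>N\<^esub> ?E = carrier N"
  proof
    show "?D <+>\<^bsub>N\<^esub> ?E \<subseteq> carrier N" by (auto simp: set_add_def set_mult_def f_closed)
    show "carrier N \<subseteq> ?D <+>\<^bsub>N\<^esub> ?E"
    proof
      fix y assume y: "y \<in> carrier N"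
      define z where "z = y \<ominus>\<^bsub>N\<^esub> f (g y)"
      have z: "z \<in> carrier N" using y by (simp add: z_def f_closed g_closed)
      have yz: "y = f (g y) \<oplus>\<^bsub>N\<^esub> z"
        using y f_closed[OF g_closed[OF y]] by (simp add: z_def N.M.minus_eq N.M.a_lcomm N.M.r_neg)
      have "g y = g (f (g y)) \<oplus>\<^bsub>M\<^esub> g z"
        using g.hom_mult[of "f (g y)" z] yz y z by (simp add: f_closed g_closed)
      then have "g z = \<zero>\<^bsub>M\<^esub>"
        using y z gf[OF g_closed[OF y]] by (simp add: g_closed M.M.add.r_cancel_one')
      then show "y \<in> ?D <+>\<^bsub>N\<^esub> ?E"
        using yz y z g_closed by (auto simp: set_add_def set_mult_def)
    qed
  qed
  ultimately show "direct_summand R S ?D N"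
    using D E unfolding direct_summand_def by blast
  have "f \<in> bimodule_hom R S M (N\<lparr>carrier := ?D\<rparr>)"
    using f by (auto simp: bimodule_hom_def hom_def)
  moreover have "bij_betw f (carrier M) ?D"
    using gf by (intro inj_on_imp_bij_betw inj_on_inverseI)
  ultimately show "bimodule_isomorphic R S M (N\<lparr>carrier := ?D\<rparr>)"
    unfolding bimodule_isomorphic_def by auto
qed

text \<open>The bimodule maps \<open>B \<rightarrow> A\<close> are the maps \<open>b \<mapsto> b r\<close> with \<open>r\<close> commuting with \<open>B\<close>.  A family of maps
  \<open>f\<^sub>i : A \<rightarrow> B\<close> together with such elements \<open>r\<^sub>i\<close> is thus the same as a pair of bimodule maps between
  \<open>A\<close> and a power of \<open>B\<close>, and the equation \<open>\<Sum>\<^sub>i f\<^sub>i(a) r\<^sub>i = a\<close> says that they make \<open>A\<close> a retract.\<close>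

lemma depth_one_if_dual_bases:
  fixes A :: "('a, 'x) ring_scheme" and I :: "'i set"
  assumes A: "ring A" and B: "subring B A" and I: "finite I" "I \<noteq> {}"
    and f: "\<And>i. i \<in> I \<Longrightarrow> f i \<in> bimodule_hom (A\<lparr>carrier := B\<rparr>) (A\<lparr>carrier := B\<rparr>)
        (regular_bimodule A (carrier A)) (regular_bimodule A B)"
    and r: "\<And>i. i \<in> I \<Longrightarrow> r i \<in> carrier A"
      "\<And>i b. i \<in> I \<Longrightarrow> b \<in> B \<Longrightarrow> b \<otimes>\<^bsub>A\<^esub> r i = r i \<otimes>\<^bsub>A\<^esub> b"
    and sum: "\<And>a. a \<in> carrier A \<Longrightarrow> (\<Oplus>\<^bsub>A\<^esub>i\<in>I. f i a \<otimes>\<^bsub>A\<^esub> r i) = a"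
  shows "depth_one A B"
proof -
  interpret A: ring A by fact
  define n where "n = card I"
  have n: "n > 0" using I by (simp add: n_def card_gt_0_iff)
  obtain e where e: "bij_betw e {..<n} I"
    using ex_bij_betw_nat_finite[OF I(1)] by (auto simp: n_def atLeast0LessThan)
  have eI: "e j \<in> I" if "j < n" for j using e that by (auto simp: bij_betw_def)
  have BA: "b \<in> carrier A" if "b \<in> B" for b using subringE(1)[OF B] that by blast
  let ?R = "A\<lparr>carrier := B\<rparr>"
  let ?M = "regular_bimodule A (carrier A)"
  let ?N = "bimodule_power (regular_bimodule A B) n"
  have M: "bimodule ?R ?R ?M"
    using bimodule_regular[OF A B B A.carrier_is_subring] subringE(1)[OF B] by simp
  have N: "bimodule ?R ?R ?N"
    by (intro bimodule_bimodule_power bimodule_regular A B) simp_all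
  have f_closed: "f i a \<in> B" if "i \<in> I" "a \<in> carrier A" for i a
    using f[OF that(1)] that(2) by (auto simp: bimodule_hom_def hom_def regular_bimodule_def)
  have f_add: "f i (a \<oplus>\<^bsub>A\<^esub> a') = f i a \<oplus>\<^bsub>A\<^esub> f i a'"
    if "i \<in> I" "a \<in> carrier A" "a' \<in> carrier A" for i a a'
    using f[OF that(1)] that(2,3) by (auto simp: bimodule_hom_def hom_def regular_bimodule_def)
  have f_act: "f i (b \<otimes>\<^bsub>A\<^esub> a) = b \<otimes>\<^bsub>A\<^esub> f i a" "f i (a \<otimes>\<^bsub>A\<^esub> b) = f i a \<otimes>\<^bsub>A\<^esub> b"
    if "i \<in> I" "a \<in> carrier A" "b \<in> B" for i a b
    using f[OF that(1)] that(2,3) by (auto simp: bimodule_hom_def hom_def regular_bimodule_def)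
  define \<alpha> where "\<alpha> a = (\<lambda>j\<in>{..<n}. f (e j) a)" for a
  define \<beta> where "\<beta> u = (\<Oplus>\<^bsub>A\<^esub>j\<in>{..<n}. u j \<otimes>\<^bsub>A\<^esub> r (e j))" for u
  have \<alpha>: "\<alpha> \<in> bimodule_hom ?R ?R ?M ?N"
    using eI by (auto simp: \<alpha>_def bimodule_hom_def hom_def regular_bimodule_def bimodule_power_def
        f_closed f_add f_act BA intro!: restrict_ext)
  have \<beta>: "\<beta> \<in> bimodule_hom ?R ?R ?N ?M"
  proof -
    have cl: "u j \<in> carrier A" if "u \<in> {..<n} \<rightarrow>\<^sub>E B" "j < n" for u j
      using that BA by auto
    have "\<beta> u \<in> carrier A" if "u \<in> {..<n} \<rightarrow>\<^sub>E B" for u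
      using that unfolding \<beta>_def by (intro A.finsum_closed) (auto simp: cl eI r)
    moreover have "\<beta> (\<lambda>j\<in>{..<n}. u j \<oplus>\<^bsub>A\<^esub> v j) = \<beta> u \<oplus>\<^bsub>A\<^esub> \<beta> v"
      if "u \<in> {..<n} \<rightarrow>\<^sub>E B" "v \<in> {..<n} \<rightarrow>\<^sub>E B" for u v
    proof -
      have "\<beta> (\<lambda>j\<in>{..<n}. u j \<oplus>\<^bsub>A\<^esub> v j)
          = (\<Oplus>\<^bsub>A\<^esub>j\<in>{..<n}. u j \<otimes>\<^bsub>A\<^esub> r (e j) \<oplus>\<^bsub>A\<^esub> v j \<otimes>\<^bsub>A\<^esub> r (e j))"
        using that unfolding \<beta>_def by (intro A.finsum_cong') (auto simp: cl eI r A.l_distr)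
      then show ?thesis
        using that unfolding \<beta>_def by (subst A.finsum_addf[symmetric]) (auto simp: cl eI r)
    qed
    moreover have "\<beta> (\<lambda>j\<in>{..<n}. b \<otimes>\<^bsub>A\<^esub> u j) = b \<otimes>\<^bsub>A\<^esub> \<beta> u"
      if "u \<in> {..<n} \<rightarrow>\<^sub>E B" "b \<in> B" for u b
    proof -
      have "\<beta> (\<lambda>j\<in>{..<n}. b \<otimes>\<^bsub>A\<^esub> u j) = (\<Oplus>\<^bsub>A\<^esub>j\<in>{..<n}. b \<otimes>\<^bsub>A\<^esub> (u j \<otimes>\<^bsub>A\<^esub> r (e j)))"
        using that unfolding \<beta>_def by (intro A.finsum_cong') (auto simp: cl eI r BA A.m_assoc)
      then show ?thesis
        using that unfolding \<beta>_def by (subst A.finsum_rdistr) (auto simp: cl eI r BA)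
    qed
    moreover have "\<beta> (\<lambda>j\<in>{..<n}. u j \<otimes>\<^bsub>A\<^esub> b) = \<beta> u \<otimes>\<^bsub>A\<^esub> b"
      if "u \<in> {..<n} \<rightarrow>\<^sub>E B" "b \<in> B" for u b
    proof -
      have "\<beta> (\<lambda>j\<in>{..<n}. u j \<otimes>\<^bsub>A\<^esub> b) = (\<Oplus>\<^bsub>A\<^esub>j\<in>{..<n}. (u j \<otimes>\<^bsub>A\<^esub> r (e j)) \<otimes>\<^bsub>A\<^esub> b)"
        using that unfolding \<beta>_def by (intro A.finsum_cong') (auto simp: cl eI r BA A.m_assoc)
      then show ?thesis
        using that unfolding \<beta>_def by (subst A.finsum_ldistr) (auto simp: cl eI r BA)
    qed
    ultimately show ?thesis
      by (auto simp: bimodule_hom_def hom_def regular_bimodule_def bimodule_power_def)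
  qed
  have "\<beta> (\<alpha> a) = a" if a: "a \<in> carrier A" for a
  proof -
    have "\<beta> (\<alpha> a) = (\<Oplus>\<^bsub>A\<^esub>j\<in>{..<n}. f (e j) a \<otimes>\<^bsub>A\<^esub> r (e j))"
      using a unfolding \<alpha>_def \<beta>_def by (intro A.finsum_cong') (auto simp: eI r f_closed BA)
    also have "\<dots> = (\<Oplus>\<^bsub>A\<^esub>i\<in>e ` {..<n}. f i a \<otimes>\<^bsub>A\<^esub> r i)"
      using a e by (intro A.finsum_reindex[symmetric]) (auto simp: bij_betw_def r f_closed BA)
    finally show ?thesis using a e sum by (simp add: bij_betw_def)
  qed
  then have "direct_summand ?R ?R (\<alpha> ` carrier ?M) ?N \<and>
      bimodule_isomorphic ?R ?R ?M (?N\<lparr>carrier := \<alpha> ` carrier ?M\<rparr>)"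
    by (intro conjI retract_is_direct_summand[OF M N \<alpha> \<beta>]) (simp_all add: regular_bimodule_def)
  with n show ?thesis
    unfolding depth_one_def Let_def by blast
qed

section \<open>Tensor products of bimodules\<close>

text \<open>The additive extension of \<open>\<phi>\<close> to the free abelian group, written with the same sum
  as \<open>frag_mult\<close>, so that the multiplication map is an instance by definition.\<close>

definition frag_sum :: "('c, 'z) ring_scheme \<Rightarrow> ('p \<Rightarrow> 'c) \<Rightarrow> ('p \<Rightarrow>\<^sub>0 int) \<Rightarrow> 'c"
  where "frag_sum C \<phi> u = (\<Oplus>\<^bsub>C\<^esub>p\<in>Poly_Mapping.keys u. [Poly_Mapping.lookup u p] \<cdot>\<^bsub>C\<^esub> \<phi> p)"

lemma frag_mult_eq_frag_sum: "frag_mult A = frag_sum A (\<lambda>p. fst p \<otimes>\<^bsub>A\<^esub> snd p)"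
  by (simp add: fun_eq_iff frag_mult_def frag_sum_def)

text \<open>Additivity holds because the sum may be taken over any finite set containing the support, and
  two elements of the free abelian group have a common such set.\<close>

lemma frag_sum_hom:
  fixes P :: "'p set"
  assumes C: "abelian_group C" and \<phi>: "\<And>p. p \<in> P \<Longrightarrow> \<phi> p \<in> carrier C"
  shows "group_hom (free_Abelian_group P) (add_monoid C) (frag_sum C \<phi>)"
    and "\<And>p. p \<in> P \<Longrightarrow> frag_sum C \<phi> (frag_of p) = \<phi> p"
proof -
  interpret C: abelian_group C by fact
  let ?k = "Poly_Mapping.keys" and ?l = "Poly_Mapping.lookup"
  have zero: "[(0::int)] \<cdot>\<^bsub>C\<^esub> x = \<zero>\<^bsub>C\<^esub>" for x by (simp add: add_pow_def)
  have extend: "frag_sum C \<phi> u = (\<Oplus>\<^bsub>C\<^esub>p\<in>T. [?l u p] \<cdot>\<^bsub>C\<^esub> \<phi> p)"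
    if "finite T" "?k u \<subseteq> T" "T \<subseteq> P" for u T
    unfolding frag_sum_def using that \<phi>
    by (intro C.add.finprod_mono_neutral_cong_left)
      (auto simp: in_keys_iff zero intro!: C.add.int_pow_closed)
  have add: "frag_sum C \<phi> (u + v) = frag_sum C \<phi> u \<oplus>\<^bsub>C\<^esub> frag_sum C \<phi> v"
    if "?k u \<subseteq> P" "?k v \<subseteq> P" for u v
  proof -
    let ?T = "?k u \<union> ?k v"
    have "frag_sum C \<phi> (u + v) = (\<Oplus>\<^bsub>C\<^esub>p\<in>?T. [?l (u + v) p] \<cdot>\<^bsub>C\<^esub> \<phi> p)"
      by (intro extend) (use that keys_add[of u v] in auto)
    also have "\<dots> = (\<Oplus>\<^bsub>C\<^esub>p\<in>?T. [?l u p] \<cdot>\<^bsub>C\<^esub> \<phi> p \<oplus>\<^bsub>C\<^esub> [?l v p] \<cdot>\<^bsub>C\<^esub> \<phi> p)"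
      using that \<phi> by (intro C.finsum_cong')
        (auto simp: lookup_add C.add.int_pow_mult intro!: C.a_closed C.add.int_pow_closed)
    also have "\<dots> = frag_sum C \<phi> u \<oplus>\<^bsub>C\<^esub> frag_sum C \<phi> v"
      using that \<phi> extend[of ?T u] extend[of ?T v]
      by (subst C.finsum_addf) (auto intro!: C.add.int_pow_closed)
    finally show ?thesis .
  qed
  have closed: "frag_sum C \<phi> u \<in> carrier C" if "?k u \<subseteq> P" for u
    unfolding frag_sum_def using that \<phi> by (intro C.finsum_closed) (auto intro!: C.add.int_pow_closed)
  show "group_hom (free_Abelian_group P) (add_monoid C) (frag_sum C \<phi>)"
    unfolding group_hom_def group_hom_axioms_def hom_def
    using add closed C.a_group by auto
  show "frag_sum C \<phi> (frag_of p) = \<phi> p" if "p \<in> P" for p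
    using \<phi>[OF that] C.add.int_pow_1[of "\<phi> p"] by (simp add: frag_sum_def)
qed

lemma frag_sum_sum:
  assumes C: "abelian_group C" and \<phi>: "\<And>p. p \<in> P \<Longrightarrow> \<phi> p \<in> carrier C"
    and I: "finite I" and p: "\<And>i. i \<in> I \<Longrightarrow> p i \<in> P"
  shows "frag_sum C \<phi> (\<Sum>i\<in>I. frag_of (p i)) = (\<Oplus>\<^bsub>C\<^esub>i\<in>I. \<phi> (p i))"
proof -
  interpret C: abelian_group C by fact
  interpret h: group_hom "free_Abelian_group P" "add_monoid C" "frag_sum C \<phi>"
    using C \<phi> by (rule frag_sum_hom)
  have "frag_sum C \<phi> (\<Sum>i\<in>I. frag_of (p i)) = (\<Oplus>\<^bsub>C\<^esub>i\<in>I. \<phi> (p i)) \<and>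
      Poly_Mapping.keys (\<Sum>i\<in>I. frag_of (p i)) \<subseteq> P"
    using I p
  proof (induction I rule: finite_induct)
    case empty
    then show ?case using h.hom_one by simp
  next
    case (insert i I)
    then show ?case
      using h.hom_mult[of "frag_of (p i)" "\<Sum>i\<in>I. frag_of (p i)"] frag_sum_hom(2)[OF C, of P \<phi> "p i"] \<phi>
        keys_add[of "frag_of (p i)" "\<Sum>i\<in>I. frag_of (p i)"]
      by (auto simp: C.finsum_insert Pi_iff)
  qed
  then show ?thesis ..
qed

lemma keys_diff_subset:
  fixes u v :: "'p \<Rightarrow>\<^sub>0 int"
  assumes "Poly_Mapping.keys u \<subseteq> P" "Poly_Mapping.keys v \<subseteq> P"
  shows "Poly_Mapping.keys (u - v) \<subseteq> P"
  using assms keys_diff[of u v] by blast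

lemma keys_sum_subset:
  fixes f :: "'i \<Rightarrow> 'p \<Rightarrow>\<^sub>0 int"
  shows "(\<And>i. i \<in> I \<Longrightarrow> Poly_Mapping.keys (f i) \<subseteq> P) \<Longrightarrow> Poly_Mapping.keys (\<Sum>i\<in>I. f i) \<subseteq> P"
proof (induction I rule: infinite_finite_induct)
  case (insert i I)
  then show ?case using keys_add[of "f i" "sum f I"] by fastforce
qed simp_all

text \<open>Computations in \<open>M \<otimes>\<^sub>S N\<close> are done with representatives in the free abelian group \<open>F\<close>, modulo the
  subgroup \<open>Q\<close> of relations: an equation between tensors is the statement that a difference of
  representatives lies in \<open>Q\<close>.\<close>

locale tensor_factors = M: bimodule R S M + N: bimodule S T N
  for R :: "('r, 'x) ring_scheme" and S :: "('s, 'y) ring_scheme" and T :: "('t, 'z) ring_scheme"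
    and M :: "('r, 'm, 's) bimodule" and N :: "('s, 'n, 't) bimodule"
begin

abbreviation F where "F \<equiv> free_Abelian_group (carrier M \<times> carrier N)"
abbreviation Q where "Q \<equiv> tensor_relations S M N"
abbreviation left_act where "left_act a \<equiv> frag_extend (\<lambda>(x, y). frag_of (a \<odot>\<^bsub>M\<^esub> x, y))"
abbreviation right_act where "right_act c \<equiv> frag_extend (\<lambda>(x, y). frag_of (x, y \<odot>\<^sub>r\<^bsub>N\<^esub> c))"

sublocale F: group F by simp

lemma relations_subgroup: "subgroup Q F"
  unfolding tensor_relations_def
proof (rule F.generate_is_subgroup, intro Un_least subsetI; clarify)
qed (simp_all add: keys_diff_subset M.ract_closed N.lact_closed)

lemma relations_subset: "u \<in> Q \<Longrightarrow> Poly_Mapping.keys u \<subseteq> carrier M \<times> carrier N"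
  using subgroup.mem_carrier[OF relations_subgroup] by simp

lemma relations_zero: "0 \<in> Q"
  using subgroup.one_closed[OF relations_subgroup] by simp

lemma relations_add: "u \<in> Q \<Longrightarrow> v \<in> Q \<Longrightarrow> u + v \<in> Q"
  using subgroup.m_closed[OF relations_subgroup] by simp

lemma relations_uminus: "u \<in> Q \<Longrightarrow> - u \<in> Q"
  using subgroup.m_inv_closed[OF relations_subgroup] relations_subset by fastforce

lemma relations_diff: "u \<in> Q \<Longrightarrow> v \<in> Q \<Longrightarrow> u - v \<in> Q"
  using relations_add[OF _ relations_uminus] by fastforce

lemma relations_sum: "(\<And>i. i \<in> I \<Longrightarrow> f i \<in> Q) \<Longrightarrow> (\<Sum>i\<in>I. f i) \<in> Q"
  by (induction I rule: infinite_finite_induct) (auto simp: relations_zero relations_add)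

lemma tensor_add_left:
  assumes "x \<in> carrier M" "x' \<in> carrier M" "y \<in> carrier N"
  shows "frag_of (x \<oplus>\<^bsub>M\<^esub> x', y) - (frag_of (x, y) + frag_of (x', y)) \<in> Q"
  using assms unfolding tensor_relations_def diff_diff_eq[symmetric]
  by (intro generate.incl) auto

lemma tensor_add_right:
  assumes "x \<in> carrier M" "y \<in> carrier N" "y' \<in> carrier N"
  shows "frag_of (x, y \<oplus>\<^bsub>N\<^esub> y') - (frag_of (x, y) + frag_of (x, y')) \<in> Q"
  using assms unfolding tensor_relations_def diff_diff_eq[symmetric]
  by (intro generate.incl) auto

lemma tensor_balanced:
  assumes "x \<in> carrier M" "s \<in> carrier S" "y \<in> carrier N"
  shows "frag_of (x \<odot>\<^sub>r\<^bsub>M\<^esub> s, y) - frag_of (x, s \<odot>\<^bsub>N\<^esub> y) \<in> Q"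
  using assms unfolding tensor_relations_def by (intro generate.incl) auto

lemma relations_least:
  assumes "subgroup W F"
    and "\<And>x x' y. x \<in> carrier M \<Longrightarrow> x' \<in> carrier M \<Longrightarrow> y \<in> carrier N \<Longrightarrow>
      frag_of (x \<oplus>\<^bsub>M\<^esub> x', y) - (frag_of (x, y) + frag_of (x', y)) \<in> W"
    and "\<And>x y y'. x \<in> carrier M \<Longrightarrow> y \<in> carrier N \<Longrightarrow> y' \<in> carrier N \<Longrightarrow>
      frag_of (x, y \<oplus>\<^bsub>N\<^esub> y') - (frag_of (x, y) + frag_of (x, y')) \<in> W"
    and "\<And>x s y. x \<in> carrier M \<Longrightarrow> s \<in> carrier S \<Longrightarrow> y \<in> carrier N \<Longrightarrow>
      frag_of (x \<odot>\<^sub>r\<^bsub>M\<^esub> s, y) - frag_of (x, s \<odot>\<^bsub>N\<^esub> y) \<in> W"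
  shows "Q \<subseteq> W"
  unfolding tensor_relations_def diff_diff_eq
  using assms(2-4) by (intro F.generate_subgroup_incl[OF _ assms(1)] Un_least subsetI; clarify)

text \<open>The universal property of the tensor product: a biadditive and balanced map kills the relations
  and hence depends only on the class of its argument.\<close>

lemma relations_in_kernel:
  assumes h: "group_hom F H h"
    and add_left: "\<And>x x' y. x \<in> carrier M \<Longrightarrow> x' \<in> carrier M \<Longrightarrow> y \<in> carrier N \<Longrightarrow>
      h (frag_of (x \<oplus>\<^bsub>M\<^esub> x', y)) = h (frag_of (x, y)) \<otimes>\<^bsub>H\<^esub> h (frag_of (x', y))"
    and add_right: "\<And>x y y'. x \<in> carrier M \<Longrightarrow> y \<in> carrier N \<Longrightarrow> y' \<in> carrier N \<Longrightarrow>
      h (frag_of (x, y \<oplus>\<^bsub>N\<^esub> y')) = h (frag_of (x, y)) \<otimes>\<^bsub>H\<^esub> h (frag_of (x, y'))"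
    and balanced: "\<And>x s y. x \<in> carrier M \<Longrightarrow> s \<in> carrier S \<Longrightarrow> y \<in> carrier N \<Longrightarrow>
      h (frag_of (x \<odot>\<^sub>r\<^bsub>M\<^esub> s, y)) = h (frag_of (x, s \<odot>\<^bsub>N\<^esub> y))"
    and u: "u \<in> Q"
  shows "h u = \<one>\<^bsub>H\<^esub>"
proof -
  interpret h: group_hom F H h by fact
  have diff: "v - w \<in> kernel F H h"
    if "v \<in> carrier F" "w \<in> carrier F" "h v = h w" for v w
  proof -
    have vw: "v - w \<in> carrier F" using that keys_diff_subset by simp
    have "h v = h (v - w) \<otimes>\<^bsub>H\<^esub> h w"
      using h.hom_mult[OF vw that(2)] by simp
    with that h.hom_closed[OF that(2)] h.hom_closed[OF vw] have "h (v - w) = \<one>\<^bsub>H\<^esub>"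
      by (simp add: h.H.l_cancel_one')
    with vw show ?thesis by (simp add: kernel_def)
  qed
  have "Q \<subseteq> kernel F H h"
  proof (rule relations_least[OF h.subgroup_kernel]; rule diff)
    fix x x' y assume "x \<in> carrier M" "x' \<in> carrier M" "y \<in> carrier N"
    then show "h (frag_of (x \<oplus>\<^bsub>M\<^esub> x', y)) = h (frag_of (x, y) + frag_of (x', y))"
      using h.hom_mult[of "frag_of (x, y)" "frag_of (x', y)"] by (simp add: add_left)
  next
    fix x y y' assume "x \<in> carrier M" "y \<in> carrier N" "y' \<in> carrier N"
    then show "h (frag_of (x, y \<oplus>\<^bsub>N\<^esub> y')) = h (frag_of (x, y) + frag_of (x, y'))"
      using h.hom_mult[of "frag_of (x, y)" "frag_of (x, y')"] by (simp add: add_right)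
  qed (use F.m_closed in \<open>auto simp: balanced M.ract_closed N.lact_closed dest: subsetD[OF keys_add]\<close>)
  with u show ?thesis by (auto simp: kernel_def)
qed

lemma hom_eq_if_class_eq:
  assumes h: "group_hom F L h" and kills: "\<And>u. u \<in> Q \<Longrightarrow> h u = \<one>\<^bsub>L\<^esub>"
    and v: "v \<in> carrier F" and eq: "u - v \<in> Q"
  shows "h u = h v"
proof -
  interpret h: group_hom F L h by fact
  have "u - v \<in> carrier F" using relations_subset[OF eq] by simp
  then have "h ((u - v) + v) = h (u - v) \<otimes>\<^bsub>L\<^esub> h v"
    using h.hom_mult[OF _ v] by (metis mult_free_Abelian_group)
  then show ?thesis using kills[OF eq] h.hom_closed[OF v] by simp
qed

lemma left_act_relations:
  assumes a: "a \<in> carrier R" and u: "u \<in> Q"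
  shows "left_act a u \<in> Q"
proof -
  have "Q \<subseteq> {u \<in> Q. left_act a u \<in> Q}"
  proof (rule relations_least)
    show "subgroup {u \<in> Q. left_act a u \<in> Q} F"
      using relations_zero relations_subset
      by (intro F.subgroupI) (auto simp: frag_extend_add frag_extend_minus relations_add relations_uminus)
  next
    fix x x' y assume "x \<in> carrier M" "x' \<in> carrier M" "y \<in> carrier N"
    then show "frag_of (x \<oplus>\<^bsub>M\<^esub> x', y) - (frag_of (x, y) + frag_of (x', y)) \<in> {u \<in> Q. left_act a u \<in> Q}"
      using a by (simp add: tensor_add_left frag_extend_diff frag_extend_add M.lact_add M.lact_closed)
  next
    fix x y y' assume "x \<in> carrier M" "y \<in> carrier N" "y' \<in> carrier N"
    then show "frag_of (x, y \<oplus>\<^bsub>N\<^esub> y') - (frag_of (x, y) + frag_of (x, y')) \<in> {u \<in> Q. left_act a u \<in> Q}"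
      using a by (simp add: tensor_add_right frag_extend_diff frag_extend_add M.lact_closed)
  next
    fix x s y assume "x \<in> carrier M" "s \<in> carrier S" "y \<in> carrier N"
    then show "frag_of (x \<odot>\<^sub>r\<^bsub>M\<^esub> s, y) - frag_of (x, s \<odot>\<^bsub>N\<^esub> y) \<in> {u \<in> Q. left_act a u \<in> Q}"
      using a by (simp add: tensor_balanced frag_extend_diff M.lact_closed flip: M.lact_ract)
  qed
  with u show ?thesis by blast
qed

lemma right_act_relations:
  assumes c: "c \<in> carrier T" and u: "u \<in> Q"
  shows "right_act c u \<in> Q"
proof -
  have "Q \<subseteq> {u \<in> Q. right_act c u \<in> Q}"
  proof (rule relations_least)
    show "subgroup {u \<in> Q. right_act c u \<in> Q} F"
      using relations_zero relations_subset
      by (intro F.subgroupI) (auto simp: frag_extend_add frag_extend_minus relations_add relations_uminus)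
  next
    fix x x' y assume "x \<in> carrier M" "x' \<in> carrier M" "y \<in> carrier N"
    then show "frag_of (x \<oplus>\<^bsub>M\<^esub> x', y) - (frag_of (x, y) + frag_of (x', y)) \<in> {u \<in> Q. right_act c u \<in> Q}"
      using c by (simp add: tensor_add_left frag_extend_diff frag_extend_add N.ract_closed)
  next
    fix x y y' assume "x \<in> carrier M" "y \<in> carrier N" "y' \<in> carrier N"
    then show "frag_of (x, y \<oplus>\<^bsub>N\<^esub> y') - (frag_of (x, y) + frag_of (x, y')) \<in> {u \<in> Q. right_act c u \<in> Q}"
      using c by (simp add: tensor_add_right frag_extend_diff frag_extend_add N.ract_add N.ract_closed)
  next
    fix x s y assume "x \<in> carrier M" "s \<in> carrier S" "y \<in> carrier N"
    then show "frag_of (x \<odot>\<^sub>r\<^bsub>M\<^esub> s, y) - frag_of (x, s \<odot>\<^bsub>N\<^esub> y) \<in> {u \<in> Q. right_act c u \<in> Q}"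
      using c by (simp add: tensor_balanced frag_extend_diff N.ract_closed N.lact_ract)
  qed
  with u show ?thesis by blast
qed

definition tensor_class :: "('m \<times> 'n \<Rightarrow>\<^sub>0 int) \<Rightarrow> ('m \<times> 'n \<Rightarrow>\<^sub>0 int) set"
  where "tensor_class u = Q #>\<^bsub>F\<^esub> u"

lemma mem_tensor_class: "v \<in> tensor_class u \<longleftrightarrow> v - u \<in> Q"
  by (auto simp: tensor_class_def r_coset_def algebra_simps intro: bexI[of _ "v - u"])

lemma tensor_class_eq_iff: "tensor_class u = tensor_class v \<longleftrightarrow> u - v \<in> Q"
proof
  assume "tensor_class u = tensor_class v"
  moreover have "u \<in> tensor_class u" by (simp add: mem_tensor_class relations_zero)
  ultimately show "u - v \<in> Q" by (simp add: mem_tensor_class)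
next
  assume "u - v \<in> Q"
  then have "w - u \<in> Q \<longleftrightarrow> w - v \<in> Q" for w
    using relations_add[of "w - u" "u - v"] relations_diff[of "w - v" "u - v"] by auto
  then show "tensor_class u = tensor_class v" by (auto simp: mem_tensor_class)
qed

lemma tensor_class_closed: "u \<in> carrier F \<Longrightarrow> tensor_class u \<in> carrier (tensor_product S M N)"
  by (auto simp: tensor_class_def tensor_product_def Let_def carrier_FactGroup)

text \<open>The actions on the tensor product are defined by adding \<open>Q\<close> to the image of a coset.  This lemma
  shows that they are computed on representatives.\<close>

lemma coset_of_image:
  assumes h: "\<And>u v. h (u + v) = h u + h v" "\<And>u. u \<in> Q \<Longrightarrow> h u \<in> Q"
  shows "Q <#>\<^bsub>F\<^esub> h ` tensor_class u = tensor_class (h u)"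
proof (intro equalityI subsetI)
  fix w assume "w \<in> Q <#>\<^bsub>F\<^esub> h ` tensor_class u"
  then obtain q v where qv: "q \<in> Q" "v - u \<in> Q" "w = q + h v"
    by (auto simp: set_mult_def mem_tensor_class)
  have "h v = h (v - u) + h u" using h(1)[of "v - u" u] by simp
  with qv show "w \<in> tensor_class (h u)"
    by (simp add: mem_tensor_class relations_add h(2))
next
  fix w assume "w \<in> tensor_class (h u)"
  then have "w - h u \<in> Q" "w = (w - h u) + h u" by (simp_all add: mem_tensor_class)
  moreover have "u \<in> tensor_class u" by (simp add: mem_tensor_class relations_zero)
  ultimately show "w \<in> Q <#>\<^bsub>F\<^esub> h ` tensor_class u" unfolding set_mult_def by fastforce
qed

lemma tensor_class_lact:
  "a \<in> carrier R \<Longrightarrow> a \<odot>\<^bsub>tensor_product S M N\<^esub> tensor_class u = tensor_class (left_act a u)"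
  using coset_of_image[of "left_act a" u] left_act_relations
  by (simp add: tensor_product_def Let_def frag_extend_add)

lemma tensor_class_ract:
  "c \<in> carrier T \<Longrightarrow> tensor_class u \<odot>\<^sub>r\<^bsub>tensor_product S M N\<^esub> c = tensor_class (right_act c u)"
  using coset_of_image[of "right_act c" u] right_act_relations
  by (simp add: tensor_product_def Let_def frag_extend_add)

end

section \<open>Group algebras of finite groups\<close>

definition single :: "('k, 'x) ring_scheme \<Rightarrow> 'k \<Rightarrow> 'g \<Rightarrow> 'g \<Rightarrow> 'k"
  where "single K k g = (\<lambda>x. if x = g then k else \<zero>\<^bsub>K\<^esub>)"

locale finite_group_algebra = K: cring K + G: group G
  for K :: "('k, 'x) ring_scheme" and G :: "('g, 'y) monoid_scheme" +
  assumes fin: "finite (carrier G)"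
begin

abbreviation A where "A \<equiv> group_algebra K G"

lemma carrier_A:
  "a \<in> carrier A \<longleftrightarrow> (\<forall>g. a g \<in> carrier K) \<and> (\<forall>g. g \<notin> carrier G \<longrightarrow> a g = \<zero>\<^bsub>K\<^esub>)"
  using finite_subset[OF _ fin, of "{g. a g \<noteq> \<zero>\<^bsub>K\<^esub>}"] 
  by (auto simp: group_algebra_def)

lemma A_closed [simp]: "a \<in> carrier A \<Longrightarrow> a g \<in> carrier K"
  by (simp add: carrier_A)

lemma A_outside: "a \<in> carrier A \<Longrightarrow> x \<notin> carrier G \<Longrightarrow> a x = \<zero>\<^bsub>K\<^esub>"
  by (simp add: carrier_A)

lemma add_A: "a \<oplus>\<^bsub>A\<^esub> b = (\<lambda>x. a x \<oplus>\<^bsub>K\<^esub> b x)"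
  and zero_A: "\<zero>\<^bsub>A\<^esub> = (\<lambda>x. \<zero>\<^bsub>K\<^esub>)"
  and one_A: "\<one>\<^bsub>A\<^esub> = single K \<one>\<^bsub>K\<^esub> \<one>\<^bsub>G\<^esub>"
  by (simp_all add: group_algebra_def single_def del: A_closed)

lemma mult_A:
  assumes "a \<in> carrier A" "b \<in> carrier A"
  shows "(a \<otimes>\<^bsub>A\<^esub> b) x =
    (if x \<in> carrier G then \<Oplus>\<^bsub>K\<^esub>y\<in>carrier G. a y \<otimes>\<^bsub>K\<^esub> b (inv\<^bsub>G\<^esub> y \<otimes>\<^bsub>G\<^esub> x) else \<zero>\<^bsub>K\<^esub>)"
proof -
  have "(\<Oplus>\<^bsub>K\<^esub>y\<in>{y \<in> carrier G. a y \<noteq> \<zero>\<^bsub>K\<^esub>}. a y \<otimes>\<^bsub>K\<^esub> b (inv\<^bsub>G\<^esub> y \<otimes>\<^bsub>G\<^esub> x))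
      = (\<Oplus>\<^bsub>K\<^esub>y\<in>carrier G. a y \<otimes>\<^bsub>K\<^esub> b (inv\<^bsub>G\<^esub> y \<otimes>\<^bsub>G\<^esub> x))"
    using fin assms by (intro K.add.finprod_mono_neutral_cong_left) auto
  moreover have "(a \<otimes>\<^bsub>A\<^esub> b) x = (if x \<in> carrier G
      then \<Oplus>\<^bsub>K\<^esub>y\<in>{y \<in> carrier G. a y \<noteq> \<zero>\<^bsub>K\<^esub>}. a y \<otimes>\<^bsub>K\<^esub> b (inv\<^bsub>G\<^esub> y \<otimes>\<^bsub>G\<^esub> x) else \<zero>\<^bsub>K\<^esub>)"
    unfolding group_algebra_def by (simp only: partial_object.simps monoid.simps)
  ultimately show ?thesis
    by (simp only:)
qed

lemma mult_A_outside [simp]: "x \<notin> carrier G \<Longrightarrow> (a \<otimes>\<^bsub>A\<^esub> b) x = \<zero>\<^bsub>K\<^esub>"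
  by (simp add: group_algebra_def del: A_closed)

lemma mult_A_closed:
  assumes "a \<in> carrier A" "b \<in> carrier A" shows "a \<otimes>\<^bsub>A\<^esub> b \<in> carrier A"
  using assms by (subst carrier_A) (auto simp: mult_A intro!: K.finsum_closed)

lemma mult_A_assoc:
  assumes "a \<in> carrier A" "b \<in> carrier A" "c \<in> carrier A"
  shows "(a \<otimes>\<^bsub>A\<^esub> b) \<otimes>\<^bsub>A\<^esub> c = a \<otimes>\<^bsub>A\<^esub> (b \<otimes>\<^bsub>A\<^esub> c)"
proof
  fix x
  show "((a \<otimes>\<^bsub>A\<^esub> b) \<otimes>\<^bsub>A\<^esub> c) x = (a \<otimes>\<^bsub>A\<^esub> (b \<otimes>\<^bsub>A\<^esub> c)) x"
  proof (cases "x \<in> carrier G")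
    case x: True
    have "((a \<otimes>\<^bsub>A\<^esub> b) \<otimes>\<^bsub>A\<^esub> c) x
        = (\<Oplus>\<^bsub>K\<^esub>y\<in>carrier G. (\<Oplus>\<^bsub>K\<^esub>z\<in>carrier G. a z \<otimes>\<^bsub>K\<^esub> b (inv\<^bsub>G\<^esub> z \<otimes>\<^bsub>G\<^esub> y)) \<otimes>\<^bsub>K\<^esub> c (inv\<^bsub>G\<^esub> y \<otimes>\<^bsub>G\<^esub> x))"
      using assms x by (simp add: mult_A mult_A_closed cong: K.finsum_cong)
    also have "\<dots> = (\<Oplus>\<^bsub>K\<^esub>y\<in>carrier G. \<Oplus>\<^bsub>K\<^esub>z\<in>carrier G.
        a z \<otimes>\<^bsub>K\<^esub> b (inv\<^bsub>G\<^esub> z \<otimes>\<^bsub>G\<^esub> y) \<otimes>\<^bsub>K\<^esub> c (inv\<^bsub>G\<^esub> y \<otimes>\<^bsub>G\<^esub> x))"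
      using assms by (intro K.finsum_cong' K.finsum_ldistr) (auto intro!: fin K.finsum_closed)
    also have "\<dots> = (\<Oplus>\<^bsub>K\<^esub>z\<in>carrier G. \<Oplus>\<^bsub>K\<^esub>y\<in>carrier G.
        a z \<otimes>\<^bsub>K\<^esub> b (inv\<^bsub>G\<^esub> z \<otimes>\<^bsub>G\<^esub> y) \<otimes>\<^bsub>K\<^esub> c (inv\<^bsub>G\<^esub> y \<otimes>\<^bsub>G\<^esub> x))"
      using assms by (intro K.finsum_swap fin) auto
    also have "\<dots> = (\<Oplus>\<^bsub>K\<^esub>z\<in>carrier G. a z \<otimes>\<^bsub>K\<^esub> (b \<otimes>\<^bsub>A\<^esub> c) (inv\<^bsub>G\<^esub> z \<otimes>\<^bsub>G\<^esub> x))"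
    proof (intro K.finsum_cong')
      fix z assume z: "z \<in> carrier G"
      have bij: "bij_betw (\<lambda>y. z \<otimes>\<^bsub>G\<^esub> y) (carrier G) (carrier G)"
        by (rule G.subgroup_translation_bij(1)[OF G.subgroup_self z])
      have "(\<Oplus>\<^bsub>K\<^esub>y\<in>carrier G. a z \<otimes>\<^bsub>K\<^esub> b (inv\<^bsub>G\<^esub> z \<otimes>\<^bsub>G\<^esub> y) \<otimes>\<^bsub>K\<^esub> c (inv\<^bsub>G\<^esub> y \<otimes>\<^bsub>G\<^esub> x))
         = (\<Oplus>\<^bsub>K\<^esub>y\<in>carrier G. a z \<otimes>\<^bsub>K\<^esub> b (inv\<^bsub>G\<^esub> z \<otimes>\<^bsub>G\<^esub> (z \<otimes>\<^bsub>G\<^esub> y)) \<otimes>\<^bsub>K\<^esub> c (inv\<^bsub>G\<^esub> (z \<otimes>\<^bsub>G\<^esub> y) \<otimes>\<^bsub>G\<^esub> x))"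
        using assms by (intro K.finsum_bij bij) auto
      also have "\<dots> = (\<Oplus>\<^bsub>K\<^esub>y\<in>carrier G. a z \<otimes>\<^bsub>K\<^esub> (b y \<otimes>\<^bsub>K\<^esub> c (inv\<^bsub>G\<^esub> y \<otimes>\<^bsub>G\<^esub> (inv\<^bsub>G\<^esub> z \<otimes>\<^bsub>G\<^esub> x))))"
        using assms z x by (intro K.finsum_cong')
          (auto simp: G.m_assoc[symmetric] G.inv_mult_group K.m_assoc)
      also have "\<dots> = a z \<otimes>\<^bsub>K\<^esub> (\<Oplus>\<^bsub>K\<^esub>y\<in>carrier G. b y \<otimes>\<^bsub>K\<^esub> c (inv\<^bsub>G\<^esub> y \<otimes>\<^bsub>G\<^esub> (inv\<^bsub>G\<^esub> z \<otimes>\<^bsub>G\<^esub> x)))"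
        using assms by (intro K.finsum_rdistr[symmetric] fin) auto
      also have "\<dots> = a z \<otimes>\<^bsub>K\<^esub> (b \<otimes>\<^bsub>A\<^esub> c) (inv\<^bsub>G\<^esub> z \<otimes>\<^bsub>G\<^esub> x)"
        using assms x z by (simp add: mult_A)
      finally show "(\<Oplus>\<^bsub>K\<^esub>y\<in>carrier G. a z \<otimes>\<^bsub>K\<^esub> b (inv\<^bsub>G\<^esub> z \<otimes>\<^bsub>G\<^esub> y) \<otimes>\<^bsub>K\<^esub> c (inv\<^bsub>G\<^esub> y \<otimes>\<^bsub>G\<^esub> x))
         = a z \<otimes>\<^bsub>K\<^esub> (b \<otimes>\<^bsub>A\<^esub> c) (inv\<^bsub>G\<^esub> z \<otimes>\<^bsub>G\<^esub> x)" .
    qed (use A_closed[OF assms(1)] A_closed[OF mult_A_closed[OF assms(2,3)]] in \<open>simp_all add: Pi_iff del: A_closed\<close>)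
    also have "\<dots> = (a \<otimes>\<^bsub>A\<^esub> (b \<otimes>\<^bsub>A\<^esub> c)) x"
      using assms x by (simp add: mult_A[OF _ mult_A_closed])
    finally show ?thesis .
  qed simp
qed

lemma single_closed [simp, intro]:
  "k \<in> carrier K \<Longrightarrow> g \<in> carrier G \<Longrightarrow> single K k g \<in> carrier A"
  by (auto simp: carrier_A single_def simp del: A_closed)

lemma single_mult_left:
  assumes "k \<in> carrier K" "g \<in> carrier G" "a \<in> carrier A" "x \<in> carrier G"
  shows "(single K k g \<otimes>\<^bsub>A\<^esub> a) x = k \<otimes>\<^bsub>K\<^esub> a (inv\<^bsub>G\<^esub> g \<otimes>\<^bsub>G\<^esub> x)"
proof -
  have "(single K k g \<otimes>\<^bsub>A\<^esub> a) x
      = (\<Oplus>\<^bsub>K\<^esub>y\<in>carrier G. if y = g then k \<otimes>\<^bsub>K\<^esub> a (inv\<^bsub>G\<^esub> y \<otimes>\<^bsub>G\<^esub> x) else \<zero>\<^bsub>K\<^esub>)"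
    using assms by (simp add: mult_A) (auto simp: single_def intro!: K.finsum_cong')
  also have "\<dots> = k \<otimes>\<^bsub>K\<^esub> a (inv\<^bsub>G\<^esub> g \<otimes>\<^bsub>G\<^esub> x)"
    using assms fin by (intro K.add.finprod_singleton_swap) auto
  finally show ?thesis .
qed

lemma single_outside [simp]: "g \<in> carrier G \<Longrightarrow> x \<notin> carrier G \<Longrightarrow> single K k g x = \<zero>\<^bsub>K\<^esub>"
  by (auto simp: single_def)

lemma single_mult [simp]:
  assumes "k \<in> carrier K" "l \<in> carrier K" "g \<in> carrier G" "h \<in> carrier G"
  shows "single K k g \<otimes>\<^bsub>A\<^esub> single K l h = single K (k \<otimes>\<^bsub>K\<^esub> l) (g \<otimes>\<^bsub>G\<^esub> h)"
proof
  fix x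
  have "inv\<^bsub>G\<^esub> g \<otimes>\<^bsub>G\<^esub> x = h \<longleftrightarrow> x = g \<otimes>\<^bsub>G\<^esub> h" if "x \<in> carrier G"
    using assms that by (intro G.inv_solve_left')
  then show "(single K k g \<otimes>\<^bsub>A\<^esub> single K l h) x = single K (k \<otimes>\<^bsub>K\<^esub> l) (g \<otimes>\<^bsub>G\<^esub> h) x"
    using assms by (cases "x \<in> carrier G") (auto simp: single_mult_left, auto simp: single_def)
qed

lemma single_add:
  assumes "k \<in> carrier K" "l \<in> carrier K"
  shows "single K (k \<oplus>\<^bsub>K\<^esub> l) g = single K k g \<oplus>\<^bsub>A\<^esub> single K l g"
  using assms by (auto simp: add_A single_def)

lemma single_zero [simp]: "single K \<zero>\<^bsub>K\<^esub> g = \<zero>\<^bsub>A\<^esub>"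
  by (auto simp: zero_A single_def)

lemma add_closed: "a \<in> carrier A \<Longrightarrow> b \<in> carrier A \<Longrightarrow> a \<oplus>\<^bsub>A\<^esub> b \<in> carrier A"
  by (simp add: carrier_A add_A del: A_closed)

lemma ring_A: "ring A"
proof (rule ringI)
  show "abelian_group A"
  proof (rule abelian_groupI)
    fix a assume a: "a \<in> carrier A"
    then have "(\<lambda>g. \<ominus>\<^bsub>K\<^esub> a g) \<in> carrier A" "(\<lambda>g. \<ominus>\<^bsub>K\<^esub> a g) \<oplus>\<^bsub>A\<^esub> a = \<zero>\<^bsub>A\<^esub>"
      by (simp_all add: carrier_A add_A zero_A K.l_neg del: A_closed)
    then show "\<exists>b\<in>carrier A. b \<oplus>\<^bsub>A\<^esub> a = \<zero>\<^bsub>A\<^esub>" by blast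
  next
    fix a b c assume "a \<in> carrier A" "b \<in> carrier A" "c \<in> carrier A"
    then show "a \<oplus>\<^bsub>A\<^esub> b \<oplus>\<^bsub>A\<^esub> c = a \<oplus>\<^bsub>A\<^esub> (b \<oplus>\<^bsub>A\<^esub> c)" by (simp add: add_A K.a_assoc)
  next
    fix a b assume "a \<in> carrier A" "b \<in> carrier A"
    then show "a \<oplus>\<^bsub>A\<^esub> b \<in> carrier A" "a \<oplus>\<^bsub>A\<^esub> b = b \<oplus>\<^bsub>A\<^esub> a"
      by (simp_all add: add_closed) (simp add: add_A K.a_comm)
  next
    show "\<zero>\<^bsub>A\<^esub> \<in> carrier A" by (simp add: carrier_A zero_A del: A_closed)
  next
    fix a assume "a \<in> carrier A"
    then show "\<zero>\<^bsub>A\<^esub> \<oplus>\<^bsub>A\<^esub> a = a" by (simp add: add_A zero_A)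
  qed
  show "monoid A"
  proof (rule monoidI)
    fix a assume a: "a \<in> carrier A"
    show "\<one>\<^bsub>A\<^esub> \<otimes>\<^bsub>A\<^esub> a = a"
    proof
      fix x
      show "(\<one>\<^bsub>A\<^esub> \<otimes>\<^bsub>A\<^esub> a) x = a x"
        using a by (cases "x \<in> carrier G") (auto simp: one_A single_mult_left A_outside)
    qed
    show "a \<otimes>\<^bsub>A\<^esub> \<one>\<^bsub>A\<^esub> = a"
    proof
      fix x
      show "(a \<otimes>\<^bsub>A\<^esub> \<one>\<^bsub>A\<^esub>) x = a x"
      proof (cases "x \<in> carrier G")
        case x: True
        have eq: "inv\<^bsub>G\<^esub> y \<otimes>\<^bsub>G\<^esub> x = \<one>\<^bsub>G\<^esub> \<longleftrightarrow> y = x" if "y \<in> carrier G" for y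
          using that x using G.inv_solve_left'[of "\<one>\<^bsub>G\<^esub>" y x] by auto
        have "(a \<otimes>\<^bsub>A\<^esub> \<one>\<^bsub>A\<^esub>) x = (\<Oplus>\<^bsub>K\<^esub>y\<in>carrier G. if y = x then a y else \<zero>\<^bsub>K\<^esub>)"
          using a x by (simp add: mult_A one_A) (auto simp: eq single_def intro!: K.finsum_cong')
        also have "\<dots> = a x"
          using a x by (intro K.add.finprod_singleton_swap fin) auto
        finally show ?thesis .
      qed (use a in \<open>auto simp: mult_A one_A carrier_A\<close>)
    qed
  qed (auto simp: mult_A_closed mult_A_assoc one_A)
next
  fix a b c assume abc: "a \<in> carrier A" "b \<in> carrier A" "c \<in> carrier A"
  then have ab: "a \<oplus>\<^bsub>A\<^esub> b \<in> carrier A" by (simp add: add_closed)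
  show "(a \<oplus>\<^bsub>A\<^esub> b) \<otimes>\<^bsub>A\<^esub> c = a \<otimes>\<^bsub>A\<^esub> c \<oplus>\<^bsub>A\<^esub> b \<otimes>\<^bsub>A\<^esub> c"
    using abc ab by (auto simp: mult_A fun_eq_iff add_A[of "a \<otimes>\<^bsub>A\<^esub> c"]) 
      (auto simp: add_A K.l_distr intro!: K.finsum_addf[symmetric] K.finsum_cong' 
         simp flip: K.finsum_addf)
  show "c \<otimes>\<^bsub>A\<^esub> (a \<oplus>\<^bsub>A\<^esub> b) = c \<otimes>\<^bsub>A\<^esub> a \<oplus>\<^bsub>A\<^esub> c \<otimes>\<^bsub>A\<^esub> b"
    using abc ab by (auto simp: mult_A fun_eq_iff add_A[of "c \<otimes>\<^bsub>A\<^esub> a"]) 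
      (auto simp: add_A K.r_distr intro!: K.finsum_addf[symmetric] K.finsum_cong' 
         simp flip: K.finsum_addf)
qed

sublocale A: ring A by (rule ring_A)

lemma finsum_A_apply:
  assumes "\<And>i. i \<in> I \<Longrightarrow> f i \<in> carrier A"
  shows "(\<Oplus>\<^bsub>A\<^esub>i\<in>I. f i) x = (\<Oplus>\<^bsub>K\<^esub>i\<in>I. f i x)"
  using assms
  by (intro hom_finsum[where h = "\<lambda>a. a x"] A.abelian_monoid_axioms K.abelian_monoid_axioms)
    (auto simp: add_A zero_A)

text \<open>Linear identities in the group algebra are proved by checking them on scalar multiples of group
  elements.  The element \<open>a\<close> is kept in the case for basis elements, which restricts the check to the
  support of \<open>a\<close>; that is how statements about the subalgebra of a subgroup are obtained.\<close>

lemma group_algebra_induct [consumes 1, case_names zero single add]: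
  assumes a: "a \<in> carrier A"
    and zero: "P \<zero>\<^bsub>A\<^esub>"
    and single: "\<And>k g. k \<in> carrier K \<Longrightarrow> g \<in> carrier G \<Longrightarrow> a g \<noteq> \<zero>\<^bsub>K\<^esub> \<Longrightarrow> P (single K k g)"
    and add: "\<And>b c. b \<in> carrier A \<Longrightarrow> c \<in> carrier A \<Longrightarrow> P b \<Longrightarrow> P c \<Longrightarrow> P (b \<oplus>\<^bsub>A\<^esub> c)"
  shows "P a"
proof -
  have sums: "P (\<Oplus>\<^bsub>A\<^esub>g\<in>S. single K (a g) g)" if "S \<subseteq> {g. a g \<noteq> \<zero>\<^bsub>K\<^esub>}" "finite S" for S
    using that(2,1)
  proof (induction S rule: finite_induct)
    case (insert g S)
    have "g \<in> carrier G" "\<And>h. h \<in> S \<Longrightarrow> h \<in> carrier G"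
      using insert.prems A_outside[OF a] by auto
    then show ?case
      using insert a by (subst A.finsum_insert) (auto intro!: add single A.finsum_closed)
  qed (simp add: zero)
  have supp: "g \<in> carrier G" if "a g \<noteq> \<zero>\<^bsub>K\<^esub>" for g
    using A_outside[OF a] that by blast
  have fs: "finite {g. a g \<noteq> \<zero>\<^bsub>K\<^esub>}"
    using supp by (intro finite_subset[OF _ fin]) auto
  from sums[of "{g. a g \<noteq> \<zero>\<^bsub>K\<^esub>}"] have P: "P (\<Oplus>\<^bsub>A\<^esub>g\<in>{g. a g \<noteq> \<zero>\<^bsub>K\<^esub>}. single K (a g) g)"
    using fs by blast
  have "(\<Oplus>\<^bsub>A\<^esub>g\<in>{g. a g \<noteq> \<zero>\<^bsub>K\<^esub>}. single K (a g) g) = a"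
  proof
    fix x
    have "(\<Oplus>\<^bsub>A\<^esub>g\<in>{g. a g \<noteq> \<zero>\<^bsub>K\<^esub>}. single K (a g) g) x
        = (\<Oplus>\<^bsub>K\<^esub>g\<in>{g. a g \<noteq> \<zero>\<^bsub>K\<^esub>}. single K (a g) g x)"
      using a by (intro finsum_A_apply single_closed supp) auto
    also have "\<dots> = (\<Oplus>\<^bsub>K\<^esub>g\<in>{g. a g \<noteq> \<zero>\<^bsub>K\<^esub>}. if x = g then a g else \<zero>\<^bsub>K\<^esub>)"
      by (simp add: single_def)
    also have "\<dots> = a x"
    proof (cases "a x = \<zero>\<^bsub>K\<^esub>")
      case True
      then show ?thesis by (intro trans[OF K.add.finprod_one_eqI]) auto
    next
      case False
      then show ?thesis using a fs by (intro K.add.finprod_singleton) auto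
    qed
    finally show "(\<Oplus>\<^bsub>A\<^esub>g\<in>{g. a g \<noteq> \<zero>\<^bsub>K\<^esub>}. single K (a g) g) x = a x" .
  qed
  with P show ?thesis by (simp only:)
qed

end

section \<open>Subgroup algebras and sums of conjugates\<close>

locale group_algebra_extension = finite_group_algebra K G + H: subgroup H G
  for K :: "('k, 'x) ring_scheme" and G :: "('g, 'y) monoid_scheme" and H :: "'g set"
begin

abbreviation \<delta> where "\<delta> \<equiv> single K \<one>\<^bsub>K\<^esub>"
abbreviation B where "B \<equiv> subgroup_algebra K G H"

lemma H_in_G [simp]: "h \<in> H \<Longrightarrow> h \<in> carrier G" by (rule H.mem_carrier)
lemma H_inv [simp]: "h \<in> H \<Longrightarrow> inv\<^bsub>G\<^esub> h \<in> H" by (rule H.m_inv_closed)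
lemma finite_H: "finite H" using fin H.subset by (rule rev_finite_subset)

lemma \<delta>_inv [simp]: "g \<in> carrier G \<Longrightarrow> \<delta> g \<otimes>\<^bsub>A\<^esub> \<delta> (inv\<^bsub>G\<^esub> g) = \<one>\<^bsub>A\<^esub>"
    "g \<in> carrier G \<Longrightarrow> \<delta> (inv\<^bsub>G\<^esub> g) \<otimes>\<^bsub>A\<^esub> \<delta> g = \<one>\<^bsub>A\<^esub>"
  by (simp_all add: one_A)

lemma mem_B: "b \<in> B \<longleftrightarrow> b \<in> carrier A \<and> (\<forall>g. g \<notin> H \<longrightarrow> b g = \<zero>\<^bsub>K\<^esub>)"
proof -
  have HG: "finite_group_algebra K (G\<lparr>carrier := H\<rparr>)"
    using H.subgroup_is_group[OF G.is_group] finite_H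
    by (intro finite_group_algebra.intro finite_group_algebra_axioms.intro K.cring_axioms) simp_all
  have "g \<notin> H" if "g \<notin> carrier G" for g using H.mem_carrier that by blast
  moreover have "carrier (G\<lparr>carrier := H\<rparr>) = H" by simp
  ultimately show ?thesis
    unfolding finite_group_algebra.carrier_A[OF HG] carrier_A by metis
qed

lemma B_in_A: "b \<in> B \<Longrightarrow> b \<in> carrier A" by (simp add: mem_B)

lemma B_support: "b \<in> B \<Longrightarrow> b g \<noteq> \<zero>\<^bsub>K\<^esub> \<Longrightarrow> g \<in> H" by (auto simp: mem_B)

lemma single_in_B [simp]: "k \<in> carrier K \<Longrightarrow> h \<in> H \<Longrightarrow> single K k h \<in> B"
  by (simp add: mem_B) (auto simp: single_def)

text \<open>The projection \<open>kG \<rightarrow> kH\<close> that forgets the coefficients outside \<open>H\<close>.  It is \<open>kH\<close>-linear on both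
  sides because the complement of \<open>H\<close> is stable under multiplication by elements of \<open>H\<close>.\<close>

definition E :: "('g \<Rightarrow> 'k) \<Rightarrow> 'g \<Rightarrow> 'k"
  where "E a = (\<lambda>x. if x \<in> H then a x else \<zero>\<^bsub>K\<^esub>)"

lemma E_in_B: "a \<in> carrier A \<Longrightarrow> E a \<in> B"
  by (auto simp: mem_B carrier_A E_def simp del: A_closed)

lemma E_closed [simp]: "a \<in> carrier A \<Longrightarrow> E a \<in> carrier A"
  by (simp add: E_in_B B_in_A)

lemma E_add: "E (a \<oplus>\<^bsub>A\<^esub> a') = E a \<oplus>\<^bsub>A\<^esub> E a'"
  by (auto simp: E_def add_A)

lemma E_zero [simp]: "E \<zero>\<^bsub>A\<^esub> = \<zero>\<^bsub>A\<^esub>"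
  by (auto simp: E_def zero_A)

lemma E_single: "E (single K k g) = (if g \<in> H then single K k g else \<zero>\<^bsub>A\<^esub>)"
  by (auto simp: E_def single_def zero_A)

lemma E_of_B: "b \<in> B \<Longrightarrow> E b = b"
  by (auto simp: E_def mem_B)

lemma H_mult_iff: "h \<in> H \<Longrightarrow> g \<in> carrier G \<Longrightarrow> h \<otimes>\<^bsub>G\<^esub> g \<in> H \<longleftrightarrow> g \<in> H"
    "h \<in> H \<Longrightarrow> g \<in> carrier G \<Longrightarrow> g \<otimes>\<^bsub>G\<^esub> h \<in> H \<longleftrightarrow> g \<in> H"
proof -
  assume hg: "h \<in> H" "g \<in> carrier G"
  have "inv\<^bsub>G\<^esub> h \<otimes>\<^bsub>G\<^esub> (h \<otimes>\<^bsub>G\<^esub> g) = g" "g \<otimes>\<^bsub>G\<^esub> h \<otimes>\<^bsub>G\<^esub> inv\<^bsub>G\<^esub> h = g"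
    using hg by (simp_all add: G.m_assoc, simp add: G.m_assoc[symmetric])
  then show "h \<otimes>\<^bsub>G\<^esub> g \<in> H \<longleftrightarrow> g \<in> H" "g \<otimes>\<^bsub>G\<^esub> h \<in> H \<longleftrightarrow> g \<in> H"
    using hg H.m_closed H_inv by metis+
qed

lemma E_left_linear:
  assumes a: "a \<in> carrier A" and b: "b \<in> B"
  shows "E (b \<otimes>\<^bsub>A\<^esub> a) = b \<otimes>\<^bsub>A\<^esub> E a"
  using B_in_A[OF b]
proof (induction b rule: group_algebra_induct)
  case (single k h)
  from B_support[OF b this(3)] have h: "h \<in> H" .
  show ?case
    using a
  proof (induction a rule: group_algebra_induct)
    case (single l g)
    then show ?case using h \<open>k \<in> carrier K\<close> by (simp add: E_single H_mult_iff)
  qed (use h \<open>k \<in> carrier K\<close> in \<open>simp_all add: A.r_distr E_add\<close>)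
qed (use a in \<open>simp_all add: A.l_distr E_add\<close>)

lemma E_right_linear:
  assumes a: "a \<in> carrier A" and b: "b \<in> B"
  shows "E (a \<otimes>\<^bsub>A\<^esub> b) = E a \<otimes>\<^bsub>A\<^esub> b"
  using B_in_A[OF b]
proof (induction b rule: group_algebra_induct)
  case (single k h)
  from B_support[OF b this(3)] have h: "h \<in> H" .
  show ?case
    using a
  proof (induction a rule: group_algebra_induct)
    case (single l g)
    then show ?case using h \<open>k \<in> carrier K\<close> by (simp add: E_single H_mult_iff)
  qed (use h \<open>k \<in> carrier K\<close> in \<open>simp_all add: A.l_distr E_add\<close>)
qed (use a in \<open>simp_all add: A.r_distr E_add\<close>)

lemma subring_B: "subring B A"
proof (rule A.subringI)
  show "B \<subseteq> carrier A" using B_in_A by blast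
  show "\<one>\<^bsub>A\<^esub> \<in> B" using H.one_closed by (simp add: one_A)
next
  fix b c assume bc: "b \<in> B" "c \<in> B"
  have "E (b \<otimes>\<^bsub>A\<^esub> c) = b \<otimes>\<^bsub>A\<^esub> c" "E (b \<oplus>\<^bsub>A\<^esub> c) = b \<oplus>\<^bsub>A\<^esub> c"
    using bc by (simp_all add: E_left_linear E_of_B E_add B_in_A)
  then show "b \<otimes>\<^bsub>A\<^esub> c \<in> B" "b \<oplus>\<^bsub>A\<^esub> c \<in> B"
    using bc E_in_B A.m_closed A.a_closed B_in_A by metis+
next
  fix b assume b: "b \<in> B"
  have "E (\<ominus>\<^bsub>A\<^esub> b) \<oplus>\<^bsub>A\<^esub> E b = \<zero>\<^bsub>A\<^esub>"
    using b by (simp add: A.l_neg B_in_A flip: E_add)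
  then have "E (\<ominus>\<^bsub>A\<^esub> b) = \<ominus>\<^bsub>A\<^esub> b"
    using A.minus_equality[of "E (\<ominus>\<^bsub>A\<^esub> b)" b] b by (simp add: E_of_B B_in_A)
  then show "\<ominus>\<^bsub>A\<^esub> b \<in> B"
    using E_in_B[of "\<ominus>\<^bsub>A\<^esub> b"] b by (simp add: B_in_A)
qed

lemma scalar_central:
  assumes k: "k \<in> carrier K" and a: "a \<in> carrier A"
  shows "single K k \<one>\<^bsub>G\<^esub> \<otimes>\<^bsub>A\<^esub> a = a \<otimes>\<^bsub>A\<^esub> single K k \<one>\<^bsub>G\<^esub>"
  using a by (induction a rule: group_algebra_induct) (simp_all add: k A.l_distr A.r_distr K.m_comm)

lemma single_eq_scalar:
  "k \<in> carrier K \<Longrightarrow> g \<in> carrier G \<Longrightarrow> single K k g = single K k \<one>\<^bsub>G\<^esub> \<otimes>\<^bsub>A\<^esub> \<delta> g"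
  by simp

lemma commutes_if_basis:
  assumes z: "z \<in> carrier A" and a: "a \<in> carrier A"
    and basis: "\<And>g. g \<in> carrier G \<Longrightarrow> a g \<noteq> \<zero>\<^bsub>K\<^esub> \<Longrightarrow> \<delta> g \<otimes>\<^bsub>A\<^esub> z = z \<otimes>\<^bsub>A\<^esub> \<delta> g"
  shows "a \<otimes>\<^bsub>A\<^esub> z = z \<otimes>\<^bsub>A\<^esub> a"
  using a
proof (induction a rule: group_algebra_induct)
  case (single k g)
  let ?k = "single K k \<one>\<^bsub>G\<^esub>"
  have "single K k g \<otimes>\<^bsub>A\<^esub> z = ?k \<otimes>\<^bsub>A\<^esub> (z \<otimes>\<^bsub>A\<^esub> \<delta> g)"
    using single z by (subst single_eq_scalar) (simp_all add: A.m_assoc basis del: single_mult)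
  also have "\<dots> = z \<otimes>\<^bsub>A\<^esub> single K k g"
    using single z scalar_central[OF _ z, of k]
    by (subst (2) single_eq_scalar) (simp_all add: A.m_assoc[symmetric] del: single_mult)
  finally show ?case .
qed (use z in \<open>simp_all add: A.l_distr A.r_distr\<close>)

text \<open>The (unnormalised) trace map.  For \<open>S = G\<close> its values are central; for \<open>S = H\<close> they only commute
  with \<open>kH\<close> in general, and for \<open>r = g\<close> they are multiples of the sum over the \<open>H\<close>-conjugacy class
  of \<open>g\<close>.\<close>

definition conj_sum :: "'g set \<Rightarrow> ('g \<Rightarrow> 'k) \<Rightarrow> 'g \<Rightarrow> 'k"
  where "conj_sum S r = (\<Oplus>\<^bsub>A\<^esub>g\<in>S. \<delta> g \<otimes>\<^bsub>A\<^esub> r \<otimes>\<^bsub>A\<^esub> \<delta> (inv\<^bsub>G\<^esub> g))"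

lemma conj_sum_closed [simp]: "S \<subseteq> carrier G \<Longrightarrow> r \<in> carrier A \<Longrightarrow> conj_sum S r \<in> carrier A"
  unfolding conj_sum_def by (intro A.finsum_closed) auto

lemma conj_sum_add:
  assumes "S \<subseteq> carrier G" "r \<in> carrier A" "s \<in> carrier A"
  shows "conj_sum S (r \<oplus>\<^bsub>A\<^esub> s) = conj_sum S r \<oplus>\<^bsub>A\<^esub> conj_sum S s"
proof -
  have "conj_sum S (r \<oplus>\<^bsub>A\<^esub> s) = (\<Oplus>\<^bsub>A\<^esub>g\<in>S. \<delta> g \<otimes>\<^bsub>A\<^esub> r \<otimes>\<^bsub>A\<^esub> \<delta> (inv\<^bsub>G\<^esub> g) \<oplus>\<^bsub>A\<^esub> \<delta> g \<otimes>\<^bsub>A\<^esub> s \<otimes>\<^bsub>A\<^esub> \<delta> (inv\<^bsub>G\<^esub> g))"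
    unfolding conj_sum_def using assms by (intro A.finsum_cong') (auto simp: A.l_distr A.r_distr subset_iff)
  also have "\<dots> = conj_sum S r \<oplus>\<^bsub>A\<^esub> conj_sum S s"
    unfolding conj_sum_def using assms by (intro A.finsum_addf) auto
  finally show ?thesis .
qed

lemma conj_sum_commutes_basis:
  assumes S: "subgroup S G" and t: "t \<in> S" and r: "r \<in> carrier A"
  shows "\<delta> t \<otimes>\<^bsub>A\<^esub> conj_sum S r = conj_sum S r \<otimes>\<^bsub>A\<^esub> \<delta> t"
proof -
  have SG [simp]: "g \<in> carrier G" if "g \<in> S" for g using S that by (rule subgroup.mem_carrier)
  have finS: "finite S" using fin SG by (meson finite_subset subsetI)
  have bij: "bij_betw (\<lambda>g. t \<otimes>\<^bsub>G\<^esub> g) S S"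
    by (rule G.subgroup_translation_bij(1)[OF S t])
  have "\<delta> t \<otimes>\<^bsub>A\<^esub> conj_sum S r = (\<Oplus>\<^bsub>A\<^esub>g\<in>S. \<delta> t \<otimes>\<^bsub>A\<^esub> (\<delta> g \<otimes>\<^bsub>A\<^esub> r \<otimes>\<^bsub>A\<^esub> \<delta> (inv\<^bsub>G\<^esub> g)))"
    unfolding conj_sum_def using r t finS by (intro A.finsum_rdistr) auto
  also have "\<dots> = (\<Oplus>\<^bsub>A\<^esub>g\<in>S. (\<delta> (t \<otimes>\<^bsub>G\<^esub> g) \<otimes>\<^bsub>A\<^esub> r \<otimes>\<^bsub>A\<^esub> \<delta> (inv\<^bsub>G\<^esub> (t \<otimes>\<^bsub>G\<^esub> g))) \<otimes>\<^bsub>A\<^esub> \<delta> t)"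
  proof (intro A.finsum_cong' refl)
    fix g assume g: "g \<in> S"
    have "\<delta> (inv\<^bsub>G\<^esub> (t \<otimes>\<^bsub>G\<^esub> g)) \<otimes>\<^bsub>A\<^esub> \<delta> t = \<delta> (inv\<^bsub>G\<^esub> g)"
      using g t by (simp add: G.inv_mult_group G.m_assoc)
    moreover have "\<delta> (t \<otimes>\<^bsub>G\<^esub> g) = \<delta> t \<otimes>\<^bsub>A\<^esub> \<delta> g" using g t by simp
    ultimately show "\<delta> t \<otimes>\<^bsub>A\<^esub> (\<delta> g \<otimes>\<^bsub>A\<^esub> r \<otimes>\<^bsub>A\<^esub> \<delta> (inv\<^bsub>G\<^esub> g))
        = (\<delta> (t \<otimes>\<^bsub>G\<^esub> g) \<otimes>\<^bsub>A\<^esub> r \<otimes>\<^bsub>A\<^esub> \<delta> (inv\<^bsub>G\<^esub> (t \<otimes>\<^bsub>G\<^esub> g))) \<otimes>\<^bsub>A\<^esub> \<delta> t"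
      using g t r by (simp add: A.m_assoc del: single_mult)
  qed (use r t in auto)
  also have "\<dots> = (\<Oplus>\<^bsub>A\<^esub>g\<in>S. (\<delta> g \<otimes>\<^bsub>A\<^esub> r \<otimes>\<^bsub>A\<^esub> \<delta> (inv\<^bsub>G\<^esub> g)) \<otimes>\<^bsub>A\<^esub> \<delta> t)"
    using r t by (intro A.finsum_bij[symmetric, OF bij]) auto
  also have "\<dots> = conj_sum S r \<otimes>\<^bsub>A\<^esub> \<delta> t"
    unfolding conj_sum_def using r t finS by (intro A.finsum_ldistr[symmetric]) auto
  finally show ?thesis .
qed

lemma conj_sum_central:
  assumes "r \<in> carrier A" "a \<in> carrier A"
  shows "a \<otimes>\<^bsub>A\<^esub> conj_sum (carrier G) r = conj_sum (carrier G) r \<otimes>\<^bsub>A\<^esub> a"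
  by (rule commutes_if_basis[OF conj_sum_closed[OF subset_refl assms(1)] assms(2)])
    (rule conj_sum_commutes_basis[OF G.subgroup_self _ assms(1)])

lemma conj_sum_commuting:
  assumes "S \<subseteq> carrier G" "z \<in> carrier A" "\<And>g. g \<in> S \<Longrightarrow> \<delta> g \<otimes>\<^bsub>A\<^esub> z = z \<otimes>\<^bsub>A\<^esub> \<delta> g"
  shows "conj_sum S z = [card S] \<cdot>\<^bsub>A\<^esub> z"
proof -
  have "conj_sum S z = (\<Oplus>\<^bsub>A\<^esub>g\<in>S. z)"
    unfolding conj_sum_def
  proof (intro A.finsum_cong' refl)
    fix g assume g: "g \<in> S"
    then have "\<delta> g \<in> carrier A" "\<delta> (inv\<^bsub>G\<^esub> g) \<in> carrier A" "g \<in> carrier G" using assms by auto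
    then show "\<delta> g \<otimes>\<^bsub>A\<^esub> z \<otimes>\<^bsub>A\<^esub> \<delta> (inv\<^bsub>G\<^esub> g) = z"
      using assms(2) assms(3)[OF g] by (simp add: A.m_assoc del: single_mult)
  qed (use assms(2) in auto)
  also have "\<dots> = [card S] \<cdot>\<^bsub>A\<^esub> z"
    by (rule A.add.finprod_const[OF assms(2)])
  finally show ?thesis .
qed

end

section \<open>Separability elements of group algebra extensions\<close>

locale char_zero_group_algebra_extension = group_algebra_extension K G H
  for K :: "('k, 'x) ring_scheme" and G :: "('g, 'y) monoid_scheme" and H :: "'g set" +
  assumes field_K: "field K"
    and char_zero: "\<And>n::nat. n > 0 \<Longrightarrow> [n] \<cdot>\<^bsub>K\<^esub> \<one>\<^bsub>K\<^esub> \<noteq> \<zero>\<^bsub>K\<^esub>"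
begin

abbreviation scalar where "scalar k \<equiv> single K k \<one>\<^bsub>G\<^esub>"

lemma scalar_inverse:
  assumes "k \<in> carrier K" "k \<noteq> \<zero>\<^bsub>K\<^esub>"
  shows "inv\<^bsub>K\<^esub> k \<in> carrier K" "scalar (inv\<^bsub>K\<^esub> k) \<otimes>\<^bsub>A\<^esub> scalar k = \<one>\<^bsub>A\<^esub>"
proof -
  interpret F: field K by (rule field_K)
  have k: "k \<in> Units K" using assms F.field_Units by blast
  show "inv\<^bsub>K\<^esub> k \<in> carrier K" using k by simp
  then show "scalar (inv\<^bsub>K\<^esub> k) \<otimes>\<^bsub>A\<^esub> scalar k = \<one>\<^bsub>A\<^esub>"
    using k assms by (simp add: one_A)
qed

lemma scalar_cancel:
  assumes "k \<in> carrier K" "k \<noteq> \<zero>\<^bsub>K\<^esub>" "a \<in> carrier A"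
  shows "scalar (inv\<^bsub>K\<^esub> k) \<otimes>\<^bsub>A\<^esub> (scalar k \<otimes>\<^bsub>A\<^esub> a) = a"
  using scalar_inverse[OF assms(1,2)] assms by (simp add: A.m_assoc[symmetric] del: single_mult)

lemma add_pow_closed [simp]: "[(n::nat)] \<cdot>\<^bsub>K\<^esub> \<one>\<^bsub>K\<^esub> \<in> carrier K"
  by (intro K.add.nat_pow_closed) simp

lemma multiple_eq_scalar:
  assumes "a \<in> carrier A"
  shows "[(n::nat)] \<cdot>\<^bsub>A\<^esub> a = scalar ([n] \<cdot>\<^bsub>K\<^esub> \<one>\<^bsub>K\<^esub>) \<otimes>\<^bsub>A\<^esub> a"
proof (induction n)
  case 0
  then show ?case using assms A.add.nat_pow_0 K.add.nat_pow_0 by simp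
next
  case (Suc n)
  have "scalar ([Suc n] \<cdot>\<^bsub>K\<^esub> \<one>\<^bsub>K\<^esub>) = scalar ([n] \<cdot>\<^bsub>K\<^esub> \<one>\<^bsub>K\<^esub>) \<oplus>\<^bsub>A\<^esub> \<one>\<^bsub>A\<^esub>"
    by (simp add: single_add one_A)
  then show ?case using Suc assms by (simp add: A.l_distr)
qed

lemma conj_sum_scalar:
  assumes "S \<subseteq> carrier G" "k \<in> carrier K" "r \<in> carrier A"
  shows "conj_sum S (scalar k \<otimes>\<^bsub>A\<^esub> r) = scalar k \<otimes>\<^bsub>A\<^esub> conj_sum S r"
proof -
  have finS: "finite S" using assms(1) fin by (rule finite_subset)
  have "conj_sum S (scalar k \<otimes>\<^bsub>A\<^esub> r)
      = (\<Oplus>\<^bsub>A\<^esub>g\<in>S. scalar k \<otimes>\<^bsub>A\<^esub> (\<delta> g \<otimes>\<^bsub>A\<^esub> r \<otimes>\<^bsub>A\<^esub> \<delta> (inv\<^bsub>G\<^esub> g)))"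
    unfolding conj_sum_def
  proof (intro A.finsum_cong' refl)
    fix g assume "g \<in> S"
    then have g: "g \<in> carrier G" using assms(1) by blast
    have "\<delta> g \<otimes>\<^bsub>A\<^esub> (scalar k \<otimes>\<^bsub>A\<^esub> r) = scalar k \<otimes>\<^bsub>A\<^esub> (\<delta> g \<otimes>\<^bsub>A\<^esub> r)"
      using assms g by (simp add: A.m_assoc[symmetric])
    then show "\<delta> g \<otimes>\<^bsub>A\<^esub> (scalar k \<otimes>\<^bsub>A\<^esub> r) \<otimes>\<^bsub>A\<^esub> \<delta> (inv\<^bsub>G\<^esub> g)
        = scalar k \<otimes>\<^bsub>A\<^esub> (\<delta> g \<otimes>\<^bsub>A\<^esub> r \<otimes>\<^bsub>A\<^esub> \<delta> (inv\<^bsub>G\<^esub> g))"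
      using assms g by (simp add: A.m_assoc)
  qed (use assms in auto)
  also have "\<dots> = scalar k \<otimes>\<^bsub>A\<^esub> conj_sum S r"
    unfolding conj_sum_def using assms finS by (intro A.finsum_rdistr[symmetric]) auto
  finally show ?thesis .
qed

abbreviation A_bimodule where "A_bimodule \<equiv> regular_bimodule A (carrier A)"

lemma regular_simps [simp]: "carrier (regular_bimodule A C) = C"
  "x \<odot>\<^bsub>regular_bimodule A C\<^esub> y = x \<otimes>\<^bsub>A\<^esub> y" "x \<odot>\<^sub>r\<^bsub>regular_bimodule A C\<^esub> y = x \<otimes>\<^bsub>A\<^esub> y"
  "x \<oplus>\<^bsub>regular_bimodule A C\<^esub> y = x \<oplus>\<^bsub>A\<^esub> y"
  by (simp_all add: regular_bimodule_def)

lemma tensor_factors_A: "tensor_factors A (A\<lparr>carrier := B\<rparr>) A A_bimodule A_bimodule"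
proof -
  have "B \<subseteq> carrier A" using B_in_A by blast
  then show ?thesis
    using bimodule_regular[OF ring_A subring_B A.carrier_is_subring A.carrier_is_subring]
      bimodule_regular[OF ring_A A.carrier_is_subring subring_B A.carrier_is_subring]
    by (intro tensor_factors.intro) simp_all
qed

interpretation T: tensor_factors A "A\<lparr>carrier := B\<rparr>" A A_bimodule A_bimodule
  by (rule tensor_factors_A)

text \<open>A representative of \<open>\<Sum>\<^sub>g g r \<otimes> g\<inverse>\<close>, summed over all of \<open>G\<close> and not over coset representatives.
  This costs only the factor \<open>|H|\<close> and allows \<open>r\<close> to be an arbitrary element of \<open>kG\<close>: a sum over
  cosets would be well defined only for \<open>r\<close> commuting with \<open>kH\<close>.\<close>

definition sep_tensor :: "('g \<Rightarrow> 'k) \<Rightarrow> (('g \<Rightarrow> 'k) \<times> ('g \<Rightarrow> 'k)) \<Rightarrow>\<^sub>0 int"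
  where "sep_tensor r = (\<Sum>g\<in>carrier G. frag_of (\<delta> g \<otimes>\<^bsub>A\<^esub> r, \<delta> (inv\<^bsub>G\<^esub> g)))"

lemma sep_tensor_closed: "r \<in> carrier A \<Longrightarrow> sep_tensor r \<in> carrier T.F"
  unfolding sep_tensor_def carrier_free_Abelian_group_iff
  by (rule keys_sum_subset) simp

text \<open>For \<open>a = k s\<close> the substitution \<open>g \<mapsto> s g\<close> turns \<open>\<Sum>\<^sub>g g r \<otimes> g\<inverse> s k\<close> into \<open>\<Sum>\<^sub>g s g r \<otimes> g\<inverse> k\<close>, and the
  scalar \<open>k\<close> lies in \<open>kH\<close>, so it can be moved across the tensor sign.\<close>

lemma sep_tensor_invariant:
  assumes r: "r \<in> carrier A" and a: "a \<in> carrier A"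
  shows "T.left_act a (sep_tensor r) - T.right_act a (sep_tensor r) \<in> T.Q"
proof -
  have left: "T.left_act a (sep_tensor r) = (\<Sum>g\<in>carrier G. frag_of (a \<otimes>\<^bsub>A\<^esub> (\<delta> g \<otimes>\<^bsub>A\<^esub> r), \<delta> (inv\<^bsub>G\<^esub> g)))"
    and right: "T.right_act a (sep_tensor r) = (\<Sum>g\<in>carrier G. frag_of (\<delta> g \<otimes>\<^bsub>A\<^esub> r, \<delta> (inv\<^bsub>G\<^esub> g) \<otimes>\<^bsub>A\<^esub> a))"
    for a
    unfolding sep_tensor_def by (simp_all add: frag_extend_sum fin)
  show ?thesis
    using a
  proof (induction a rule: group_algebra_induct)
    case zero
    have "frag_of (\<zero>\<^bsub>A\<^esub>, \<delta> (inv\<^bsub>G\<^esub> g)) - frag_of (\<delta> g \<otimes>\<^bsub>A\<^esub> r, \<zero>\<^bsub>A\<^esub>) \<in> T.Q" if "g \<in> carrier G" for g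
      using T.tensor_balanced[of "\<delta> g \<otimes>\<^bsub>A\<^esub> r" "\<zero>\<^bsub>A\<^esub>" "\<delta> (inv\<^bsub>G\<^esub> g)"] that r subringE(2)[OF subring_B]
      by simp
    then show ?case
      using r unfolding left right by (simp add: sum_subtractf[symmetric] T.relations_sum)
  next
    case (single k s)
    have bij: "bij_betw (\<lambda>g. s \<otimes>\<^bsub>G\<^esub> g) (carrier G) (carrier G)"
      by (rule G.subgroup_translation_bij(1)[OF G.subgroup_self single(2)])
    have "T.right_act (single K k s) (sep_tensor r)
        = (\<Sum>g\<in>carrier G. frag_of (\<delta> (s \<otimes>\<^bsub>G\<^esub> g) \<otimes>\<^bsub>A\<^esub> r, \<delta> (inv\<^bsub>G\<^esub> (s \<otimes>\<^bsub>G\<^esub> g)) \<otimes>\<^bsub>A\<^esub> single K k s))"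
      unfolding right by (rule sum.reindex_bij_betw[OF bij, symmetric])
    then have "T.left_act (single K k s) (sep_tensor r) - T.right_act (single K k s) (sep_tensor r)
      = (\<Sum>g\<in>carrier G. frag_of (single K k s \<otimes>\<^bsub>A\<^esub> (\<delta> g \<otimes>\<^bsub>A\<^esub> r), \<delta> (inv\<^bsub>G\<^esub> g))
          - frag_of (\<delta> (s \<otimes>\<^bsub>G\<^esub> g) \<otimes>\<^bsub>A\<^esub> r, \<delta> (inv\<^bsub>G\<^esub> (s \<otimes>\<^bsub>G\<^esub> g)) \<otimes>\<^bsub>A\<^esub> single K k s))"
      unfolding left by (simp add: sum_subtractf)
    also have "\<dots> \<in> T.Q"
    proof (rule T.relations_sum)
      fix g assume g: "g \<in> carrier G"
      have "single K k s \<otimes>\<^bsub>A\<^esub> (\<delta> g \<otimes>\<^bsub>A\<^esub> r) = scalar k \<otimes>\<^bsub>A\<^esub> (\<delta> (s \<otimes>\<^bsub>G\<^esub> g) \<otimes>\<^bsub>A\<^esub> r)"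
        using g r single(1,2) by (simp add: A.m_assoc[symmetric])
      also have "\<dots> = (\<delta> (s \<otimes>\<^bsub>G\<^esub> g) \<otimes>\<^bsub>A\<^esub> r) \<otimes>\<^bsub>A\<^esub> scalar k"
        using g r single(1,2) by (intro scalar_central) simp_all
      finally have l: "single K k s \<otimes>\<^bsub>A\<^esub> (\<delta> g \<otimes>\<^bsub>A\<^esub> r) = (\<delta> (s \<otimes>\<^bsub>G\<^esub> g) \<otimes>\<^bsub>A\<^esub> r) \<otimes>\<^bsub>A\<^esub> scalar k" .
      have r': "\<delta> (inv\<^bsub>G\<^esub> (s \<otimes>\<^bsub>G\<^esub> g)) \<otimes>\<^bsub>A\<^esub> single K k s = scalar k \<otimes>\<^bsub>A\<^esub> \<delta> (inv\<^bsub>G\<^esub> g)"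
        using g single(1,2) by (simp add: G.inv_mult_group G.m_assoc)
      show "frag_of (single K k s \<otimes>\<^bsub>A\<^esub> (\<delta> g \<otimes>\<^bsub>A\<^esub> r), \<delta> (inv\<^bsub>G\<^esub> g))
          - frag_of (\<delta> (s \<otimes>\<^bsub>G\<^esub> g) \<otimes>\<^bsub>A\<^esub> r, \<delta> (inv\<^bsub>G\<^esub> (s \<otimes>\<^bsub>G\<^esub> g)) \<otimes>\<^bsub>A\<^esub> single K k s) \<in> T.Q"
        unfolding l r'
        using T.tensor_balanced[of "\<delta> (s \<otimes>\<^bsub>G\<^esub> g) \<otimes>\<^bsub>A\<^esub> r" "scalar k" "\<delta> (inv\<^bsub>G\<^esub> g)"]
          g r single(1,2) H.one_closed by simp
    qed
    finally show ?case .
  next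
    case (add b c)
    let ?u = "sep_tensor r"
    have l: "T.left_act (b \<oplus>\<^bsub>A\<^esub> c) ?u - (T.left_act b ?u + T.left_act c ?u) \<in> T.Q"
      unfolding left sum.distrib[symmetric] sum_subtractf[symmetric]
    proof (rule T.relations_sum)
      fix g assume g: "g \<in> carrier G"
      show "frag_of ((b \<oplus>\<^bsub>A\<^esub> c) \<otimes>\<^bsub>A\<^esub> (\<delta> g \<otimes>\<^bsub>A\<^esub> r), \<delta> (inv\<^bsub>G\<^esub> g))
          - (frag_of (b \<otimes>\<^bsub>A\<^esub> (\<delta> g \<otimes>\<^bsub>A\<^esub> r), \<delta> (inv\<^bsub>G\<^esub> g))
            + frag_of (c \<otimes>\<^bsub>A\<^esub> (\<delta> g \<otimes>\<^bsub>A\<^esub> r), \<delta> (inv\<^bsub>G\<^esub> g))) \<in> T.Q"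
        using T.tensor_add_left[of "b \<otimes>\<^bsub>A\<^esub> (\<delta> g \<otimes>\<^bsub>A\<^esub> r)" "c \<otimes>\<^bsub>A\<^esub> (\<delta> g \<otimes>\<^bsub>A\<^esub> r)" "\<delta> (inv\<^bsub>G\<^esub> g)"]
          add g r by (simp add: A.l_distr)
    qed
    have r: "T.right_act (b \<oplus>\<^bsub>A\<^esub> c) ?u - (T.right_act b ?u + T.right_act c ?u) \<in> T.Q"
      unfolding right sum.distrib[symmetric] sum_subtractf[symmetric]
    proof (rule T.relations_sum)
      fix g assume g: "g \<in> carrier G"
      show "frag_of (\<delta> g \<otimes>\<^bsub>A\<^esub> r, \<delta> (inv\<^bsub>G\<^esub> g) \<otimes>\<^bsub>A\<^esub> (b \<oplus>\<^bsub>A\<^esub> c))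
          - (frag_of (\<delta> g \<otimes>\<^bsub>A\<^esub> r, \<delta> (inv\<^bsub>G\<^esub> g) \<otimes>\<^bsub>A\<^esub> b)
            + frag_of (\<delta> g \<otimes>\<^bsub>A\<^esub> r, \<delta> (inv\<^bsub>G\<^esub> g) \<otimes>\<^bsub>A\<^esub> c)) \<in> T.Q"
        using T.tensor_add_right[of "\<delta> g \<otimes>\<^bsub>A\<^esub> r" "\<delta> (inv\<^bsub>G\<^esub> g) \<otimes>\<^bsub>A\<^esub> b" "\<delta> (inv\<^bsub>G\<^esub> g) \<otimes>\<^bsub>A\<^esub> c"]
          add g r by (simp add: A.r_distr)
    qed
    show ?case
      using T.relations_add[OF T.relations_diff[OF l r] T.relations_add[OF add(3,4)]]
      by (simp add: algebra_simps)
  qed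
qed

lemma frag_mult_sep_tensor:
  assumes "r \<in> carrier A"
  shows "frag_mult A (sep_tensor r) = conj_sum (carrier G) r"
  unfolding frag_mult_eq_frag_sum sep_tensor_def conj_sum_def
  using assms fin by (subst frag_sum_sum[OF A.abelian_group_axioms, of "carrier A \<times> carrier A"]) auto

lemma tensor_mult_class:
  assumes "u \<in> carrier T.F"
  shows "tensor_mult A (T.tensor_class u) = frag_mult A u"
proof -
  let ?P = "carrier A \<times> carrier A"
  have \<phi>: "fst p \<otimes>\<^bsub>A\<^esub> snd p \<in> carrier A" if "p \<in> ?P" for p using that by auto
  note h = frag_sum_hom[OF A.abelian_group_axioms \<phi>, of ?P]
  have kills: "frag_mult A v = \<zero>\<^bsub>A\<^esub>" if "v \<in> T.Q" for v
    using T.relations_in_kernel[where H = "add_monoid A" and h = "frag_mult A" and u = v] that h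
    by (simp add: frag_mult_eq_frag_sum A.l_distr A.r_distr A.m_assoc B_in_A)
  have "frag_mult A v = frag_mult A u" if "v \<in> T.tensor_class u" for v
    using T.hom_eq_if_class_eq[where L = "add_monoid A" and h = "frag_mult A" and u = v and v = u]
      that h(1) kills assms by (simp add: T.mem_tensor_class frag_mult_eq_frag_sum)
  moreover have "u \<in> T.tensor_class u" by (simp add: T.mem_tensor_class T.relations_zero)
  ultimately have "frag_mult A ` T.tensor_class u = {frag_mult A u}" by blast
  then show ?thesis by (simp add: tensor_mult_def)
qed

lemma separability_element_sep_tensor:
  assumes r: "r \<in> carrier A" and tr: "conj_sum (carrier G) r = \<one>\<^bsub>A\<^esub>"
  shows "separability_element A B (T.tensor_class (sep_tensor r))"
  unfolding separability_element_def tensor_square_def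
  using sep_tensor_closed[OF r] T.tensor_class_closed tr sep_tensor_invariant[OF r]
  by (simp add: tensor_mult_class frag_mult_sep_tensor r T.tensor_class_lact T.tensor_class_ract
      T.tensor_class_eq_iff)

text \<open>The tensor determines \<open>tr\<^sub>H r\<close>: the map \<open>x \<otimes> y \<mapsto> x E(y)\<close> is balanced because \<open>E\<close> is left linear,
  and it keeps exactly the summands with \<open>g \<in> H\<close>.\<close>

lemma conj_sum_eq_if_class_eq:
  assumes r: "r \<in> carrier A" "r' \<in> carrier A"
    and eq: "T.tensor_class (sep_tensor r) = T.tensor_class (sep_tensor r')"
  shows "conj_sum H r = conj_sum H r'"
proof -
  let ?P = "carrier A \<times> carrier A"
  let ?\<phi> = "\<lambda>p. fst p \<otimes>\<^bsub>A\<^esub> E (snd p)"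
  have \<phi>: "?\<phi> p \<in> carrier A" if "p \<in> ?P" for p using that by auto
  note h = frag_sum_hom[OF A.abelian_group_axioms \<phi>, of ?P]
  have kills: "frag_sum A ?\<phi> v = \<zero>\<^bsub>A\<^esub>" if "v \<in> T.Q" for v
    using T.relations_in_kernel[where H = "add_monoid A" and h = "frag_sum A ?\<phi>" and u = v] that h
    by (simp add: A.l_distr A.r_distr A.m_assoc B_in_A E_add E_left_linear)
  have "frag_sum A ?\<phi> (sep_tensor r) = frag_sum A ?\<phi> (sep_tensor r')"
    using T.hom_eq_if_class_eq[where L = "add_monoid A" and h = "frag_sum A ?\<phi>"
        and u = "sep_tensor r" and v = "sep_tensor r'"]
      h(1) kills sep_tensor_closed[OF r(2)] eq by (simp add: T.tensor_class_eq_iff)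
  moreover have "frag_sum A ?\<phi> (sep_tensor r) = conj_sum H r" if r: "r \<in> carrier A" for r
  proof -
    have "frag_sum A ?\<phi> (sep_tensor r) = (\<Oplus>\<^bsub>A\<^esub>g\<in>carrier G. \<delta> g \<otimes>\<^bsub>A\<^esub> r \<otimes>\<^bsub>A\<^esub> E (\<delta> (inv\<^bsub>G\<^esub> g)))"
      unfolding sep_tensor_def using r fin
      by (subst frag_sum_sum[OF A.abelian_group_axioms, of ?P]) auto
    also have "\<dots> = conj_sum H r"
      unfolding conj_sum_def
    proof (rule A.add.finprod_mono_neutral_cong_right)
      fix g assume g: "g \<in> carrier G - H"
      then have "inv\<^bsub>G\<^esub> g \<notin> H" using H_inv[of "inv\<^bsub>G\<^esub> g"] by auto
      then show "\<delta> g \<otimes>\<^bsub>A\<^esub> r \<otimes>\<^bsub>A\<^esub> E (\<delta> (inv\<^bsub>G\<^esub> g)) = \<zero>\<^bsub>A\<^esub>"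
        using g r by (simp add: E_single)
    qed (use r fin H.subset in \<open>auto simp: E_single\<close>)
    finally show ?thesis .
  qed
  ultimately show ?thesis using r by simp
qed

text \<open>Two solutions of \<open>tr\<^sub>G r' = 1\<close> are compared, the constant \<open>r\<^sub>1 = 1/|G|\<close> and its perturbation by
  \<open>|G| r - tr\<^sub>G r\<close>, an element of trace zero.  They have the same value of \<open>tr\<^sub>H\<close>, so \<open>tr\<^sub>H r\<close> is a
  scalar multiple of the central element \<open>tr\<^sub>G r\<close>.\<close>

theorem conj_sum_central_if_uniquely_separable:
  assumes uniq: "uniquely_separable A B" and r: "r \<in> carrier A" and a: "a \<in> carrier A"
  shows "a \<otimes>\<^bsub>A\<^esub> conj_sum H r = conj_sum H r \<otimes>\<^bsub>A\<^esub> a"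
proof -
  define n where "n = card (carrier G)"
  define k where "k = [n] \<cdot>\<^bsub>K\<^esub> \<one>\<^bsub>K\<^esub>"
  define m where "m = [card H] \<cdot>\<^bsub>K\<^esub> \<one>\<^bsub>K\<^esub>"
  have n: "n > 0" unfolding n_def using fin by (auto simp: card_gt_0_iff)
  have k: "k \<in> carrier K" "k \<noteq> \<zero>\<^bsub>K\<^esub>" using char_zero[OF n] by (simp_all add: k_def)
  have m: "m \<in> carrier K" by (simp add: m_def)
  note ki = scalar_inverse[OF k]
  let ?G = "carrier G"
  have HG: "H \<subseteq> carrier G" by (rule H.subset)
  define z where "z = conj_sum ?G r"
  have z: "z \<in> carrier A" "\<And>a. a \<in> carrier A \<Longrightarrow> a \<otimes>\<^bsub>A\<^esub> z = z \<otimes>\<^bsub>A\<^esub> a"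
    using conj_sum_central[OF r] r by (simp_all add: z_def)
  define r1 where "r1 = scalar (inv\<^bsub>K\<^esub> k)"
  have r1: "r1 \<in> carrier A" using ki by (simp add: r1_def)
  have tr1: "conj_sum ?G r1 = \<one>\<^bsub>A\<^esub>"
  proof -
    have "conj_sum ?G r1 = scalar k \<otimes>\<^bsub>A\<^esub> r1"
      using conj_sum_commuting[of ?G r1] scalar_central[OF ki(1)] r1
      by (simp add: multiple_eq_scalar n_def k_def r1_def del: single_mult)
    also have "\<dots> = \<one>\<^bsub>A\<^esub>" using ki scalar_central[OF k(1) r1] by (simp add: r1_def del: single_mult)
    finally show ?thesis .
  qed
  define r2 where "r2 = r1 \<oplus>\<^bsub>A\<^esub> scalar k \<otimes>\<^bsub>A\<^esub> r \<ominus>\<^bsub>A\<^esub> z"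
  have kr: "scalar k \<otimes>\<^bsub>A\<^esub> r \<in> carrier A" using k r by simp
  have r2: "r2 \<in> carrier A" using r1 kr z by (simp add: r2_def)
  have r2_z: "r2 \<oplus>\<^bsub>A\<^esub> z = r1 \<oplus>\<^bsub>A\<^esub> scalar k \<otimes>\<^bsub>A\<^esub> r"
    using r1 kr z by (simp add: r2_def A.minus_eq A.a_assoc A.l_neg)
  \<comment> \<open>The defining equation of \<open>r2\<close> without subtraction, after applying the trace over \<open>S\<close>.  For
    \<open>S = G\<close> it shows that \<open>r2\<close> has trace one, for \<open>S = H\<close> it becomes
    \<open>|G| tr\<^sub>H r = |H| tr\<^sub>G r\<close> as soon as \<open>r1\<close> and \<open>r2\<close> are known to have the same trace over \<open>H\<close>.\<close>
  have sums: "conj_sum S r2 \<oplus>\<^bsub>A\<^esub> [card S] \<cdot>\<^bsub>A\<^esub> z = conj_sum S r1 \<oplus>\<^bsub>A\<^esub> scalar k \<otimes>\<^bsub>A\<^esub> conj_sum S r"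
    if S: "S \<subseteq> ?G" for S
  proof -
    have "conj_sum S z = [card S] \<cdot>\<^bsub>A\<^esub> z"
    proof (rule conj_sum_commuting[OF S z(1)])
      fix g assume "g \<in> S"
      then show "\<delta> g \<otimes>\<^bsub>A\<^esub> z = z \<otimes>\<^bsub>A\<^esub> \<delta> g" using S by (intro z(2)) auto
    qed
    then have "conj_sum S (r2 \<oplus>\<^bsub>A\<^esub> z) = conj_sum S r2 \<oplus>\<^bsub>A\<^esub> [card S] \<cdot>\<^bsub>A\<^esub> z"
      using conj_sum_add[OF S r2 z(1)] by simp
    then show ?thesis
      using conj_sum_add[OF S r1 kr] conj_sum_scalar[OF S k(1) r] by (simp add: r2_z)
  qed
  have tr2: "conj_sum ?G r2 = \<one>\<^bsub>A\<^esub>"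
    using sums[OF subset_refl] r2 z(1) tr1 k
    by (simp add: multiple_eq_scalar n_def[symmetric] k_def[symmetric] z_def[symmetric] A.add.right_cancel)
  have "T.tensor_class (sep_tensor r1) = T.tensor_class (sep_tensor r2)"
    using uniq separability_element_sep_tensor[OF r1 tr1] separability_element_sep_tensor[OF r2 tr2]
    unfolding uniquely_separable_def by blast
  then have "conj_sum H r1 = conj_sum H r2"
    by (rule conj_sum_eq_if_class_eq[OF r1 r2])
  then have "scalar k \<otimes>\<^bsub>A\<^esub> conj_sum H r = scalar m \<otimes>\<^bsub>A\<^esub> z"
    using sums[OF HG] r r1 r2 z(1) k(1) m HG
      A.add.right_cancel[of "conj_sum H r2" "scalar m \<otimes>\<^bsub>A\<^esub> z" "scalar k \<otimes>\<^bsub>A\<^esub> conj_sum H r"]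
    by (simp add: multiple_eq_scalar m_def[symmetric] A.a_comm)
  then have eq: "conj_sum H r = scalar (inv\<^bsub>K\<^esub> k) \<otimes>\<^bsub>A\<^esub> (scalar m \<otimes>\<^bsub>A\<^esub> z)"
    using scalar_cancel[OF k, of "conj_sum H r"] r HG by simp
  define s where "s = scalar (inv\<^bsub>K\<^esub> k) \<otimes>\<^bsub>A\<^esub> scalar m"
  have s: "s \<in> carrier A" "a \<otimes>\<^bsub>A\<^esub> s = s \<otimes>\<^bsub>A\<^esub> a"
    using scalar_central[of "inv\<^bsub>K\<^esub> k \<otimes>\<^bsub>K\<^esub> m" a] ki m a by (simp_all add: s_def)
  have "conj_sum H r = s \<otimes>\<^bsub>A\<^esub> z"
    using eq ki m z(1) by (simp add: s_def A.m_assoc del: single_mult)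
  then show ?thesis
    using s z(1) z(2)[OF a] a by (metis A.m_assoc)
qed

end

section \<open>The sum of all commutators\<close>

context group_algebra_extension
begin

abbreviation class_sum where "class_sum g \<equiv> conj_sum H (\<delta> g)"

lemma class_sum_closed: "g \<in> carrier G \<Longrightarrow> class_sum g \<in> carrier A"
  using H.subset by simp

lemma class_sum_eq:
  assumes g: "g \<in> carrier G"
  shows "class_sum g = (\<Oplus>\<^bsub>A\<^esub>y\<in>H. \<delta> (y \<otimes>\<^bsub>G\<^esub> g \<otimes>\<^bsub>G\<^esub> inv\<^bsub>G\<^esub> y))"
  unfolding conj_sum_def using g by (intro A.finsum_cong') auto

lemma class_sum_conj:
  assumes g: "g \<in> carrier G" and t: "t \<in> H"
  shows "class_sum (t \<otimes>\<^bsub>G\<^esub> g \<otimes>\<^bsub>G\<^esub> inv\<^bsub>G\<^esub> t) = class_sum g"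
proof -
  have bij: "bij_betw (\<lambda>y. y \<otimes>\<^bsub>G\<^esub> t) H H"
    by (rule G.subgroup_translation_bij(2)[OF H.subgroup_axioms t])
  have "class_sum g = (\<Oplus>\<^bsub>A\<^esub>y\<in>H. \<delta> (y \<otimes>\<^bsub>G\<^esub> t \<otimes>\<^bsub>G\<^esub> g \<otimes>\<^bsub>G\<^esub> inv\<^bsub>G\<^esub> (y \<otimes>\<^bsub>G\<^esub> t)))"
    unfolding class_sum_eq[OF g] using g by (intro A.finsum_bij[OF bij]) auto
  also have "\<dots> = class_sum (t \<otimes>\<^bsub>G\<^esub> g \<otimes>\<^bsub>G\<^esub> inv\<^bsub>G\<^esub> t)"
    using g t by (subst class_sum_eq) (auto simp: G.m_assoc G.inv_mult_group intro!: A.finsum_cong')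
  finally show ?thesis ..
qed

text \<open>The sum of all commutators \<open>x h x\<inverse> h\<inverse>\<close> with \<open>x, h \<in> H\<close>, grouped so that the inner sums are class
  sums.\<close>

definition commutator_sum :: "'g \<Rightarrow> 'k"
  where "commutator_sum = (\<Oplus>\<^bsub>A\<^esub>h\<in>H. class_sum h \<otimes>\<^bsub>A\<^esub> \<delta> (inv\<^bsub>G\<^esub> h))"

lemma commutator_sum_closed: "commutator_sum \<in> carrier A"
  unfolding commutator_sum_def by (intro A.finsum_closed) (auto simp: class_sum_closed)

lemma commutator_sum_eq:
  "commutator_sum = (\<Oplus>\<^bsub>A\<^esub>h\<in>H. \<Oplus>\<^bsub>A\<^esub>x\<in>H. \<delta> (x \<otimes>\<^bsub>G\<^esub> h \<otimes>\<^bsub>G\<^esub> inv\<^bsub>G\<^esub> x \<otimes>\<^bsub>G\<^esub> inv\<^bsub>G\<^esub> h))"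
  unfolding commutator_sum_def
proof (intro A.finsum_cong' refl)
  fix h assume h: "h \<in> H"
  have "class_sum h \<otimes>\<^bsub>A\<^esub> \<delta> (inv\<^bsub>G\<^esub> h)
      = (\<Oplus>\<^bsub>A\<^esub>x\<in>H. \<delta> (x \<otimes>\<^bsub>G\<^esub> h \<otimes>\<^bsub>G\<^esub> inv\<^bsub>G\<^esub> x) \<otimes>\<^bsub>A\<^esub> \<delta> (inv\<^bsub>G\<^esub> h))"
    using h by (subst class_sum_eq) (auto simp: finite_H intro!: A.finsum_ldistr simp del: single_mult)
  also have "\<dots> = (\<Oplus>\<^bsub>A\<^esub>x\<in>H. \<delta> (x \<otimes>\<^bsub>G\<^esub> h \<otimes>\<^bsub>G\<^esub> inv\<^bsub>G\<^esub> x \<otimes>\<^bsub>G\<^esub> inv\<^bsub>G\<^esub> h))"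
    using h by (intro A.finsum_cong') auto
  finally show "class_sum h \<otimes>\<^bsub>A\<^esub> \<delta> (inv\<^bsub>G\<^esub> h)
    = (\<Oplus>\<^bsub>A\<^esub>x\<in>H. \<delta> (x \<otimes>\<^bsub>G\<^esub> h \<otimes>\<^bsub>G\<^esub> inv\<^bsub>G\<^esub> x \<otimes>\<^bsub>G\<^esub> inv\<^bsub>G\<^esub> h))" .
qed (auto intro!: A.finsum_closed)

text \<open>The image in \<open>kH\<close> of an element of the integral group ring of \<open>H\<close>.\<close>

definition int_element :: "('g \<Rightarrow> int) \<Rightarrow> 'g \<Rightarrow> 'k"
  where "int_element v = (\<lambda>g. if g \<in> H then [v g] \<cdot>\<^bsub>K\<^esub> \<one>\<^bsub>K\<^esub> else \<zero>\<^bsub>K\<^esub>)"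

lemma int_element_in_B: "int_element v \<in> B"
proof -
  have "g \<notin> H" if "g \<notin> carrier G" for g using that H.mem_carrier by blast
  then show ?thesis
    by (simp add: mem_B carrier_A int_element_def K.add.int_pow_closed del: A_closed H_in_G)
qed

text \<open>The double sum in the hypothesis is the coefficient at \<open>a\<close> of the product of the commutator sum
  with \<open>v\<close> in the integral group ring: the inverse of \<open>x h x\<inverse> h\<inverse>\<close> is \<open>h x h\<inverse> x\<inverse>\<close>.\<close>

lemma commutator_sum_times_int_element:
  assumes v: "\<forall>a\<in>H. (\<Sum>h\<in>H. \<Sum>x\<in>H. v (h \<otimes>\<^bsub>G\<^esub> x \<otimes>\<^bsub>G\<^esub> inv\<^bsub>G\<^esub> h \<otimes>\<^bsub>G\<^esub> inv\<^bsub>G\<^esub> x \<otimes>\<^bsub>G\<^esub> a))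
    = (if a = \<one>\<^bsub>G\<^esub> then N else 0)"
  shows "commutator_sum \<otimes>\<^bsub>A\<^esub> int_element v = single K ([N] \<cdot>\<^bsub>K\<^esub> \<one>\<^bsub>K\<^esub>) \<one>\<^bsub>G\<^esub>"
proof
  fix a
  have v_closed [simp]: "int_element v \<in> carrier A" by (rule B_in_A[OF int_element_in_B])
  show "(commutator_sum \<otimes>\<^bsub>A\<^esub> int_element v) a = single K ([N] \<cdot>\<^bsub>K\<^esub> \<one>\<^bsub>K\<^esub>) \<one>\<^bsub>G\<^esub> a"
  proof (cases "a \<in> carrier G")
    case a: True
    have in_H: "h \<otimes>\<^bsub>G\<^esub> x \<otimes>\<^bsub>G\<^esub> inv\<^bsub>G\<^esub> h \<otimes>\<^bsub>G\<^esub> inv\<^bsub>G\<^esub> x \<in> H" if "h \<in> H" "x \<in> H" for h x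
      using that by simp
    have "commutator_sum \<otimes>\<^bsub>A\<^esub> int_element v
        = (\<Oplus>\<^bsub>A\<^esub>h\<in>H. (\<Oplus>\<^bsub>A\<^esub>x\<in>H. \<delta> (x \<otimes>\<^bsub>G\<^esub> h \<otimes>\<^bsub>G\<^esub> inv\<^bsub>G\<^esub> x \<otimes>\<^bsub>G\<^esub> inv\<^bsub>G\<^esub> h)) \<otimes>\<^bsub>A\<^esub> int_element v)"
      unfolding commutator_sum_eq by (intro A.finsum_ldistr finite_H) (auto intro!: A.finsum_closed)
    also have "\<dots> = (\<Oplus>\<^bsub>A\<^esub>h\<in>H. \<Oplus>\<^bsub>A\<^esub>x\<in>H. \<delta> (x \<otimes>\<^bsub>G\<^esub> h \<otimes>\<^bsub>G\<^esub> inv\<^bsub>G\<^esub> x \<otimes>\<^bsub>G\<^esub> inv\<^bsub>G\<^esub> h) \<otimes>\<^bsub>A\<^esub> int_element v)"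
      by (intro A.finsum_cong' refl A.finsum_ldistr finite_H) (auto intro!: A.finsum_closed)
    finally have "(commutator_sum \<otimes>\<^bsub>A\<^esub> int_element v) a
        = (\<Oplus>\<^bsub>K\<^esub>h\<in>H. (\<Oplus>\<^bsub>A\<^esub>x\<in>H. \<delta> (x \<otimes>\<^bsub>G\<^esub> h \<otimes>\<^bsub>G\<^esub> inv\<^bsub>G\<^esub> x \<otimes>\<^bsub>G\<^esub> inv\<^bsub>G\<^esub> h) \<otimes>\<^bsub>A\<^esub> int_element v) a)"
      by (simp only:) (rule finsum_A_apply, auto intro!: A.finsum_closed)
    also have "\<dots> = (\<Oplus>\<^bsub>K\<^esub>h\<in>H. \<Oplus>\<^bsub>K\<^esub>x\<in>H. (\<delta> (x \<otimes>\<^bsub>G\<^esub> h \<otimes>\<^bsub>G\<^esub> inv\<^bsub>G\<^esub> x \<otimes>\<^bsub>G\<^esub> inv\<^bsub>G\<^esub> h) \<otimes>\<^bsub>A\<^esub> int_element v) a)"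
      by (intro K.finsum_cong' refl finsum_A_apply) (auto intro!: K.finsum_closed)
    also have "\<dots> = (\<Oplus>\<^bsub>K\<^esub>h\<in>H. \<Oplus>\<^bsub>K\<^esub>x\<in>H. int_element v (h \<otimes>\<^bsub>G\<^esub> x \<otimes>\<^bsub>G\<^esub> inv\<^bsub>G\<^esub> h \<otimes>\<^bsub>G\<^esub> inv\<^bsub>G\<^esub> x \<otimes>\<^bsub>G\<^esub> a))"
      using a by (intro K.finsum_cong' refl)
        (auto simp: single_mult_left G.inv_mult_group G.m_assoc intro!: K.finsum_closed)
    also have "\<dots> = single K ([N] \<cdot>\<^bsub>K\<^esub> \<one>\<^bsub>K\<^esub>) \<one>\<^bsub>G\<^esub> a"
    proof (cases "a \<in> H")
      case aH: True
      have cl: "[i] \<cdot>\<^bsub>K\<^esub> \<one>\<^bsub>K\<^esub> \<in> carrier K" for i :: int by (simp add: K.add.int_pow_closed)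
      have "(\<Oplus>\<^bsub>K\<^esub>h\<in>H. \<Oplus>\<^bsub>K\<^esub>x\<in>H. int_element v (h \<otimes>\<^bsub>G\<^esub> x \<otimes>\<^bsub>G\<^esub> inv\<^bsub>G\<^esub> h \<otimes>\<^bsub>G\<^esub> inv\<^bsub>G\<^esub> x \<otimes>\<^bsub>G\<^esub> a))
         = (\<Oplus>\<^bsub>K\<^esub>h\<in>H. \<Oplus>\<^bsub>K\<^esub>x\<in>H. [v (h \<otimes>\<^bsub>G\<^esub> x \<otimes>\<^bsub>G\<^esub> inv\<^bsub>G\<^esub> h \<otimes>\<^bsub>G\<^esub> inv\<^bsub>G\<^esub> x \<otimes>\<^bsub>G\<^esub> a)] \<cdot>\<^bsub>K\<^esub> \<one>\<^bsub>K\<^esub>)"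
        using aH by (intro K.finsum_cong' refl) (auto simp: int_element_def cl intro!: K.finsum_closed)
      also have "\<dots> = [(\<Sum>h\<in>H. \<Sum>x\<in>H. v (h \<otimes>\<^bsub>G\<^esub> x \<otimes>\<^bsub>G\<^esub> inv\<^bsub>G\<^esub> h \<otimes>\<^bsub>G\<^esub> inv\<^bsub>G\<^esub> x \<otimes>\<^bsub>G\<^esub> a))] \<cdot>\<^bsub>K\<^esub> \<one>\<^bsub>K\<^esub>"
        by (simp add: K.finsum_int_multiple finite_H)
      also have "\<dots> = single K ([N] \<cdot>\<^bsub>K\<^esub> \<one>\<^bsub>K\<^esub>) \<one>\<^bsub>G\<^esub> a"
        using v aH by (simp add: single_def add_pow_def)
      finally show ?thesis .
    next
      case aH: False
      then have "(\<Oplus>\<^bsub>K\<^esub>h\<in>H. \<Oplus>\<^bsub>K\<^esub>x\<in>H. int_element v (h \<otimes>\<^bsub>G\<^esub> x \<otimes>\<^bsub>G\<^esub> inv\<^bsub>G\<^esub> h \<otimes>\<^bsub>G\<^esub> inv\<^bsub>G\<^esub> x \<otimes>\<^bsub>G\<^esub> a)) = \<zero>\<^bsub>K\<^esub>"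
        using a H_mult_iff(1)[OF in_H a] by (intro K.add.finprod_one_eqI) (simp add: int_element_def)
      with aH show ?thesis using H.one_closed by (auto simp: single_def)
    qed
    finally show ?thesis .
  qed simp
qed

lemma commutator_sum_commutes:
  assumes b: "b \<in> B" and central: "\<And>h. h \<in> H \<Longrightarrow> b \<otimes>\<^bsub>A\<^esub> class_sum h = class_sum h \<otimes>\<^bsub>A\<^esub> b"
  shows "b \<otimes>\<^bsub>A\<^esub> commutator_sum = commutator_sum \<otimes>\<^bsub>A\<^esub> b"
proof (rule commutes_if_basis[OF commutator_sum_closed B_in_A[OF b]])
  fix t assume "t \<in> carrier G" "b t \<noteq> \<zero>\<^bsub>K\<^esub>"
  then have t: "t \<in> H" using B_support[OF b] by blast
  have bij: "bij_betw (\<lambda>h. t \<otimes>\<^bsub>G\<^esub> h \<otimes>\<^bsub>G\<^esub> inv\<^bsub>G\<^esub> t) H H"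
    by (rule G.subgroup_translation_bij(3)[OF H.subgroup_axioms t])
  have "\<delta> t \<otimes>\<^bsub>A\<^esub> commutator_sum = (\<Oplus>\<^bsub>A\<^esub>h\<in>H. \<delta> t \<otimes>\<^bsub>A\<^esub> (class_sum h \<otimes>\<^bsub>A\<^esub> \<delta> (inv\<^bsub>G\<^esub> h)))"
    unfolding commutator_sum_def using t by (intro A.finsum_rdistr finite_H) (auto simp: class_sum_closed)
  also have "\<dots> = (\<Oplus>\<^bsub>A\<^esub>h\<in>H. (class_sum (t \<otimes>\<^bsub>G\<^esub> h \<otimes>\<^bsub>G\<^esub> inv\<^bsub>G\<^esub> t)
      \<otimes>\<^bsub>A\<^esub> \<delta> (inv\<^bsub>G\<^esub> (t \<otimes>\<^bsub>G\<^esub> h \<otimes>\<^bsub>G\<^esub> inv\<^bsub>G\<^esub> t))) \<otimes>\<^bsub>A\<^esub> \<delta> t)"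
  proof (intro A.finsum_cong' refl)
    fix h assume h: "h \<in> H"
    have "\<delta> (inv\<^bsub>G\<^esub> (t \<otimes>\<^bsub>G\<^esub> h \<otimes>\<^bsub>G\<^esub> inv\<^bsub>G\<^esub> t)) \<otimes>\<^bsub>A\<^esub> \<delta> t = \<delta> t \<otimes>\<^bsub>A\<^esub> \<delta> (inv\<^bsub>G\<^esub> h)"
      using h t by (simp add: G.inv_mult_group G.m_assoc)
    then show "\<delta> t \<otimes>\<^bsub>A\<^esub> (class_sum h \<otimes>\<^bsub>A\<^esub> \<delta> (inv\<^bsub>G\<^esub> h)) = (class_sum (t \<otimes>\<^bsub>G\<^esub> h \<otimes>\<^bsub>G\<^esub> inv\<^bsub>G\<^esub> t)
      \<otimes>\<^bsub>A\<^esub> \<delta> (inv\<^bsub>G\<^esub> (t \<otimes>\<^bsub>G\<^esub> h \<otimes>\<^bsub>G\<^esub> inv\<^bsub>G\<^esub> t))) \<otimes>\<^bsub>A\<^esub> \<delta> t"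
      using h t conj_sum_commutes_basis[OF H.subgroup_axioms t, of "\<delta> h"] class_sum_closed[of h]
      by (simp add: class_sum_conj A.m_assoc del: single_mult) (simp add: A.m_assoc[symmetric] del: single_mult)
  qed (use t in \<open>auto simp: class_sum_closed\<close>)
  also have "\<dots> = (\<Oplus>\<^bsub>A\<^esub>h\<in>H. (class_sum h \<otimes>\<^bsub>A\<^esub> \<delta> (inv\<^bsub>G\<^esub> h)) \<otimes>\<^bsub>A\<^esub> \<delta> t)"
    using t by (intro A.finsum_bij[OF bij, symmetric]) (auto simp: class_sum_closed)
  also have "\<dots> = commutator_sum \<otimes>\<^bsub>A\<^esub> \<delta> t"
    unfolding commutator_sum_def using t by (intro A.finsum_ldistr[symmetric] finite_H) (auto simp: class_sum_closed)
  finally show "\<delta> t \<otimes>\<^bsub>A\<^esub> commutator_sum = commutator_sum \<otimes>\<^bsub>A\<^esub> \<delta> t" .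
qed

text \<open>For \<open>a = s \<in> G\<close> only the summands with \<open>x = s g\<inverse> \<in> H\<close> survive.  Then \<open>g = x\<inverse> s\<close>, and the sum becomes
  \<open>\<Sum> x h x\<inverse> s h\<inverse>\<close> over \<open>x, h \<in> H\<close>.  For fixed \<open>h\<close> the elements \<open>x h x\<inverse>\<close> add up to the class sum of \<open>h\<close>,
  which can be moved to the right of \<open>s\<close> because it is central.\<close>

lemma projection_expansion:
  assumes a: "a \<in> carrier A"
    and central: "\<And>h a. h \<in> H \<Longrightarrow> a \<in> carrier A \<Longrightarrow> a \<otimes>\<^bsub>A\<^esub> class_sum h = class_sum h \<otimes>\<^bsub>A\<^esub> a"
  shows "(\<Oplus>\<^bsub>A\<^esub>g\<in>carrier G. E (a \<otimes>\<^bsub>A\<^esub> \<delta> (inv\<^bsub>G\<^esub> g)) \<otimes>\<^bsub>A\<^esub> class_sum g) = a \<otimes>\<^bsub>A\<^esub> commutator_sum"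
  using a
proof (induction a rule: group_algebra_induct)
  case zero
  have "(\<Oplus>\<^bsub>A\<^esub>g\<in>carrier G. E (\<zero>\<^bsub>A\<^esub> \<otimes>\<^bsub>A\<^esub> \<delta> (inv\<^bsub>G\<^esub> g)) \<otimes>\<^bsub>A\<^esub> class_sum g) = \<zero>\<^bsub>A\<^esub>"
    by (rule A.add.finprod_one_eqI) (simp add: class_sum_closed)
  then show ?case by (simp add: commutator_sum_closed)
next
  case (add b c)
  have "(\<Oplus>\<^bsub>A\<^esub>g\<in>carrier G. E ((b \<oplus>\<^bsub>A\<^esub> c) \<otimes>\<^bsub>A\<^esub> \<delta> (inv\<^bsub>G\<^esub> g)) \<otimes>\<^bsub>A\<^esub> class_sum g)
    = (\<Oplus>\<^bsub>A\<^esub>g\<in>carrier G. E (b \<otimes>\<^bsub>A\<^esub> \<delta> (inv\<^bsub>G\<^esub> g)) \<otimes>\<^bsub>A\<^esub> class_sum g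
        \<oplus>\<^bsub>A\<^esub> E (c \<otimes>\<^bsub>A\<^esub> \<delta> (inv\<^bsub>G\<^esub> g)) \<otimes>\<^bsub>A\<^esub> class_sum g)"
    using add(1,2) by (intro A.finsum_cong') (auto simp: A.l_distr E_add class_sum_closed)
  also have "\<dots> = b \<otimes>\<^bsub>A\<^esub> commutator_sum \<oplus>\<^bsub>A\<^esub> c \<otimes>\<^bsub>A\<^esub> commutator_sum"
    using add by (subst A.finsum_addf) (auto simp: class_sum_closed)
  finally show ?case using add(1,2) by (simp add: A.l_distr commutator_sum_closed)
next
  case (single k s)
  have ks: "k \<in> carrier K" "s \<in> carrier G" by fact+
  have bij: "bij_betw (\<lambda>x. inv\<^bsub>G\<^esub> x \<otimes>\<^bsub>G\<^esub> s) (carrier G) (carrier G)"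
    using ks by (intro bij_betwI[of _ _ _ "\<lambda>g. s \<otimes>\<^bsub>G\<^esub> inv\<^bsub>G\<^esub> g"])
      (auto simp: G.inv_mult_group G.m_assoc[symmetric], auto simp: G.m_assoc)
  have "(\<Oplus>\<^bsub>A\<^esub>g\<in>carrier G. E (single K k s \<otimes>\<^bsub>A\<^esub> \<delta> (inv\<^bsub>G\<^esub> g)) \<otimes>\<^bsub>A\<^esub> class_sum g)
      = (\<Oplus>\<^bsub>A\<^esub>x\<in>carrier G. E (single K k s \<otimes>\<^bsub>A\<^esub> \<delta> (inv\<^bsub>G\<^esub> (inv\<^bsub>G\<^esub> x \<otimes>\<^bsub>G\<^esub> s))) \<otimes>\<^bsub>A\<^esub> class_sum (inv\<^bsub>G\<^esub> x \<otimes>\<^bsub>G\<^esub> s))"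
    using ks by (intro A.finsum_bij[OF bij]) (auto simp: class_sum_closed)
  also have "\<dots> = (\<Oplus>\<^bsub>A\<^esub>x\<in>carrier G. E (single K k x) \<otimes>\<^bsub>A\<^esub> class_sum (inv\<^bsub>G\<^esub> x \<otimes>\<^bsub>G\<^esub> s))"
  proof (intro A.finsum_cong' refl)
    fix x assume x: "x \<in> carrier G"
    have "s \<otimes>\<^bsub>G\<^esub> inv\<^bsub>G\<^esub> (inv\<^bsub>G\<^esub> x \<otimes>\<^bsub>G\<^esub> s) = x"
      using x ks by (simp add: G.inv_mult_group) (simp add: G.m_assoc[symmetric])
    then show "E (single K k s \<otimes>\<^bsub>A\<^esub> \<delta> (inv\<^bsub>G\<^esub> (inv\<^bsub>G\<^esub> x \<otimes>\<^bsub>G\<^esub> s))) \<otimes>\<^bsub>A\<^esub> class_sum (inv\<^bsub>G\<^esub> x \<otimes>\<^bsub>G\<^esub> s)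
        = E (single K k x) \<otimes>\<^bsub>A\<^esub> class_sum (inv\<^bsub>G\<^esub> x \<otimes>\<^bsub>G\<^esub> s)"
      using x ks by simp
  qed (use ks in \<open>auto simp: class_sum_closed\<close>)
  also have "\<dots> = (\<Oplus>\<^bsub>A\<^esub>x\<in>H. single K k x \<otimes>\<^bsub>A\<^esub> class_sum (inv\<^bsub>G\<^esub> x \<otimes>\<^bsub>G\<^esub> s))"
    using ks fin H.subset
    by (intro A.add.finprod_mono_neutral_cong_right) (auto simp: E_single class_sum_closed)
  also have "\<dots> = (\<Oplus>\<^bsub>A\<^esub>x\<in>H. \<Oplus>\<^bsub>A\<^esub>h\<in>H. \<delta> (x \<otimes>\<^bsub>G\<^esub> h \<otimes>\<^bsub>G\<^esub> inv\<^bsub>G\<^esub> x) \<otimes>\<^bsub>A\<^esub> single K k (s \<otimes>\<^bsub>G\<^esub> inv\<^bsub>G\<^esub> h))"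
  proof (intro A.finsum_cong' refl)
    fix x assume x: "x \<in> H"
    have "single K k x \<otimes>\<^bsub>A\<^esub> class_sum (inv\<^bsub>G\<^esub> x \<otimes>\<^bsub>G\<^esub> s)
        = (\<Oplus>\<^bsub>A\<^esub>h\<in>H. single K k x \<otimes>\<^bsub>A\<^esub> \<delta> (h \<otimes>\<^bsub>G\<^esub> (inv\<^bsub>G\<^esub> x \<otimes>\<^bsub>G\<^esub> s) \<otimes>\<^bsub>G\<^esub> inv\<^bsub>G\<^esub> h))"
      using x ks by (subst class_sum_eq) (auto intro!: A.finsum_rdistr finite_H simp del: single_mult)
    also have "\<dots> = (\<Oplus>\<^bsub>A\<^esub>h\<in>H. \<delta> (x \<otimes>\<^bsub>G\<^esub> h \<otimes>\<^bsub>G\<^esub> inv\<^bsub>G\<^esub> x) \<otimes>\<^bsub>A\<^esub> single K k (s \<otimes>\<^bsub>G\<^esub> inv\<^bsub>G\<^esub> h))"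
      using x ks by (intro A.finsum_cong' refl) (auto simp: G.m_assoc)
    finally show "single K k x \<otimes>\<^bsub>A\<^esub> class_sum (inv\<^bsub>G\<^esub> x \<otimes>\<^bsub>G\<^esub> s)
        = (\<Oplus>\<^bsub>A\<^esub>h\<in>H. \<delta> (x \<otimes>\<^bsub>G\<^esub> h \<otimes>\<^bsub>G\<^esub> inv\<^bsub>G\<^esub> x) \<otimes>\<^bsub>A\<^esub> single K k (s \<otimes>\<^bsub>G\<^esub> inv\<^bsub>G\<^esub> h))" .
  qed (use ks in \<open>auto intro!: A.finsum_closed\<close>)
  also have "\<dots> = (\<Oplus>\<^bsub>A\<^esub>h\<in>H. \<Oplus>\<^bsub>A\<^esub>x\<in>H. \<delta> (x \<otimes>\<^bsub>G\<^esub> h \<otimes>\<^bsub>G\<^esub> inv\<^bsub>G\<^esub> x) \<otimes>\<^bsub>A\<^esub> single K k (s \<otimes>\<^bsub>G\<^esub> inv\<^bsub>G\<^esub> h))"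
    using ks by (intro A.finsum_swap finite_H) auto
  also have "\<dots> = (\<Oplus>\<^bsub>A\<^esub>h\<in>H. single K k s \<otimes>\<^bsub>A\<^esub> (class_sum h \<otimes>\<^bsub>A\<^esub> \<delta> (inv\<^bsub>G\<^esub> h)))"
  proof (intro A.finsum_cong' refl)
    fix h assume h: "h \<in> H"
    have "(\<Oplus>\<^bsub>A\<^esub>x\<in>H. \<delta> (x \<otimes>\<^bsub>G\<^esub> h \<otimes>\<^bsub>G\<^esub> inv\<^bsub>G\<^esub> x) \<otimes>\<^bsub>A\<^esub> single K k (s \<otimes>\<^bsub>G\<^esub> inv\<^bsub>G\<^esub> h))
        = class_sum h \<otimes>\<^bsub>A\<^esub> single K k (s \<otimes>\<^bsub>G\<^esub> inv\<^bsub>G\<^esub> h)"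
      using h ks by (subst class_sum_eq) (auto intro!: A.finsum_ldistr[symmetric] finite_H simp del: single_mult)
    also have "\<dots> = class_sum h \<otimes>\<^bsub>A\<^esub> (single K k s \<otimes>\<^bsub>A\<^esub> \<delta> (inv\<^bsub>G\<^esub> h))"
      using h ks by simp
    also have "\<dots> = single K k s \<otimes>\<^bsub>A\<^esub> (class_sum h \<otimes>\<^bsub>A\<^esub> \<delta> (inv\<^bsub>G\<^esub> h))"
      using h ks central[OF h, of "single K k s"] class_sum_closed[of h]
      by (simp add: A.m_assoc[symmetric] del: single_mult)
    finally show "(\<Oplus>\<^bsub>A\<^esub>x\<in>H. \<delta> (x \<otimes>\<^bsub>G\<^esub> h \<otimes>\<^bsub>G\<^esub> inv\<^bsub>G\<^esub> x) \<otimes>\<^bsub>A\<^esub> single K k (s \<otimes>\<^bsub>G\<^esub> inv\<^bsub>G\<^esub> h))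
      = single K k s \<otimes>\<^bsub>A\<^esub> (class_sum h \<otimes>\<^bsub>A\<^esub> \<delta> (inv\<^bsub>G\<^esub> h))" .
  qed (use ks in \<open>auto simp: class_sum_closed\<close>)
  also have "\<dots> = single K k s \<otimes>\<^bsub>A\<^esub> commutator_sum"
    unfolding commutator_sum_def using ks
    by (intro A.finsum_rdistr[symmetric] finite_H) (auto simp: class_sum_closed)
  finally show ?case .
qed

text \<open>The map \<open>a \<mapsto> E (a g\<inverse>)\<close> of the previous lemma is linear over \<open>kH\<close> only on the left.  The class sum
  of \<open>g\<close> does not change if \<open>g\<close> is replaced by an \<open>H\<close>-conjugate, so \<open>g\<inverse>\<close> may be averaged over its
  \<open>H\<close>-conjugates; this gives two-sided linearity at the price of the factor \<open>|H|\<close>.\<close>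

lemma averaged_projection_expansion:
  assumes a: "a \<in> carrier A"
    and central: "\<And>h a. h \<in> H \<Longrightarrow> a \<in> carrier A \<Longrightarrow> a \<otimes>\<^bsub>A\<^esub> class_sum h = class_sum h \<otimes>\<^bsub>A\<^esub> a"
  shows "(\<Oplus>\<^bsub>A\<^esub>g\<in>carrier G. E (a \<otimes>\<^bsub>A\<^esub> class_sum (inv\<^bsub>G\<^esub> g)) \<otimes>\<^bsub>A\<^esub> class_sum g)
    = [card H] \<cdot>\<^bsub>A\<^esub> (a \<otimes>\<^bsub>A\<^esub> commutator_sum)"
proof -
  let ?f = "\<lambda>y g. E (a \<otimes>\<^bsub>A\<^esub> \<delta> (y \<otimes>\<^bsub>G\<^esub> inv\<^bsub>G\<^esub> g \<otimes>\<^bsub>G\<^esub> inv\<^bsub>G\<^esub> y)) \<otimes>\<^bsub>A\<^esub> class_sum g"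
  have f: "?f y g \<in> carrier A" if "y \<in> H" "g \<in> carrier G" for y g
    using that a by (simp add: class_sum_closed)
  have "(\<Oplus>\<^bsub>A\<^esub>g\<in>carrier G. E (a \<otimes>\<^bsub>A\<^esub> class_sum (inv\<^bsub>G\<^esub> g)) \<otimes>\<^bsub>A\<^esub> class_sum g)
      = (\<Oplus>\<^bsub>A\<^esub>g\<in>carrier G. \<Oplus>\<^bsub>A\<^esub>y\<in>H. ?f y g)"
  proof (intro A.finsum_cong' refl)
    fix g assume g: "g \<in> carrier G"
    let ?d = "\<lambda>y. \<delta> (y \<otimes>\<^bsub>G\<^esub> inv\<^bsub>G\<^esub> g \<otimes>\<^bsub>G\<^esub> inv\<^bsub>G\<^esub> y)"
    have "a \<otimes>\<^bsub>A\<^esub> class_sum (inv\<^bsub>G\<^esub> g) = (\<Oplus>\<^bsub>A\<^esub>y\<in>H. a \<otimes>\<^bsub>A\<^esub> ?d y)"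
      using g a by (subst class_sum_eq) (auto intro!: A.finsum_rdistr finite_H)
    moreover have "E (\<Oplus>\<^bsub>A\<^esub>y\<in>H. a \<otimes>\<^bsub>A\<^esub> ?d y) = (\<Oplus>\<^bsub>A\<^esub>y\<in>H. E (a \<otimes>\<^bsub>A\<^esub> ?d y))"
      using g a by (intro hom_finsum[OF A.abelian_monoid_axioms A.abelian_monoid_axioms])
        (auto simp: E_add)
    moreover have "(\<Oplus>\<^bsub>A\<^esub>y\<in>H. E (a \<otimes>\<^bsub>A\<^esub> ?d y)) \<otimes>\<^bsub>A\<^esub> class_sum g = (\<Oplus>\<^bsub>A\<^esub>y\<in>H. ?f y g)"
      using g a by (intro A.finsum_ldistr finite_H) (auto simp: class_sum_closed)
    ultimately show "E (a \<otimes>\<^bsub>A\<^esub> class_sum (inv\<^bsub>G\<^esub> g)) \<otimes>\<^bsub>A\<^esub> class_sum g = (\<Oplus>\<^bsub>A\<^esub>y\<in>H. ?f y g)"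
      by (simp only:)
  qed (use f in \<open>auto intro!: A.finsum_closed\<close>)
  also have "\<dots> = (\<Oplus>\<^bsub>A\<^esub>y\<in>H. \<Oplus>\<^bsub>A\<^esub>g\<in>carrier G. ?f y g)"
    by (intro A.finsum_swap finite_H fin f)
  also have "\<dots> = (\<Oplus>\<^bsub>A\<^esub>y\<in>H. a \<otimes>\<^bsub>A\<^esub> commutator_sum)"
  proof (intro A.finsum_cong' refl)
    fix y assume y: "y \<in> H"
    have bij: "bij_betw (\<lambda>g. inv\<^bsub>G\<^esub> y \<otimes>\<^bsub>G\<^esub> g \<otimes>\<^bsub>G\<^esub> inv\<^bsub>G\<^esub> (inv\<^bsub>G\<^esub> y)) (carrier G) (carrier G)"
      using y by (intro G.subgroup_translation_bij(3)[OF G.subgroup_self]) simp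
    have "(\<Oplus>\<^bsub>A\<^esub>g\<in>carrier G. ?f y g)
        = (\<Oplus>\<^bsub>A\<^esub>g\<in>carrier G. ?f y (inv\<^bsub>G\<^esub> y \<otimes>\<^bsub>G\<^esub> g \<otimes>\<^bsub>G\<^esub> inv\<^bsub>G\<^esub> (inv\<^bsub>G\<^esub> y)))"
      by (intro A.finsum_bij[OF bij] f y)
    also have "\<dots> = (\<Oplus>\<^bsub>A\<^esub>g\<in>carrier G. E (a \<otimes>\<^bsub>A\<^esub> \<delta> (inv\<^bsub>G\<^esub> g)) \<otimes>\<^bsub>A\<^esub> class_sum g)"
    proof (intro A.finsum_cong' refl)
      fix g assume g: "g \<in> carrier G"
      have "y \<otimes>\<^bsub>G\<^esub> inv\<^bsub>G\<^esub> (inv\<^bsub>G\<^esub> y \<otimes>\<^bsub>G\<^esub> g \<otimes>\<^bsub>G\<^esub> inv\<^bsub>G\<^esub> (inv\<^bsub>G\<^esub> y)) \<otimes>\<^bsub>G\<^esub> inv\<^bsub>G\<^esub> y = inv\<^bsub>G\<^esub> g"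
        using y g by (simp add: G.inv_mult_group G.m_assoc) (simp add: G.m_assoc[symmetric])
      then show "?f y (inv\<^bsub>G\<^esub> y \<otimes>\<^bsub>G\<^esub> g \<otimes>\<^bsub>G\<^esub> inv\<^bsub>G\<^esub> (inv\<^bsub>G\<^esub> y)) = E (a \<otimes>\<^bsub>A\<^esub> \<delta> (inv\<^bsub>G\<^esub> g)) \<otimes>\<^bsub>A\<^esub> class_sum g"
        using class_sum_conj[OF g H_inv[OF y]] by simp
    qed (use a in \<open>auto simp: class_sum_closed\<close>)
    also have "\<dots> = a \<otimes>\<^bsub>A\<^esub> commutator_sum"
      using a central by (rule projection_expansion)
    finally show "(\<Oplus>\<^bsub>A\<^esub>g\<in>carrier G. ?f y g) = a \<otimes>\<^bsub>A\<^esub> commutator_sum" .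
  qed (use a in \<open>auto simp: commutator_sum_closed\<close>)
  also have "\<dots> = [card H] \<cdot>\<^bsub>A\<^esub> (a \<otimes>\<^bsub>A\<^esub> commutator_sum)"
    using a by (intro A.add.finprod_const) (simp add: commutator_sum_closed)
  finally show ?thesis .
qed

end

section \<open>Invertibility of the sum of all commutators\<close>

text \<open>Cramer's rule: an injective integer matrix has nonzero determinant \<open>N\<close>, and the columns of its
  adjugate solve the system with right-hand side \<open>N\<close> times a unit vector.\<close>

lemma integer_system_solvable:
  fixes M :: "'a \<Rightarrow> 'a \<Rightarrow> int"
  assumes S: "finite S" "s \<in> S"
    and inj: "\<And>z. (\<And>a. a \<in> S \<Longrightarrow> (\<Sum>b\<in>S. M a b * z b) = 0) \<Longrightarrow> \<forall>a\<in>S. z a = 0"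
  shows "\<exists>v N. N \<noteq> 0 \<and> (\<forall>a\<in>S. (\<Sum>b\<in>S. M a b * v b) = (if a = s then N else 0))"
proof -
  define n where "n = card S"
  obtain e where e: "bij_betw e {0..<n} S"
    using ex_bij_betw_nat_finite[OF S(1)] by (auto simp: n_def)
  define e' where "e' = the_inv_into {0..<n} e"
  have e'e: "e' (e i) = i" if "i < n" for i
    using e that by (auto simp: e'_def bij_betw_def intro!: the_inv_into_f_f)
  have ee': "e (e' a) = a" "e' a < n" if "a \<in> S" for a
    using e that f_the_inv_into_f[of e "{0..<n}" a] the_inv_into_into[of e "{0..<n}" a "{0..<n}"]
    by (auto simp: e'_def bij_betw_def)
  have eS: "e i \<in> S" if "i < n" for i
    using e that by (auto simp: bij_betw_def)
  define P where "P = mat n n (\<lambda>(i, j). M (e i) (e j))"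
  have P: "P \<in> carrier_mat n n" by (simp add: P_def)
  have sum_e: "(\<Sum>b\<in>S. f b) = (\<Sum>j\<in>{0..<n}. f (e j))" for f :: "'a \<Rightarrow> int"
    using sum.reindex_bij_betw[OF e, of f] by simp
  have "det P \<noteq> 0"
  proof
    assume "det P = 0"
    then obtain v where v: "v \<in> carrier_vec n" "v \<noteq> 0\<^sub>v n" "P *\<^sub>v v = 0\<^sub>v n"
      using det_0_iff_vec_prod_zero[OF P] by blast
    have "(\<Sum>b\<in>S. M a b * v $ e' b) = 0" if a: "a \<in> S" for a
    proof -
      have "(\<Sum>b\<in>S. M a b * v $ e' b) = (\<Sum>j\<in>{0..<n}. M a (e j) * v $ j)"
        unfolding sum_e by (intro sum.cong) (auto simp: e'e)
      also have "\<dots> = (P *\<^sub>v v) $ e' a"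
        using v(1) ee'[OF a] by (simp add: P_def scalar_prod_def)
      finally show ?thesis using v(3) ee'[OF a] by simp
    qed
    then have "\<forall>a\<in>S. v $ e' a = 0" by (rule inj)
    then have "v $ i = 0" if "i < n" for i
      using that eS e'e by metis
    then have "v = 0\<^sub>v n" using v(1) by (intro eq_vecI) auto
    with v(2) show False by simp
  qed
  moreover have "(\<Sum>b\<in>S. M a b * adj_mat P $$ (e' b, e' s)) = (if a = s then det P else 0)"
    if a: "a \<in> S" for a
  proof -
    have eq: "e' a = e' s \<longleftrightarrow> a = s" using ee'(1) a S(2) by metis
    have adj: "adj_mat P \<in> carrier_mat n n" "P * adj_mat P = det P \<cdot>\<^sub>m 1\<^sub>m n"
      using adj_mat[OF P] by auto
    have "(\<Sum>b\<in>S. M a b * adj_mat P $$ (e' b, e' s))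
        = (\<Sum>j\<in>{0..<n}. M a (e j) * adj_mat P $$ (j, e' s))"
      unfolding sum_e by (intro sum.cong) (auto simp: e'e)
    also have "\<dots> = (P * adj_mat P) $$ (e' a, e' s)"
      using adj(1) ee'[OF a] ee'[OF S(2)] by (simp add: P_def scalar_prod_def)
    also have "\<dots> = (if a = s then det P else 0)"
      unfolding adj(2) using ee'[OF a] ee'[OF S(2)] eq by simp
    finally show ?thesis .
  qed
  ultimately show ?thesis
    by (intro exI[of _ "\<lambda>b. adj_mat P $$ (e' b, e' s)"] exI[of _ "det P"]) simp
qed

text \<open>In the integral group ring, \<open>|H|\<close> times the commutator sum is the sum over \<open>h\<close> of
  \<open>C\<^sub>h C\<^sub>h\<^sup>*\<close>, where \<open>C\<^sub>h = \<Sum>\<^sub>x x h x\<inverse>\<close> and \<open>\<^sup>*\<close> is the linear extension of inversion.  Hence its quadratic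
  form is the sum of the squared lengths of the vectors \<open>C\<^sub>h\<^sup>* z\<close>, whose coefficients are the inner
  sums on the left.  The proof expands the squares and substitutes \<open>y = u x\<close>, \<open>k = x h x\<inverse>\<close> and
  \<open>a = k c\<close>.\<close>

lemma (in group) commutator_form:
  fixes z :: "'a \<Rightarrow> int"
  assumes H: "subgroup H G"
  shows "(\<Sum>h\<in>H. \<Sum>c\<in>H. (\<Sum>x\<in>H. z (x \<otimes> h \<otimes> inv x \<otimes> c))\<^sup>2)
    = int (card H) * (\<Sum>a\<in>H. z a * (\<Sum>h\<in>H. \<Sum>x\<in>H. z (h \<otimes> x \<otimes> inv h \<otimes> inv x \<otimes> a)))"
proof -
  have [simp]: "a \<in> carrier G" if "a \<in> H" for a using H that by (rule subgroup.mem_carrier)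
  have [simp]: "inv a \<in> H" if "a \<in> H" for a using H that by (rule subgroup.m_inv_closed)
  have [simp]: "a \<otimes> b \<in> H" if "a \<in> H" "b \<in> H" for a b
    using H that by (rule subgroup.m_closed)
  have inner: "(\<Sum>h\<in>H. \<Sum>c\<in>H. z (x \<otimes> h \<otimes> inv x \<otimes> c) * (\<Sum>y\<in>H. z (y \<otimes> h \<otimes> inv y \<otimes> c)))
      = (\<Sum>a\<in>H. z a * (\<Sum>k\<in>H. \<Sum>u\<in>H. z (u \<otimes> k \<otimes> inv u \<otimes> inv k \<otimes> a)))" (is "?l = ?r")
    if x: "x \<in> H" for x
  proof -
    have "?l = (\<Sum>h\<in>H. \<Sum>c\<in>H. z (x \<otimes> h \<otimes> inv x \<otimes> c) * (\<Sum>u\<in>H. z (u \<otimes> x \<otimes> h \<otimes> inv (u \<otimes> x) \<otimes> c)))"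
      by (intro sum.cong refl arg_cong2[where f = "(*)"]
          sum.reindex_bij_betw[OF subgroup_translation_bij(2)[OF H x], symmetric])
    also have "\<dots> = (\<Sum>h\<in>H. \<Sum>c\<in>H. z ((x \<otimes> h \<otimes> inv x) \<otimes> c) *
        (\<Sum>u\<in>H. z (u \<otimes> (x \<otimes> h \<otimes> inv x) \<otimes> inv u \<otimes> c)))"
      using x by (intro sum.cong refl arg_cong2[where f = "(*)"] arg_cong[where f = z])
        (simp_all add: m_assoc inv_mult_group)
    also have "\<dots> = (\<Sum>k\<in>H. \<Sum>c\<in>H. z (k \<otimes> c) * (\<Sum>u\<in>H. z (u \<otimes> k \<otimes> inv u \<otimes> c)))"
      by (rule sum.reindex_bij_betw[OF subgroup_translation_bij(3)[OF H x]])
    also have "\<dots> = (\<Sum>k\<in>H. \<Sum>a\<in>H. z a * (\<Sum>u\<in>H. z (u \<otimes> k \<otimes> inv u \<otimes> inv k \<otimes> a)))"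
    proof (rule sum.cong[OF refl])
      fix k assume k: "k \<in> H"
      have "(\<Sum>a\<in>H. z a * (\<Sum>u\<in>H. z (u \<otimes> k \<otimes> inv u \<otimes> inv k \<otimes> a)))
         = (\<Sum>c\<in>H. z (k \<otimes> c) * (\<Sum>u\<in>H. z (u \<otimes> k \<otimes> inv u \<otimes> inv k \<otimes> (k \<otimes> c))))"
        by (rule sum.reindex_bij_betw[OF subgroup_translation_bij(1)[OF H k], symmetric])
      also have "\<dots> = (\<Sum>c\<in>H. z (k \<otimes> c) * (\<Sum>u\<in>H. z (u \<otimes> k \<otimes> inv u \<otimes> c)))"
        using k by (intro sum.cong refl arg_cong2[where f = "(*)"] arg_cong[where f = z])
          (simp add: m_assoc inv_mult_cancel)
      finally show "(\<Sum>c\<in>H. z (k \<otimes> c) * (\<Sum>u\<in>H. z (u \<otimes> k \<otimes> inv u \<otimes> c)))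
         = (\<Sum>a\<in>H. z a * (\<Sum>u\<in>H. z (u \<otimes> k \<otimes> inv u \<otimes> inv k \<otimes> a)))" ..
    qed
    also have "\<dots> = ?r"
      by (subst sum.swap) (simp add: sum_distrib_left)
    finally show ?thesis .
  qed
  have "(\<Sum>h\<in>H. \<Sum>c\<in>H. (\<Sum>x\<in>H. z (x \<otimes> h \<otimes> inv x \<otimes> c))\<^sup>2)
      = (\<Sum>h\<in>H. \<Sum>c\<in>H. \<Sum>x\<in>H. z (x \<otimes> h \<otimes> inv x \<otimes> c) * (\<Sum>y\<in>H. z (y \<otimes> h \<otimes> inv y \<otimes> c)))"
    by (simp add: power2_eq_square sum_distrib_right)
  also have "\<dots> = (\<Sum>h\<in>H. \<Sum>x\<in>H. \<Sum>c\<in>H. z (x \<otimes> h \<otimes> inv x \<otimes> c) * (\<Sum>y\<in>H. z (y \<otimes> h \<otimes> inv y \<otimes> c)))"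
    by (intro sum.cong refl sum.swap)
  also have "\<dots> = (\<Sum>x\<in>H. \<Sum>h\<in>H. \<Sum>c\<in>H. z (x \<otimes> h \<otimes> inv x \<otimes> c) * (\<Sum>y\<in>H. z (y \<otimes> h \<otimes> inv y \<otimes> c)))"
    by (rule sum.swap)
  also have "\<dots> = int (card H) * (\<Sum>a\<in>H. z a * (\<Sum>k\<in>H. \<Sum>u\<in>H. z (u \<otimes> k \<otimes> inv u \<otimes> inv k \<otimes> a)))"
    by (simp add: inner)
  also have "\<dots> = int (card H) * (\<Sum>a\<in>H. z a * (\<Sum>h\<in>H. \<Sum>x\<in>H. z (h \<otimes> x \<otimes> inv h \<otimes> inv x \<otimes> a)))"
    by (subst sum.swap) simp
  finally show ?thesis .
qed

text \<open>The form is positive definite: the summands with \<open>h = 1\<close> in \<open>commutator_form\<close> are already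
  \<open>(|H| z(c))\<^sup>2\<close>.\<close>

lemma (in group) commutator_sum_invertible_over_int:
  assumes H: "subgroup H G" "finite H"
  shows "\<exists>(v :: 'a \<Rightarrow> int) N. N \<noteq> 0 \<and>
    (\<forall>a\<in>H. (\<Sum>h\<in>H. \<Sum>x\<in>H. v (h \<otimes> x \<otimes> inv h \<otimes> inv x \<otimes> a)) = (if a = \<one> then N else 0))"
proof -
  have [simp]: "a \<in> carrier G" if "a \<in> H" for a using H(1) that by (rule subgroup.mem_carrier)
  have [simp]: "inv a \<in> H" if "a \<in> H" for a using H(1) that by (rule subgroup.m_inv_closed)
  have [simp]: "a \<otimes> b \<in> H" if "a \<in> H" "b \<in> H" for a b
    using H(1) that by (rule subgroup.m_closed)
  have [simp]: "\<one> \<in> H" using H(1) by (rule subgroup.one_closed)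
  define M :: "'a \<Rightarrow> 'a \<Rightarrow> int" where
    "M a b = (\<Sum>h\<in>H. \<Sum>x\<in>H. if h \<otimes> x \<otimes> inv h \<otimes> inv x \<otimes> a = b then 1 else 0)" for a b
  have M: "(\<Sum>b\<in>H. M a b * z b) = (\<Sum>h\<in>H. \<Sum>x\<in>H. z (h \<otimes> x \<otimes> inv h \<otimes> inv x \<otimes> a))"
    if "a \<in> H" for a and z :: "'a \<Rightarrow> int"
  proof -
    have "(\<Sum>b\<in>H. M a b * z b)
        = (\<Sum>b\<in>H. \<Sum>h\<in>H. \<Sum>x\<in>H. if h \<otimes> x \<otimes> inv h \<otimes> inv x \<otimes> a = b then z b else 0)"
      unfolding M_def sum_distrib_right by (intro sum.cong) auto
    also have "\<dots> = (\<Sum>h\<in>H. \<Sum>b\<in>H. \<Sum>x\<in>H. if h \<otimes> x \<otimes> inv h \<otimes> inv x \<otimes> a = b then z b else 0)"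
      by (rule sum.swap)
    also have "\<dots> = (\<Sum>h\<in>H. \<Sum>x\<in>H. \<Sum>b\<in>H. if h \<otimes> x \<otimes> inv h \<otimes> inv x \<otimes> a = b then z b else 0)"
      by (intro sum.cong refl sum.swap)
    also have "\<dots> = (\<Sum>h\<in>H. \<Sum>x\<in>H. z (h \<otimes> x \<otimes> inv h \<otimes> inv x \<otimes> a))"
      using H(2) that by (intro sum.cong refl) (simp add: sum.delta)
    finally show ?thesis .
  qed
  have "\<exists>v N. N \<noteq> 0 \<and> (\<forall>a\<in>H. (\<Sum>b\<in>H. M a b * v b) = (if a = \<one> then N else 0))"
  proof (rule integer_system_solvable)
    fix z assume "\<And>a. a \<in> H \<Longrightarrow> (\<Sum>b\<in>H. M a b * z b) = 0"
    then have "(\<Sum>h\<in>H. \<Sum>c\<in>H. (\<Sum>x\<in>H. z (x \<otimes> h \<otimes> inv x \<otimes> c))\<^sup>2) = 0"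
      by (simp add: commutator_form[OF H(1)] M)
    then have "(\<Sum>c\<in>H. (\<Sum>x\<in>H. z (x \<otimes> h \<otimes> inv x \<otimes> c))\<^sup>2) = 0" if "h \<in> H" for h
      using that H(2) by (subst (asm) sum_nonneg_eq_0_iff) (auto intro: sum_nonneg)
    \<comment> \<open>Conjugates of the unit element are trivial, so the inner sum has \<open>|H|\<close> equal terms.\<close>
    from this[of \<one>] have "(\<Sum>c\<in>H. (int (card H) * z c)\<^sup>2) = 0"
      by simp
    then show "\<forall>a\<in>H. z a = 0"
      using H(2) by (subst (asm) sum_nonneg_eq_0_iff) auto
  qed (use H in auto)
  then show ?thesis
    by (simp add: M)
qed

context char_zero_group_algebra_extension
begin

lemma int_multiple_nonzero:
  assumes "N \<noteq> 0"
  shows "[(N::int)] \<cdot>\<^bsub>K\<^esub> \<one>\<^bsub>K\<^esub> \<noteq> \<zero>\<^bsub>K\<^esub>"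
proof (cases "N > 0")
  case True
  then show ?thesis using char_zero[of "nat N"] add_pow_int_ge[of N K "\<one>\<^bsub>K\<^esub>"] by simp
next
  case False
  then have "[N] \<cdot>\<^bsub>K\<^esub> \<one>\<^bsub>K\<^esub> = \<ominus>\<^bsub>K\<^esub> ([nat (- N)] \<cdot>\<^bsub>K\<^esub> \<one>\<^bsub>K\<^esub>)"
    using assms by (intro add_pow_int_lt) simp
  moreover have "[nat (- N)] \<cdot>\<^bsub>K\<^esub> \<one>\<^bsub>K\<^esub> \<noteq> \<zero>\<^bsub>K\<^esub>"
    using False assms by (intro char_zero) simp
  ultimately show ?thesis
    using K.minus_minus[of "[nat (- N)] \<cdot>\<^bsub>K\<^esub> \<one>\<^bsub>K\<^esub>"] by (auto simp del: K.minus_minus)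
qed

text \<open>The inverse is the integral solution divided by \<open>N\<close>.  It lies in \<open>kH\<close>, with which the commutator
  sum commutes, so it is a two-sided inverse and commutes with \<open>kH\<close> itself.\<close>

theorem commutator_sum_invertible:
  assumes central: "\<And>b h. b \<in> B \<Longrightarrow> h \<in> H \<Longrightarrow> b \<otimes>\<^bsub>A\<^esub> class_sum h = class_sum h \<otimes>\<^bsub>A\<^esub> b"
  shows "\<exists>u\<in>B. commutator_sum \<otimes>\<^bsub>A\<^esub> u = \<one>\<^bsub>A\<^esub> \<and> (\<forall>b\<in>B. b \<otimes>\<^bsub>A\<^esub> u = u \<otimes>\<^bsub>A\<^esub> b)"
proof -
  obtain v N where N: "N \<noteq> 0" and v: "\<forall>a\<in>H. (\<Sum>h\<in>H. \<Sum>x\<in>H.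
      v (h \<otimes>\<^bsub>G\<^esub> x \<otimes>\<^bsub>G\<^esub> inv\<^bsub>G\<^esub> h \<otimes>\<^bsub>G\<^esub> inv\<^bsub>G\<^esub> x \<otimes>\<^bsub>G\<^esub> a)) = (if a = \<one>\<^bsub>G\<^esub> then N else (0::int))"
    using G.commutator_sum_invertible_over_int[OF H.subgroup_axioms finite_H] by blast
  define k where "k = [N] \<cdot>\<^bsub>K\<^esub> \<one>\<^bsub>K\<^esub>"
  have k: "k \<in> carrier K" "k \<noteq> \<zero>\<^bsub>K\<^esub>"
    using int_multiple_nonzero[OF N] by (auto simp: k_def intro!: K.add.int_pow_closed)
  note ki = scalar_inverse[OF k]
  let ?w = commutator_sum
  define u where "u = scalar (inv\<^bsub>K\<^esub> k) \<otimes>\<^bsub>A\<^esub> int_element v"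
  have v_B: "int_element v \<in> B" by (rule int_element_in_B)
  have u_B: "u \<in> B"
    unfolding u_def using ki(1) v_B H.one_closed by (intro subringE(6)[OF subring_B]) simp_all
  have u: "u \<in> carrier A" by (rule B_in_A[OF u_B])
  have w: "?w \<in> carrier A" by (rule commutator_sum_closed)
  have "?w \<otimes>\<^bsub>A\<^esub> u = scalar (inv\<^bsub>K\<^esub> k) \<otimes>\<^bsub>A\<^esub> (?w \<otimes>\<^bsub>A\<^esub> int_element v)"
    using scalar_central[OF ki(1) w] ki(1) w B_in_A[OF v_B] unfolding u_def
    by (metis A.m_assoc G.one_closed single_closed)
  also have "\<dots> = \<one>\<^bsub>A\<^esub>"
    using commutator_sum_times_int_element[OF v] ki(2) by (simp add: k_def)
  finally have wu: "?w \<otimes>\<^bsub>A\<^esub> u = \<one>\<^bsub>A\<^esub>" .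
  have w_comm: "b \<otimes>\<^bsub>A\<^esub> ?w = ?w \<otimes>\<^bsub>A\<^esub> b" if "b \<in> B" for b
    using that central by (intro commutator_sum_commutes)
  have "b \<otimes>\<^bsub>A\<^esub> u = u \<otimes>\<^bsub>A\<^esub> b" if b: "b \<in> B" for b
  proof -
    have bA: "b \<in> carrier A" by (rule B_in_A[OF b])
    have "u \<otimes>\<^bsub>A\<^esub> b = u \<otimes>\<^bsub>A\<^esub> (b \<otimes>\<^bsub>A\<^esub> (?w \<otimes>\<^bsub>A\<^esub> u))"
      using u bA by (simp add: wu)
    also have "\<dots> = u \<otimes>\<^bsub>A\<^esub> ((b \<otimes>\<^bsub>A\<^esub> ?w) \<otimes>\<^bsub>A\<^esub> u)"
      using u w bA by (simp add: A.m_assoc)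
    also have "\<dots> = (u \<otimes>\<^bsub>A\<^esub> ?w) \<otimes>\<^bsub>A\<^esub> (b \<otimes>\<^bsub>A\<^esub> u)"
      using u w bA by (simp add: w_comm[OF b] A.m_assoc)
    also have "\<dots> = b \<otimes>\<^bsub>A\<^esub> u"
      using u bA by (simp add: w_comm[OF u_B] wu)
    finally show ?thesis ..
  qed
  with u_B wu show ?thesis by blast
qed

text \<open>The maps \<open>f\<close> are bimodule maps because class sums are central.  The factors \<open>r\<close> absorb the inverse
  of \<open>|H|\<close> times the commutator sum in \<open>averaged_projection_expansion\<close>.\<close>

end

section \<open>Depth one\<close>

context char_zero_group_algebra_extension
begin

theorem depth_one_if_uniquely_separable:
  assumes "uniquely_separable A B"
  shows "depth_one A B"
proof -
  have central: "a \<otimes>\<^bsub>A\<^esub> class_sum g = class_sum g \<otimes>\<^bsub>A\<^esub> a" if "a \<in> carrier A" "g \<in> carrier G" for a g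
    using that by (intro conj_sum_central_if_uniquely_separable[OF assms]) auto
  obtain u where u_B: "u \<in> B" and wu: "commutator_sum \<otimes>\<^bsub>A\<^esub> u = \<one>\<^bsub>A\<^esub>"
    and u_comm: "\<And>b. b \<in> B \<Longrightarrow> b \<otimes>\<^bsub>A\<^esub> u = u \<otimes>\<^bsub>A\<^esub> b"
    using commutator_sum_invertible central B_in_A H_in_G by metis
  have u: "u \<in> carrier A" by (rule B_in_A[OF u_B])
  define m where "m = [card H] \<cdot>\<^bsub>K\<^esub> \<one>\<^bsub>K\<^esub>"
  have "card H > 0" using finite_H H.one_closed by (metis card_gt_0_iff empty_iff)
  then have m: "m \<in> carrier K" "m \<noteq> \<zero>\<^bsub>K\<^esub>" using char_zero by (simp_all add: m_def)
  note mi = scalar_inverse[OF m]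
  define s where "s = scalar (inv\<^bsub>K\<^esub> m) \<otimes>\<^bsub>A\<^esub> u"
  have s: "s \<in> carrier A" using mi(1) u by (simp add: s_def)
  have s_comm: "b \<otimes>\<^bsub>A\<^esub> s = s \<otimes>\<^bsub>A\<^esub> b" if "b \<in> B" for b
    using u_comm[OF that] scalar_central[OF mi(1) B_in_A[OF that]] mi(1) u B_in_A[OF that]
    unfolding s_def by (metis A.m_assoc G.one_closed single_closed)
  define f where "f g a = E (a \<otimes>\<^bsub>A\<^esub> class_sum (inv\<^bsub>G\<^esub> g))" for g a
  define r where "r g = class_sum g \<otimes>\<^bsub>A\<^esub> s" for g
  show ?thesis
  proof (rule depth_one_if_dual_bases[OF ring_A subring_B fin])
    show "carrier G \<noteq> {}" using G.one_closed by blast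
  next
    fix g assume g: "g \<in> carrier G"
    have c: "class_sum (inv\<^bsub>G\<^esub> g) \<in> carrier A" using g by (simp add: class_sum_closed)
    have "f g (a \<otimes>\<^bsub>A\<^esub> b) = f g a \<otimes>\<^bsub>A\<^esub> b" if "a \<in> carrier A" "b \<in> B" for a b
    proof -
      have "a \<otimes>\<^bsub>A\<^esub> b \<otimes>\<^bsub>A\<^esub> class_sum (inv\<^bsub>G\<^esub> g) = a \<otimes>\<^bsub>A\<^esub> class_sum (inv\<^bsub>G\<^esub> g) \<otimes>\<^bsub>A\<^esub> b"
        using that c g central[OF B_in_A[OF that(2)], of "inv\<^bsub>G\<^esub> g"] B_in_A[OF that(2)] by (simp add: A.m_assoc)
      then show ?thesis using that c by (simp add: f_def E_right_linear)
    qed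
    moreover have "f g (b \<otimes>\<^bsub>A\<^esub> a) = b \<otimes>\<^bsub>A\<^esub> f g a" if "a \<in> carrier A" "b \<in> B" for a b
      using that c by (simp add: f_def A.m_assoc B_in_A E_left_linear)
    moreover have "f g a \<in> B" if "a \<in> carrier A" for a
      using that c by (simp add: f_def E_in_B)
    moreover have "f g (a \<oplus>\<^bsub>A\<^esub> a') = f g a \<oplus>\<^bsub>A\<^esub> f g a'" if "a \<in> carrier A" "a' \<in> carrier A" for a a'
      using that c by (simp add: f_def A.l_distr E_add)
    ultimately show "f g \<in> bimodule_hom (A\<lparr>carrier := B\<rparr>) (A\<lparr>carrier := B\<rparr>)
        (regular_bimodule A (carrier A)) (regular_bimodule A B)"
      by (simp add: bimodule_hom_def hom_def)
    show r_g: "r g \<in> carrier A" using g s by (simp add: r_def class_sum_closed)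
    fix b assume b: "b \<in> B"
    show "b \<otimes>\<^bsub>A\<^esub> r g = r g \<otimes>\<^bsub>A\<^esub> b"
      using g s class_sum_closed[OF g] B_in_A[OF b] central[OF B_in_A[OF b] g] s_comm[OF b]
      unfolding r_def by (metis A.m_assoc)
  next
    fix a assume a: "a \<in> carrier A"
    have w: "a \<otimes>\<^bsub>A\<^esub> commutator_sum \<in> carrier A" using a by (simp add: commutator_sum_closed)
    have f_closed: "f g a \<in> carrier A" if "g \<in> carrier G" for g
      using that a by (simp add: f_def class_sum_closed)
    have "(\<Oplus>\<^bsub>A\<^esub>g\<in>carrier G. f g a \<otimes>\<^bsub>A\<^esub> r g) = (\<Oplus>\<^bsub>A\<^esub>g\<in>carrier G. (f g a \<otimes>\<^bsub>A\<^esub> class_sum g) \<otimes>\<^bsub>A\<^esub> s)"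
      using s f_closed by (intro A.finsum_cong') (auto simp: r_def A.m_assoc class_sum_closed)
    also have "\<dots> = (\<Oplus>\<^bsub>A\<^esub>g\<in>carrier G. f g a \<otimes>\<^bsub>A\<^esub> class_sum g) \<otimes>\<^bsub>A\<^esub> s"
      using s f_closed by (intro A.finsum_ldistr[symmetric] fin) (auto simp: class_sum_closed)
    also have "(\<Oplus>\<^bsub>A\<^esub>g\<in>carrier G. f g a \<otimes>\<^bsub>A\<^esub> class_sum g) = [card H] \<cdot>\<^bsub>A\<^esub> (a \<otimes>\<^bsub>A\<^esub> commutator_sum)"
      unfolding f_def using a central by (intro averaged_projection_expansion) auto
    also have "\<dots> = scalar m \<otimes>\<^bsub>A\<^esub> (a \<otimes>\<^bsub>A\<^esub> commutator_sum)"
      using w by (simp add: multiple_eq_scalar m_def)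
    also have "\<dots> \<otimes>\<^bsub>A\<^esub> s = (a \<otimes>\<^bsub>A\<^esub> commutator_sum) \<otimes>\<^bsub>A\<^esub> (scalar m \<otimes>\<^bsub>A\<^esub> s)"
      using scalar_central[OF m(1) w] m(1) w s by (simp add: A.m_assoc)
    also have "scalar m \<otimes>\<^bsub>A\<^esub> s = u"
      using mi scalar_central[OF mi(1), of "scalar m"] m u
      by (simp add: s_def A.m_assoc[symmetric] del: single_mult)
    also have "(a \<otimes>\<^bsub>A\<^esub> commutator_sum) \<otimes>\<^bsub>A\<^esub> u = a"
      using a u commutator_sum_closed wu by (simp add: A.m_assoc)
    finally show "(\<Oplus>\<^bsub>A\<^esub>g\<in>carrier G. f g a \<otimes>\<^bsub>A\<^esub> r g) = a" .
  qed
qed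

end

theorem proposition5p3:
  fixes K :: "('k, 'x) ring_scheme" and G :: "('g, 'y) monoid_scheme" and H :: "'g set"
  assumes "field K" and "\<forall>n::nat. n > 0 \<longrightarrow> [n] \<cdot>\<^bsub>K\<^esub> \<one>\<^bsub>K\<^esub> \<noteq> \<zero>\<^bsub>K\<^esub>"
    and "group G" and "finite (carrier G)" and "subgroup H G"
    and "uniquely_separable (group_algebra K G) (subgroup_algebra K G H)"
  shows "depth_one (group_algebra K G) (subgroup_algebra K G H)"
proof -
  interpret K: field K by fact
  interpret G: group G by fact
  interpret H: subgroup H G by fact
  interpret char_zero_group_algebra_extension K G H
    using assms by unfold_locales auto
  show ?thesis using assms(6) by (rule depth_one_if_uniquely_separable)
qed

end
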